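(* Let $\mathsf G$ be a discrete, amenable and rigidly symmetric group, let $\mathcal A(\mathsf G)$ be a unital $C^*$-subalgebra of $\ell^\infty(\mathsf G)$ that is invariant under translations, and let $\omega$ be an $\mathcal A(\mathsf G)$-valued $2$-cocycle. Then $\mathbb I^{\mathcal A}_\lambda(\mathsf G)$ is a $*$-subalgebra of $\mathbb B[\ell^2(\mathsf G)]$ that is inverse closed and Fredholm inverse closed.
   Context: A Banach $*$-algebra is symmetric if the spectrum of $B^*B$ is contained in $[0,\infty)$ for every element $B$ (spectrum in the unitization if there is no unit). A discrete group $\mathsf G$ (unit $\mathsf e$) is rigidly symmetric if for every $C^*$-algebra $\mathcal B$ the Banach $*$-algebra $\ell^1(\mathsf G;\mathcal B)\cong\ell^1(\mathsf G)\widehat\otimes\mathcal B$ (convolution $(f\star g)(x)=\sum_y f(y)g(y^{-1}x)$, involution $f^\star(x)=f(x^{-1})^*$) is symmetric. Translations: $[\alpha_x(\varphi)](y)=\varphi(x^{-1}y)$; invariance under translations means $\alpha_x(\mathcal A(\mathsf G))\subset\mathcal A(\mathsf G)$ for all $x$. An $\mathcal A(\mathsf G)$-valued $2$-cocycle is a map $\omega:\mathsf G\times\mathsf G\to\mathcal A(\mathsf G)$ with unitary (i.e. $\mathbb T$-valued) values satisfying $\omega(x,y)\omega(xy,z)=\alpha_x[\omega(y,z)]\omega(x,yz)$ and $\omega(x,\mathsf e)=1=\omega(\mathsf e,x)$; write $\omega(x,y;q):=[\omega(x,y)](q)$ and set $\lambda(x,y):=\omega(x^{-1},xy^{-1};\mathsf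 e)$. $\mathfrak K^{\mathcal A}_\omega(\mathsf G\times\mathsf G)$ is the set of kernels $\mathsf K:\mathsf G\times\mathsf G\to\mathbb C$ such that for some $k\in\ell^1(\mathsf G)$ one has $|\mathsf K(x,y)|\le|k(xy^{-1})|$ for all $x,y$, and such that $z\mapsto\mathsf K(xz,yz)$ belongs to $\mathcal A(\mathsf G)$ for all $x,y\in\mathsf G$. For such $\mathsf K$ define the bounded operator on $\ell^2(\mathsf G)$ $$[\mathsf{Int}_\lambda(\mathsf K)v](x)=\sum_{y\in\mathsf G}\mathsf K(x,y)\lambda(x,y)v(y),$$ and set $\mathbb I^{\mathcal A}_\lambda(\mathsf G):=\{\mathsf{Int}_\lambda(\mathsf K)\mid\mathsf K\in\mathfrak K^{\mathcal A}_\omega(\mathsf G\times\mathsf G)\}$. A $*$-subalgebra $\mathfrak B$ of a unital $C^*$-algebra $\mathfrak C$ is inverse closed if every $f\in\mathfrak B$ invertible in $\mathfrak C$ satisfies $f^{-1}\in\mathfrak B$; here $\mathfrak C=\mathbb B[\ell^2(\mathsf G)]$. A $*$-algebra $\mathfrak F\subset\mathbb B(\mathscr H)$ is Fredholm inverse closed if for every Fredholm operator $T\in\mathfrak F$ there exist $S\in\mathfrak F$ and compact operators $K,L\in\mathbb K(\mathscr H)$ with $ST=1+K$ and $TS=1+L$. *)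

theory Defs
  imports "HOL-Analysis.Analysis" "HOL-Algebra.FiniteProduct"
begin

text \<open>
  The discrete group is a type \<open>'g\<close> of class \<^class>\<open>group_add\<close>, which is the library's class of
  (not necessarily commutative) groups. It is written additively: \<open>xy\<close>, \<open>x\<inverse>\<close>, \<open>e\<close>, \<open>xy\<inverse>\<close>
  become \<open>x + y\<close>, \<open>- x\<close>, \<open>0\<close>, \<open>x - y\<close>.
\<close>

section \<open>The Hilbert space of square-summable functions\<close>

typedef 'a ell2 = "{f :: 'a \<Rightarrow> complex. (\<lambda>x. (cmod (f x))\<^sup>2) summable_on UNIV}"
  morphisms ell2_fun Abs_ell2
  by (rule exI[of _ "\<lambda>_. 0"]) simp

lemma ell2_summable: "(\<lambda>x. (cmod (ell2_fun v x))\<^sup>2) summable_on UNIV"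
  using ell2_fun by blast

lemma ell2_eqI: "(\<And>x. ell2_fun v x = ell2_fun w x) \<Longrightarrow> v = w"
  by (metis ell2_fun_inject ext)

lemma ell2_add_aux:
  fixes f g :: "'a \<Rightarrow> complex"
  assumes "(\<lambda>x. (cmod (f x))\<^sup>2) summable_on UNIV" "(\<lambda>x. (cmod (g x))\<^sup>2) summable_on UNIV"
  shows "(\<lambda>x. (cmod (f x + g x))\<^sup>2) summable_on UNIV"
proof (rule summable_on_comparison_test[OF summable_on_add[OF
        summable_on_cmult_right[OF assms(1), of 2] summable_on_cmult_right[OF assms(2), of 2]]])
  fix x
  have "(cmod (f x + g x))\<^sup>2 \<le> (cmod (f x) + cmod (g x))\<^sup>2"
    by (simp add: norm_triangle_ineq power_mono)
  also have "\<dots> \<le> 2 * (cmod (f x))\<^sup>2 + 2 * (cmod (g x))\<^sup>2"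
    using sum_squares_bound[of "cmod (f x)" "cmod (g x)"] by (simp add: power2_sum)
  finally show "(cmod (f x + g x))\<^sup>2 \<le> 2 * (cmod (f x))\<^sup>2 + 2 * (cmod (g x))\<^sup>2" .
qed auto

lemma ell2_scale_aux:
  fixes f :: "'a \<Rightarrow> complex"
  assumes "(\<lambda>x. (cmod (f x))\<^sup>2) summable_on UNIV"
  shows "(\<lambda>x. (cmod (c * f x))\<^sup>2) summable_on UNIV"
  using summable_on_cmult_right[OF assms, of "(cmod c)\<^sup>2"]
  by (simp add: norm_mult power_mult_distrib)

definition ell2_scale :: "complex \<Rightarrow> 'a ell2 \<Rightarrow> 'a ell2" where
  "ell2_scale c v = Abs_ell2 (\<lambda>x. c * ell2_fun v x)"

definition ell2_cinner :: "'a ell2 \<Rightarrow> 'a ell2 \<Rightarrow> complex" where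
  "ell2_cinner v w = (\<Sum>\<^sub>\<infinity>x. ell2_fun v x * cnj (ell2_fun w x))"

lemma ell2_fun_scale [simp]: "ell2_fun (ell2_scale c v) x = c * ell2_fun v x"
  unfolding ell2_scale_def using ell2_scale_aux[OF ell2_summable] by (subst Abs_ell2_inverse) auto

instantiation ell2 :: (type) real_inner
begin

definition "0 = Abs_ell2 (\<lambda>_. 0)"
definition "v + w = Abs_ell2 (\<lambda>x. ell2_fun v x + ell2_fun w x)"
definition "scaleR r v = ell2_scale (complex_of_real r) v"
definition "- v = ell2_scale (-1) (v :: 'a ell2)"
definition "v - w = v + (- w :: 'a ell2)"
definition "inner v w = Re (ell2_cinner v w)"
definition "norm v = sqrt (\<Sum>\<^sub>\<infinity>x. (cmod (ell2_fun v x))\<^sup>2)"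
definition "dist v w = norm (v - w :: 'a ell2)"
definition "sgn v = inverse (norm v) *\<^sub>R (v :: 'a ell2)"
definition "(uniformity :: ('a ell2 \<times> 'a ell2) filter) =
  (INF e\<in>{0 <..}. principal {(x, y). dist x y < e})"
definition "open (U :: 'a ell2 set) \<longleftrightarrow>
  (\<forall>x\<in>U. eventually (\<lambda>(x', y). x' = x \<longrightarrow> y \<in> U) uniformity)"

lemma ell2_fun_zero: "ell2_fun 0 x = 0"
  unfolding zero_ell2_def by (subst Abs_ell2_inverse) auto

lemma ell2_fun_add: "ell2_fun (v + w) x = ell2_fun v x + ell2_fun w x"
  unfolding plus_ell2_def using ell2_add_aux[OF ell2_summable ell2_summable]
  by (subst Abs_ell2_inverse) auto

lemma ell2_cinner_summable:
  "(\<lambda>x. ell2_fun v x * cnj (ell2_fun w x)) summable_on UNIV"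
proof (rule abs_summable_summable[OF abs_summable_product])
  show "(\<lambda>x. norm (ell2_fun v x * ell2_fun v x)) summable_on UNIV"
    using ell2_summable[of v] by (simp add: norm_mult power2_eq_square)
  show "(\<lambda>x. norm (cnj (ell2_fun w x) * cnj (ell2_fun w x))) summable_on UNIV"
    using ell2_summable[of w] by (simp add: norm_mult power2_eq_square)
qed

lemma ell2_cinner_add_left: "ell2_cinner (u + v) w = ell2_cinner u w + ell2_cinner v w"
  unfolding ell2_cinner_def
  by (simp add: ell2_fun_add distrib_right infsum_add ell2_cinner_summable)

lemma ell2_cinner_scale_left: "ell2_cinner (ell2_scale c v) w = c * ell2_cinner v w"
  unfolding ell2_cinner_def by (simp add: mult.assoc infsum_cmult_right')

lemma ell2_cinner_commute: "ell2_cinner v w = cnj (ell2_cinner w v)"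
  unfolding ell2_cinner_def by (simp add: infsum_cnj[symmetric] mult.commute)

lemma ell2_cinner_self:
  "ell2_cinner v v = complex_of_real (\<Sum>\<^sub>\<infinity>x. (cmod (ell2_fun v x))\<^sup>2)"
proof -
  have "ell2_cinner v v = (\<Sum>\<^sub>\<infinity>x. complex_of_real ((cmod (ell2_fun v x))\<^sup>2))"
    unfolding ell2_cinner_def by (simp add: complex_norm_square[symmetric])
  also have "\<dots> = complex_of_real (\<Sum>\<^sub>\<infinity>x. (cmod (ell2_fun v x))\<^sup>2)"
    by (rule infsumI[OF has_sum_of_real[OF has_sum_infsum[OF ell2_summable]]])
  finally show ?thesis .
qed

instance
proof
  fix u v w :: "'a ell2" and r s :: real
  show "u + v + w = u + (v + w)" "u + v = v + u" "0 + u = u" "- u + u = 0"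
    by (rule ell2_eqI; simp add: ell2_fun_add ell2_fun_zero uminus_ell2_def)+
  show "u - v = u + - v" "dist u v = norm (u - v)" "sgn u = inverse (norm u) *\<^sub>R u"
    by (simp_all add: minus_ell2_def dist_ell2_def sgn_ell2_def)
  show "r *\<^sub>R (u + v) = r *\<^sub>R u + r *\<^sub>R v" "(r + s) *\<^sub>R u = r *\<^sub>R u + s *\<^sub>R u"
    "r *\<^sub>R s *\<^sub>R u = (r * s) *\<^sub>R u" "1 *\<^sub>R u = u"
    by (rule ell2_eqI; simp add: ell2_fun_add scaleR_ell2_def algebra_simps)+
  show "inner u v = inner v u"
    unfolding inner_ell2_def by (subst ell2_cinner_commute) simp
  show "inner (u + v) w = inner u w + inner v w" "inner (r *\<^sub>R u) v = r * inner u v"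
    by (simp_all add: inner_ell2_def ell2_cinner_add_left scaleR_ell2_def ell2_cinner_scale_left)
  show "0 \<le> inner u u"
    by (simp add: inner_ell2_def ell2_cinner_self infsum_nonneg)
  show "norm u = sqrt (inner u u)"
    by (simp add: inner_ell2_def ell2_cinner_self norm_ell2_def)
  show "inner u u = 0 \<longleftrightarrow> u = 0"
  proof
    assume "inner u u = 0"
    then have "(\<Sum>\<^sub>\<infinity>x. (cmod (ell2_fun u x))\<^sup>2) = 0"
      by (simp add: inner_ell2_def ell2_cinner_self)
    then have "(cmod (ell2_fun u x))\<^sup>2 = 0" for x
      using nonneg_infsum_le_0D[of "\<lambda>x. (cmod (ell2_fun u x))\<^sup>2" UNIV x] ell2_summable[of u]
      by simp
    then show "u = 0"
      by (intro ell2_eqI) (simp add: ell2_fun_zero)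
  qed (simp add: inner_ell2_def ell2_cinner_def ell2_fun_zero)
qed (simp_all add: uniformity_ell2_def open_ell2_def)

end

declare ell2_fun_zero [simp] ell2_fun_add [simp]

interpretation ell2: vector_space "ell2_scale :: complex \<Rightarrow> 'a ell2 \<Rightarrow> 'a ell2"
  by unfold_locales (rule ell2_eqI; simp add: algebra_simps)+

section \<open>Operators on this Hilbert space\<close>

text \<open>
  The library's type of bounded operators consists of the real-linear ones;
  \<open>ell2_ops\<close> is the C*-algebra of bounded complex-linear operators.
\<close>

definition ell2_ops :: "('a ell2 \<Rightarrow>\<^sub>L 'a ell2) set" where
  "ell2_ops = {T :: 'a ell2 \<Rightarrow>\<^sub>L 'a ell2. \<forall>c v. T (ell2_scale c v) = ell2_scale c (T v)}"

definition op_scale :: "complex \<Rightarrow> ('a ell2 \<Rightarrow>\<^sub>L 'a ell2) \<Rightarrow> ('a ell2 \<Rightarrow>\<^sub>L 'a ell2)" where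
  "op_scale c T = Blinfun (\<lambda>v. ell2_scale c (T v))"

definition op_adj :: "('a ell2 \<Rightarrow>\<^sub>L 'a ell2) \<Rightarrow> ('a ell2 \<Rightarrow>\<^sub>L 'a ell2)" where
  "op_adj T = (THE S. S \<in> ell2_ops \<and> (\<forall>v w. ell2_cinner (S v) w = ell2_cinner v (T w)))"

definition star_subalgebra :: "('a ell2 \<Rightarrow>\<^sub>L 'a ell2) set \<Rightarrow> bool" where
  "star_subalgebra F \<longleftrightarrow> F \<subseteq> ell2_ops \<and> 0 \<in> F \<and>
     (\<forall>S\<in>F. \<forall>T\<in>F. S + T \<in> F) \<and> (\<forall>c. \<forall>T\<in>F. op_scale c T \<in> F) \<and>
     (\<forall>S\<in>F. \<forall>T\<in>F. S o\<^sub>L T \<in> F) \<and> (\<forall>T\<in>F. op_adj T \<in> F)"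

definition inverse_closed :: "('a ell2 \<Rightarrow>\<^sub>L 'a ell2) set \<Rightarrow> bool" where
  "inverse_closed F \<longleftrightarrow>
     (\<forall>T\<in>F. \<forall>S\<in>ell2_ops. S o\<^sub>L T = id_blinfun \<and> T o\<^sub>L S = id_blinfun \<longrightarrow> S \<in> F)"

definition compact_ops :: "('a ell2 \<Rightarrow>\<^sub>L 'a ell2) set" where
  "compact_ops = {K \<in> ell2_ops. compact (closure (blinfun_apply K ` cball 0 1))}"

text \<open>Finite-dimensional kernel, closed range, finite-dimensional cokernel (all over the complex
  numbers: \<open>ell2.span\<close> is the span with respect to \<open>ell2_scale\<close>).\<close>

definition fredholm :: "('a ell2 \<Rightarrow>\<^sub>L 'a ell2) \<Rightarrow> bool" where
  "fredholm T \<longleftrightarrow> T \<in> ell2_ops \<and>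
     (\<exists>B. finite B \<and> {v. T v = 0} \<subseteq> ell2.span B) \<and>
     closed (range (blinfun_apply T)) \<and>
     (\<exists>B. finite B \<and> (\<forall>v. \<exists>u. v - T u \<in> ell2.span B))"

definition fredholm_inverse_closed :: "('a ell2 \<Rightarrow>\<^sub>L 'a ell2) set \<Rightarrow> bool" where
  "fredholm_inverse_closed F \<longleftrightarrow>
     (\<forall>T\<in>F. fredholm T \<longrightarrow>
       (\<exists>S\<in>F. \<exists>K\<in>compact_ops. \<exists>L\<in>compact_ops.
          S o\<^sub>L T = id_blinfun + K \<and> T o\<^sub>L S = id_blinfun + L))"

section \<open>Banach *-algebras, symmetry\<close>

text \<open>
  C*-algebras have to be quantified over inside a hypothesis, so they are
  structures with an explicit carrier. No unit is part of the structure.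
\<close>

record 'b star_alg = "'b partial_object" +
  alg_zero :: 'b
  alg_add :: "'b \<Rightarrow> 'b \<Rightarrow> 'b"
  alg_scale :: "complex \<Rightarrow> 'b \<Rightarrow> 'b"
  alg_mult :: "'b \<Rightarrow> 'b \<Rightarrow> 'b"
  alg_star :: "'b \<Rightarrow> 'b"
  alg_norm :: "'b \<Rightarrow> real"

definition add_group :: "'b star_alg \<Rightarrow> 'b monoid" where
  "add_group B = \<lparr>carrier = carrier B, monoid.mult = alg_add B, one = alg_zero B\<rparr>"

definition alg_diff :: "'b star_alg \<Rightarrow> 'b \<Rightarrow> 'b \<Rightarrow> 'b" where
  "alg_diff B a b = alg_add B a (alg_scale B (-1) b)"

locale banach_star_algebra =
  fixes B :: "'b star_alg" (structure)
  assumes add_comm_group: "comm_group (add_group B)"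
    and scale_closed: "a \<in> carrier B \<Longrightarrow> alg_scale B z a \<in> carrier B"
    and scale_add_right: "a \<in> carrier B \<Longrightarrow> b \<in> carrier B \<Longrightarrow>
      alg_scale B z (alg_add B a b) = alg_add B (alg_scale B z a) (alg_scale B z b)"
    and scale_add_left: "a \<in> carrier B \<Longrightarrow>
      alg_scale B (z + z') a = alg_add B (alg_scale B z a) (alg_scale B z' a)"
    and scale_scale: "a \<in> carrier B \<Longrightarrow> alg_scale B z (alg_scale B z' a) = alg_scale B (z * z') a"
    and scale_one: "a \<in> carrier B \<Longrightarrow> alg_scale B 1 a = a"
    and mult_closed: "a \<in> carrier B \<Longrightarrow> b \<in> carrier B \<Longrightarrow> alg_mult B a b \<in> carrier B"
    and mult_assoc: "a \<in> carrier B \<Longrightarrow> b \<in> carrier B \<Longrightarrow> c \<in> carrier B \<Longrightarrow>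
      alg_mult B (alg_mult B a b) c = alg_mult B a (alg_mult B b c)"
    and mult_add_left: "a \<in> carrier B \<Longrightarrow> b \<in> carrier B \<Longrightarrow> c \<in> carrier B \<Longrightarrow>
      alg_mult B (alg_add B a b) c = alg_add B (alg_mult B a c) (alg_mult B b c)"
    and mult_add_right: "a \<in> carrier B \<Longrightarrow> b \<in> carrier B \<Longrightarrow> c \<in> carrier B \<Longrightarrow>
      alg_mult B a (alg_add B b c) = alg_add B (alg_mult B a b) (alg_mult B a c)"
    and mult_scale_left: "a \<in> carrier B \<Longrightarrow> b \<in> carrier B \<Longrightarrow>
      alg_mult B (alg_scale B z a) b = alg_scale B z (alg_mult B a b)"
    and mult_scale_right: "a \<in> carrier B \<Longrightarrow> b \<in> carrier B \<Longrightarrow>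
      alg_mult B a (alg_scale B z b) = alg_scale B z (alg_mult B a b)"
    and norm_nonneg: "a \<in> carrier B \<Longrightarrow> 0 \<le> alg_norm B a"
    and norm_eq_zero: "a \<in> carrier B \<Longrightarrow> alg_norm B a = 0 \<longleftrightarrow> a = alg_zero B"
    and norm_scale: "a \<in> carrier B \<Longrightarrow> alg_norm B (alg_scale B z a) = cmod z * alg_norm B a"
    and norm_add: "a \<in> carrier B \<Longrightarrow> b \<in> carrier B \<Longrightarrow>
      alg_norm B (alg_add B a b) \<le> alg_norm B a + alg_norm B b"
    and norm_mult: "a \<in> carrier B \<Longrightarrow> b \<in> carrier B \<Longrightarrow>
      alg_norm B (alg_mult B a b) \<le> alg_norm B a * alg_norm B b"
    and complete: "(\<And>n :: nat. s n \<in> carrier B) \<Longrightarrow>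
      (\<And>e. 0 < e \<Longrightarrow> \<exists>N. \<forall>m\<ge>N. \<forall>n\<ge>N. alg_norm B (alg_diff B (s m) (s n)) < e) \<Longrightarrow>
      \<exists>l\<in>carrier B. (\<lambda>n. alg_norm B (alg_diff B (s n) l)) \<longlonglongrightarrow> 0"
    and star_closed: "a \<in> carrier B \<Longrightarrow> alg_star B a \<in> carrier B"
    and star_star: "a \<in> carrier B \<Longrightarrow> alg_star B (alg_star B a) = a"
    and star_add: "a \<in> carrier B \<Longrightarrow> b \<in> carrier B \<Longrightarrow>
      alg_star B (alg_add B a b) = alg_add B (alg_star B a) (alg_star B b)"
    and star_scale: "a \<in> carrier B \<Longrightarrow>
      alg_star B (alg_scale B z a) = alg_scale B (cnj z) (alg_star B a)"
    and star_mult: "a \<in> carrier B \<Longrightarrow> b \<in> carrier B \<Longrightarrow>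
      alg_star B (alg_mult B a b) = alg_mult B (alg_star B b) (alg_star B a)"
    and norm_star: "a \<in> carrier B \<Longrightarrow> alg_norm B (alg_star B a) = alg_norm B a"

locale cstar_algebra = banach_star_algebra +
  assumes cstar_identity: "a \<in> carrier B \<Longrightarrow>
    alg_norm B (alg_mult B (alg_star B a) a) = (alg_norm B a)\<^sup>2"

definition is_unit_of :: "'b star_alg \<Rightarrow> 'b \<Rightarrow> bool" where
  "is_unit_of B u \<longleftrightarrow> u \<in> carrier B \<and>
     (\<forall>a\<in>carrier B. alg_mult B u a = a \<and> alg_mult B a u = a)"

text \<open>The unitization; \<open>(z, a)\<close> stands for \<open>z 1 + a\<close>.\<close>

definition unitization :: "'b star_alg \<Rightarrow> (complex \<times> 'b) star_alg" where
  "unitization B =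
    \<lparr>carrier = UNIV \<times> carrier B,
     alg_zero = (0, alg_zero B),
     alg_add = (\<lambda>(z, a) (w, b). (z + w, alg_add B a b)),
     alg_scale = (\<lambda>c (z, a). (c * z, alg_scale B c a)),
     alg_mult = (\<lambda>(z, a) (w, b). (z * w,
        alg_add B (alg_add B (alg_scale B z b) (alg_scale B w a)) (alg_mult B a b))),
     alg_star = (\<lambda>(z, a). (cnj z, alg_star B a)),
     alg_norm = (\<lambda>(z, a). cmod z + alg_norm B a)\<rparr>"

definition spectrum_wrt :: "'b star_alg \<Rightarrow> 'b \<Rightarrow> 'b \<Rightarrow> complex set" where
  "spectrum_wrt B u a =
    {z. \<not> (\<exists>c\<in>carrier B. alg_mult B c (alg_diff B (alg_scale B z u) a) = u \<and>
                         alg_mult B (alg_diff B (alg_scale B z u) a) c = u)}"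

definition alg_spectrum :: "'b star_alg \<Rightarrow> 'b \<Rightarrow> complex set" where
  "alg_spectrum B a =
    (if \<exists>u. is_unit_of B u then spectrum_wrt B (THE u. is_unit_of B u) a
     else spectrum_wrt (unitization B) (1, alg_zero B) (0, a))"

definition symmetric_algebra :: "'b star_alg \<Rightarrow> bool" where
  "symmetric_algebra B \<longleftrightarrow>
    (\<forall>b\<in>carrier B. alg_spectrum B (alg_mult B (alg_star B b) b) \<subseteq> complex_of_real ` {0..})"

section \<open>Rigidly symmetric groups, amenable groups\<close>

text \<open>The norm limit of the net of finite partial sums.\<close>

definition alg_infsum :: "'b star_alg \<Rightarrow> ('i \<Rightarrow> 'b) \<Rightarrow> 'b" where
  "alg_infsum B h = (THE s. s \<in> carrier B \<and>
     ((\<lambda>F. alg_norm B (alg_diff B (finprod (add_group B) h F) s)) \<longlongrightarrow> 0)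
       (finite_subsets_at_top UNIV))"

definition l1_algebra :: "'b star_alg \<Rightarrow> ('g::group_add \<Rightarrow> 'b) star_alg" where
  "l1_algebra B =
    \<lparr>carrier = {f. (\<forall>x. f x \<in> carrier B) \<and> (\<lambda>x. alg_norm B (f x)) summable_on UNIV},
     alg_zero = (\<lambda>x. alg_zero B),
     alg_add = (\<lambda>f g x. alg_add B (f x) (g x)),
     alg_scale = (\<lambda>c f x. alg_scale B c (f x)),
     alg_mult = (\<lambda>f g x. alg_infsum B (\<lambda>y. alg_mult B (f y) (g (- y + x)))),
     alg_star = (\<lambda>f x. alg_star B (f (- x))),
     alg_norm = (\<lambda>f. \<Sum>\<^sub>\<infinity>x. alg_norm B (f x))\<rparr>"

text \<open>
  HOL has no quantification over all types inside a formula, so the C*-algebras range over all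
  C*-algebra structures whose underlying set is contained in a given type \<open>'b\<close>. For every \<open>'b\<close>
  with at least continuum many elements this is the full notion: an element of
  \<open>\<ell>\<^sup>1(G; B)\<close> has countable support, hence lies in \<open>\<ell>\<^sup>1(G; D)\<close> for a separable
  C*-subalgebra \<open>D\<close> of \<open>B\<close>, and separable C*-algebras have at most continuum many elements.
  (Passing from \<open>D\<close> to \<open>B\<close> can enlarge the spectrum by \<open>0\<close> only.) The type of bounded
  operators on \<open>'g ell2\<close> is such a \<open>'b\<close>, since it contains the scalars. The operations of the
  structures are arbitrary and unrelated to any operations that \<open>'b\<close> may carry.
\<close>

definition rigidly_symmetric :: "'g::group_add itself \<Rightarrow> 'b itself \<Rightarrow> bool" where
  "rigidly_symmetric TYPE('g) TYPE('b) \<longleftrightarrow>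
    (\<forall>B :: 'b star_alg. cstar_algebra B \<longrightarrow>
       symmetric_algebra (l1_algebra B :: ('g \<Rightarrow> 'b) star_alg))"

definition translate :: "'g::group_add \<Rightarrow> ('g \<Rightarrow> 'c) \<Rightarrow> ('g \<Rightarrow> 'c)" where
  "translate x f = (\<lambda>y. f (- x + y))"

text \<open>Existence of a left invariant mean on the bounded functions.\<close>

definition amenable :: "'g::group_add itself \<Rightarrow> bool" where
  "amenable TYPE('g) \<longleftrightarrow>
    (\<exists>m :: ('g \<Rightarrow> real) \<Rightarrow> real.
       (\<forall>f g. bounded (range f) \<and> bounded (range g) \<longrightarrow> m (\<lambda>x. f x + g x) = m f + m g) \<and>
       (\<forall>c f. bounded (range f) \<longrightarrow> m (\<lambda>x. c * f x) = c * m f) \<and>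
       (\<forall>f. bounded (range f) \<and> (\<forall>x. 0 \<le> f x) \<longrightarrow> 0 \<le> m f) \<and>
       m (\<lambda>x. 1) = 1 \<and>
       (\<forall>x f. bounded (range f) \<longrightarrow> m (translate x f) = m f))"

section \<open>Twisted kernels\<close>

definition unital_cstar_subalgebra_linf :: "('g \<Rightarrow> complex) set \<Rightarrow> bool" where
  "unital_cstar_subalgebra_linf A \<longleftrightarrow>
     (\<forall>f\<in>A. bounded (range f)) \<and>
     (\<lambda>_. 1) \<in> A \<and>
     (\<forall>f\<in>A. \<forall>g\<in>A. (\<lambda>x. f x + g x) \<in> A) \<and>
     (\<forall>c. \<forall>f\<in>A. (\<lambda>x. c * f x) \<in> A) \<and>
     (\<forall>f\<in>A. \<forall>g\<in>A. (\<lambda>x. f x * g x) \<in> A) \<and>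
     (\<forall>f\<in>A. (\<lambda>x. cnj (f x)) \<in> A) \<and>
     (\<forall>s f. (\<forall>n. s n \<in> A) \<and> uniform_limit UNIV s f sequentially \<longrightarrow> f \<in> A)"

definition translation_invariant :: "('g::group_add \<Rightarrow> complex) set \<Rightarrow> bool" where
  "translation_invariant A \<longleftrightarrow> (\<forall>x. translate x ` A \<subseteq> A)"

definition two_cocycle ::
  "('g::group_add \<Rightarrow> complex) set \<Rightarrow> ('g \<Rightarrow> 'g \<Rightarrow> 'g \<Rightarrow> complex) \<Rightarrow> bool" where
  "two_cocycle A \<omega> \<longleftrightarrow>
     (\<forall>x y. \<omega> x y \<in> A) \<and>
     (\<forall>x y q. cmod (\<omega> x y q) = 1) \<and>
     (\<forall>x y z q. \<omega> x y q * \<omega> (x + y) z q = translate x (\<omega> y z) q * \<omega> x (y + z) q) \<and>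
     (\<forall>x q. \<omega> x 0 q = 1 \<and> \<omega> 0 x q = 1)"

definition cocycle_lambda ::
  "('g::group_add \<Rightarrow> 'g \<Rightarrow> 'g \<Rightarrow> complex) \<Rightarrow> 'g \<Rightarrow> 'g \<Rightarrow> complex" where
  "cocycle_lambda \<omega> x y = \<omega> (- x) (x - y) 0"

definition kernels :: "('g::group_add \<Rightarrow> complex) set \<Rightarrow> ('g \<Rightarrow> 'g \<Rightarrow> complex) set" where
  "kernels A = {K.
     (\<exists>k :: 'g \<Rightarrow> complex. (\<lambda>x. cmod (k x)) summable_on UNIV \<and>
        (\<forall>x y. cmod (K x y) \<le> cmod (k (x - y)))) \<and>
     (\<forall>x y. (\<lambda>z. K (x + z) (y + z)) \<in> A)}"

definition int_op ::
  "('g \<Rightarrow> 'g \<Rightarrow> complex) \<Rightarrow> ('g \<Rightarrow> 'g \<Rightarrow> complex) \<Rightarrow> ('g ell2 \<Rightarrow>\<^sub>L 'g ell2)" where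
  "int_op l K = Blinfun (\<lambda>v. Abs_ell2 (\<lambda>x. \<Sum>\<^sub>\<infinity>y. K x y * l x y * ell2_fun v y))"

definition int_ops ::
  "('g::group_add \<Rightarrow> complex) set \<Rightarrow> ('g \<Rightarrow> 'g \<Rightarrow> complex) \<Rightarrow> ('g ell2 \<Rightarrow>\<^sub>L 'g ell2) set" where
  "int_ops A l = int_op l ` kernels A"

text \<open>Schur's test: on the kernels in question the formula defines a bounded operator.\<close>

lemma int_op_bound_aux:
  fixes M :: "'g::group_add \<Rightarrow> 'g \<Rightarrow> complex" and a :: "'g \<Rightarrow> real"
  assumes a: "a summable_on UNIV" and M: "\<And>x y. cmod (M x y) \<le> a (x - y)"
  shows "(\<lambda>y. M x y * ell2_fun v y) summable_on UNIV"
    and "(\<lambda>x. (cmod (\<Sum>\<^sub>\<infinity>y. M x y * ell2_fun v y))\<^sup>2) summable_on UNIV"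
    and "(\<Sum>\<^sub>\<infinity>x. (cmod (\<Sum>\<^sub>\<infinity>y. M x y * ell2_fun v y))\<^sup>2) \<le> ((\<Sum>\<^sub>\<infinity>x. a x) * norm v)\<^sup>2"
proof -
  define C where "C = (\<Sum>\<^sub>\<infinity>x. a x)"
  define w where "w = (\<lambda>y. (cmod (ell2_fun v y))\<^sup>2)"
  have a0: "0 \<le> a t" for t
    using M[of t 0] norm_ge_zero[of "M t 0"] by (metis diff_0_right order_trans)
  have w: "w summable_on UNIV" and w0: "0 \<le> w y" for y
    using ell2_summable by (auto simp: w_def)
  have C0: "0 \<le> C"
    unfolding C_def by (intro infsum_nonneg a0)
  have bij: "bij (\<lambda>y. x - y)" for x :: 'g
    by (rule bij_betw_byWitness[where f' = "\<lambda>y. - y + x"]) (auto simp: algebra_simps)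
  have bij2: "bij_betw (\<lambda>(x, y). (x - y, y)) (UNIV \<times> UNIV) (UNIV \<times> (UNIV :: 'g set))"
    by (rule bij_betw_byWitness[where f' = "\<lambda>(x, y). (x + y, y)"]) auto
  have prod: "(\<lambda>(t, y). a t * w y) summable_on UNIV \<times> UNIV"
    by (rule summable_on_SigmaI[where g = "\<lambda>t. a t * infsum w UNIV"])
      (auto intro!: has_sum_cmult_right has_sum_infsum w summable_on_cmult_left a mult_nonneg_nonneg a0 w0)
  have prod_sum: "(\<Sum>\<^sub>\<infinity>(t, y)\<in>UNIV \<times> UNIV. a t * w y) = C * infsum w UNIV"
    using infsum_Sigma'_banach[of "\<lambda>t y. a t * w y" UNIV "\<lambda>_. UNIV"] prod
    by (simp add: C_def infsum_cmult_right' infsum_cmult_left')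
  have conv: "(\<lambda>(x, y). a (x - y) * w y) summable_on UNIV \<times> UNIV"
    using summable_on_reindex_bij_betw[OF bij2, of "\<lambda>(t, y). a t * w y"] prod
    by (simp add: case_prod_unfold)
  have conv_sum: "(\<Sum>\<^sub>\<infinity>(x, y)\<in>UNIV \<times> UNIV. a (x - y) * w y) = C * infsum w UNIV"
    using infsum_reindex_bij_betw[OF bij2, of "\<lambda>(t, y). a t * w y"] prod_sum
    by (simp add: case_prod_unfold)
  have row: "(\<lambda>y. a (x - y) * w y) summable_on UNIV" for x
    using summable_on_SigmaD1[of "\<lambda>x y. a (x - y) * w y" UNIV "\<lambda>_. UNIV" x] conv a0 w0 by auto
  have rows: "(\<lambda>x. \<Sum>\<^sub>\<infinity>y. a (x - y) * w y) summable_on UNIV"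
    using summable_on_Sigma_banach[of "\<lambda>x y. a (x - y) * w y" UNIV "\<lambda>_. UNIV"] conv by simp
  have rows_sum: "(\<Sum>\<^sub>\<infinity>x. \<Sum>\<^sub>\<infinity>y. a (x - y) * w y) = C * infsum w UNIV"
    using infsum_Sigma'_banach[of "\<lambda>x y. a (x - y) * w y" UNIV "\<lambda>_. UNIV"] conv conv_sum by simp
  have ax: "(\<lambda>y. a (x - y)) summable_on UNIV" "(\<Sum>\<^sub>\<infinity>y. a (x - y)) = C" for x
    using summable_on_reindex_bij_betw[OF bij, of a x] infsum_reindex_bij_betw[OF bij, of a x] a
    by (simp_all add: C_def)
  define p where "p = (\<lambda>x. Abs_ell2 (\<lambda>y. complex_of_real (sqrt (a (x - y)))))"
  define q where "q = (\<lambda>x. Abs_ell2 (\<lambda>y. complex_of_real (sqrt (a (x - y)) * cmod (ell2_fun v y))))"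
  have p: "ell2_fun (p x) y = complex_of_real (sqrt (a (x - y)))" for x y
    unfolding p_def using ax a0 by (subst Abs_ell2_inverse) auto
  have q: "ell2_fun (q x) y = complex_of_real (sqrt (a (x - y)) * cmod (ell2_fun v y))" for x y
    unfolding q_def using row[of x] a0
    by (subst Abs_ell2_inverse) (auto simp: norm_mult power_mult_distrib w_def)
  have pq: "ell2_fun (p x) y * cnj (ell2_fun (q x) y)
      = complex_of_real (a (x - y) * cmod (ell2_fun v y))" for x y
    using a0[of "x - y"] by (simp add: p q mult.assoc[symmetric] flip: of_real_mult)
  have abs_sum: "(\<lambda>y. a (x - y) * cmod (ell2_fun v y)) summable_on UNIV" for x
    using summable_on_Re[OF ell2_cinner_summable[of "p x" "q x"]] unfolding pq by simp
  have le: "norm (M x y * ell2_fun v y) \<le> a (x - y) * cmod (ell2_fun v y)" for x y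
    using M[of x y] by (simp add: norm_mult mult_right_mono)
  have abs_M: "(\<lambda>y. norm (M x y * ell2_fun v y)) summable_on UNIV" for x
    by (rule summable_on_comparison_test[OF abs_sum[of x]]) (use le in auto)
  then show "(\<lambda>y. M x y * ell2_fun v y) summable_on UNIV" for x
    by (rule abs_summable_summable)
  have sq: "(cmod (\<Sum>\<^sub>\<infinity>y. M x y * ell2_fun v y))\<^sup>2 \<le> C * (\<Sum>\<^sub>\<infinity>y. a (x - y) * w y)" for x
  proof -
    have "cmod (\<Sum>\<^sub>\<infinity>y. M x y * ell2_fun v y) \<le> (\<Sum>\<^sub>\<infinity>y. a (x - y) * cmod (ell2_fun v y))"
      by (rule norm_infsum_le[OF has_sum_infsum[OF abs_summable_summable[OF abs_M]]
            has_sum_infsum[OF abs_sum]]) (use le in auto)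
    also have "\<dots> = inner (p x) (q x)"
      unfolding inner_ell2_def ell2_cinner_def pq
      by (subst infsumI[OF has_sum_of_real[OF has_sum_infsum[OF abs_sum]]]) simp
    finally have "(cmod (\<Sum>\<^sub>\<infinity>y. M x y * ell2_fun v y))\<^sup>2 \<le> (inner (p x) (q x))\<^sup>2"
      by (simp add: power_mono)
    also have "\<dots> \<le> (norm (p x))\<^sup>2 * (norm (q x))\<^sup>2"
      using Cauchy_Schwarz_ineq[of "p x" "q x"] by (simp add: power2_norm_eq_inner)
    also have "(norm (p x))\<^sup>2 = C"
      unfolding norm_ell2_def p using a0 C0 by (simp add: ax)
    also have "(norm (q x))\<^sup>2 = (\<Sum>\<^sub>\<infinity>y. a (x - y) * w y)"
      unfolding norm_ell2_def q using a0 w0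
      by (simp add: norm_mult power_mult_distrib w_def infsum_nonneg)
    finally show ?thesis .
  qed
  show sm: "(\<lambda>x. (cmod (\<Sum>\<^sub>\<infinity>y. M x y * ell2_fun v y))\<^sup>2) summable_on UNIV"
    by (rule summable_on_comparison_test[OF summable_on_cmult_right[OF rows, of C]]) (use sq in auto)
  have "(\<Sum>\<^sub>\<infinity>x. (cmod (\<Sum>\<^sub>\<infinity>y. M x y * ell2_fun v y))\<^sup>2) \<le> (\<Sum>\<^sub>\<infinity>x. C * (\<Sum>\<^sub>\<infinity>y. a (x - y) * w y))"
    by (rule infsum_mono[OF sm summable_on_cmult_right[OF rows]]) (use sq in auto)
  also have "\<dots> = C * (C * infsum w UNIV)"
    by (simp add: infsum_cmult_right' rows_sum)
  also have "\<dots> = (C * norm v)\<^sup>2"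
    using w0 by (simp add: norm_ell2_def w_def infsum_nonneg power_mult_distrib power2_eq_square)
  finally show "(\<Sum>\<^sub>\<infinity>x. (cmod (\<Sum>\<^sub>\<infinity>y. M x y * ell2_fun v y))\<^sup>2) \<le> ((\<Sum>\<^sub>\<infinity>x. a x) * norm v)\<^sup>2"
    unfolding C_def .
qed

lemma
  assumes K: "K \<in> kernels A" and l: "\<And>x y. cmod (l x y) = 1"
  shows int_op_apply: "ell2_fun (int_op l K v) x = (\<Sum>\<^sub>\<infinity>y. K x y * l x y * ell2_fun v y)"
    and int_op_summable: "(\<lambda>y. K x y * l x y * ell2_fun v y) summable_on UNIV"
    and int_op_in_ell2_ops: "int_op l K \<in> ell2_ops"
proof -
  obtain k where k: "(\<lambda>x. cmod (k x)) summable_on UNIV" "\<And>x y. cmod (K x y) \<le> cmod (k (x - y))"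
    using K by (auto simp: kernels_def)
  note aux = int_op_bound_aux[of "\<lambda>x. cmod (k x)" "\<lambda>x y. K x y * l x y"]
  have M: "cmod (K x y * l x y) \<le> cmod (k (x - y))" for x y
    using k(2) l by (simp add: norm_mult)
  show sm: "(\<lambda>y. K x y * l x y * ell2_fun v y) summable_on UNIV" for x v
    using aux(1)[OF k(1) M] .
  define T where "T v = Abs_ell2 (\<lambda>x. \<Sum>\<^sub>\<infinity>y. K x y * l x y * ell2_fun v y)" for v
  have T: "ell2_fun (T v) x = (\<Sum>\<^sub>\<infinity>y. K x y * l x y * ell2_fun v y)" for v x
    unfolding T_def using aux(2)[OF k(1) M] by (subst Abs_ell2_inverse) auto
  have T_add: "T (v + w) = T v + T w" for v w
    by (rule ell2_eqI) (simp add: T distrib_left infsum_add sm)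
  have T_scale: "T (ell2_scale c v) = ell2_scale c (T v)" for c v
    by (rule ell2_eqI) (simp add: T mult.left_commute infsum_cmult_right')
  have "norm (T v) \<le> norm v * (\<Sum>\<^sub>\<infinity>x. cmod (k x))" for v
    using aux(3)[OF k(1) M, of v]
    unfolding norm_ell2_def[of "T v"] T
    by (intro real_le_lsqrt mult_nonneg_nonneg infsum_nonneg) (simp_all add: mult.commute)
  then have bl: "bounded_linear T"
    by (intro bounded_linear_intro T_add) (simp_all add: scaleR_ell2_def T_scale)
  have eq: "int_op l K v = T v" for v
    unfolding int_op_def T_def[symmetric] using bl by (simp add: bounded_linear_Blinfun_apply)
  show "ell2_fun (int_op l K v) x = (\<Sum>\<^sub>\<infinity>y. K x y * l x y * ell2_fun v y)"
    by (simp add: eq T)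
  show "int_op l K \<in> ell2_ops"
    by (simp add: ell2_ops_def eq T_scale)
qed

end

theory Submission
  imports Defs "HOL-Analysis.Finite_Function_Topology"
begin

text \<open>
  In these comments the group is written multiplicatively. An operator \<open>T\<close> on \<open>\<ell>\<^sup>2(G)\<close> is called
  convolution-dominated if \<open>|T(x, y)| \<le> k (x y\<inverse>)\<close> for its matrix entries and some \<open>k \<in> \<ell>\<^sup>1(G)\<close>. The operators
  \<open>Int\<^sub>\<lambda>(K)\<close> are exactly those that are convolution-dominated and have all functions \<open>z \<mapsto> K(x z, y z)\<close> in
  \<open>A\<close>, where \<open>K(x, y) = T(x, y) / \<lambda>(x, y)\<close> (\<open>int_ops_iff\<close>). The two conditions are treated separately. The
  cocycle enters only through the second one, by the identity
  \<open>\<lambda>(x, z) \<lambda>(z, y) = \<omega>(x z\<inverse>, z y\<inverse>; x) \<lambda>(x, y)\<close>, which shows that products and adjoints stay in the set.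
  The second condition survives limits in the operator norm, the first in general does not.

  On a finite group every operator is convolution-dominated, so let \<open>G\<close> be infinite. Inverses are
  convolution-dominated because of rigid symmetry. Sending \<open>T\<close> to the family of its diagonals embeds
  the convolution-dominated operators into \<open>\<ell>\<^sup>1(G; B)\<close>, where \<open>B\<close> is the algebra of all bounded operators on
  \<open>\<ell>\<^sup>2(G)\<close>. Symmetry of this algebra makes every element \<open>\<delta> + b\<^sup>* b\<close> with \<open>\<delta> > 0\<close> invertible, so for
  invertible \<open>T\<close> it suffices to write \<open>a = T\<^sup>* T\<close> in this form. Since \<open>T\<close> is bounded below, \<open>a - \<epsilon> = R\<^sup>* R\<close> for a
  bounded operator \<open>R\<close> and some \<open>\<epsilon> > 0\<close>, but the norms of the diagonals of \<open>R\<close> need not be summable. Amenability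
  supplies a finitely supported unit vector \<open>\<xi>\<close> whose coefficient \<open>\<phi>(g) = \<langle>\<lambda>\<^sub>g \<xi>, \<xi>\<rangle>\<close> is so close to one that multiplying the \<open>g\<close>-th diagonal of \<open>a\<close>
  by \<open>\<phi>(g)\<close>, for every \<open>g\<close>, changes \<open>a\<close> by less than \<open>\<epsilon>/2\<close> in the \<open>\<ell>\<^sup>1\<close>-norm. The multiple \<open>\<phi> R\<^sup>* R\<close> is a square
  in \<open>\<ell>\<^sup>1(G; B)\<close>, built from finitely many translates of \<open>R\<close> (\<open>diagonals_of_gram_operators\<close>), and the
  error together with \<open>\<epsilon>/2\<close> has a convolution-dominated square root (\<open>dominated_square_root\<close>). This
  gives \<open>a = \<epsilon>/2 + b\<^sup>* b\<close> (\<open>dominated_gram_inverse\<close>).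

  That the inverse also has its diagonals in \<open>A\<close> follows from the Neumann series of \<open>s a\<close> for small \<open>s\<close>. For
  Fredholm \<open>T\<close> the projection \<open>P\<close> onto the kernel belongs to the algebra: its diagonals lie in \<open>A\<close> because
  \<open>(1 - s a)\<^sup>n\<close> converges to \<open>P\<close> in norm, and it is convolution-dominated because it factors through a
  finite matrix and the dominated inverse of a finite-rank perturbation of \<open>s a\<close>. Then \<open>(s a + P)\<inverse> s T\<^sup>*\<close> inverts \<open>T\<close> up to
  operators of finite rank.
\<close>


type_synonym 'a operator = "'a ell2 \<Rightarrow>\<^sub>L 'a ell2"

section \<open>Infinite sums\<close>

lemma has_sum_singleton:
  assumes "\<And>i. i \<noteq> j \<Longrightarrow> f i = 0"
  shows "(f has_sum f j) UNIV"
proof -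
  have "(f has_sum f j) {j}" using has_sum_finite[of "{j}" f] by simp
  then show ?thesis by (subst has_sum_cong_neutral[of "{j}" UNIV f f]) (use assms in auto)
qed

lemma summable_on_finite_support:
  fixes k :: "'i \<Rightarrow> real"
  assumes "finite {i. k i \<noteq> 0}"
  shows "k summable_on UNIV"
proof -
  have "k summable_on UNIV \<longleftrightarrow> k summable_on {i. k i \<noteq> 0}"
    by (rule summable_on_cong_neutral) auto
  then show ?thesis using assms by simp
qed

lemma infsum_split_finite:
  fixes f :: "'i \<Rightarrow> 'c::banach"
  assumes "f summable_on UNIV" "finite F"
  shows "infsum f UNIV = sum f F + infsum f (- F)"
  using infsum_Un_disjoint[of f F "- F"] summable_on_subset_banach[OF assms(1)] assms(2)
  by (simp add: Compl_partition)

lemma finite_sum_near_infsum: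
  fixes f :: "'i \<Rightarrow> real"
  assumes "f summable_on UNIV" "0 < e"
  obtains F where "finite F" "infsum f (- F) < e"
proof -
  have "\<forall>\<^sub>F F in finite_subsets_at_top UNIV. dist (sum f F) (infsum f UNIV) < e"
    using has_sum_infsum[OF assms(1)] assms(2) unfolding has_sum_def by (rule tendstoD)
  then obtain F where F: "finite F" "dist (sum f F) (infsum f UNIV) < e"
    unfolding eventually_finite_subsets_at_top by blast
  then show ?thesis using that[OF F(1)] infsum_split_finite[OF assms(1) F(1)] by (simp add: dist_real_def)
qed

section \<open>Hilbert space geometry of square-summable functions\<close>

lemma mult_cnj_cmod:
  "z * cnj z = (complex_of_real (cmod z))\<^sup>2" "cnj z * z = (complex_of_real (cmod z))\<^sup>2"
  using complex_norm_square[of z] by (simp_all add: mult.commute)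

definition ket :: "'a \<Rightarrow> 'a ell2" where
  "ket x = Abs_ell2 (\<lambda>y. if y = x then 1 else 0)"

lemma ell2_fun_Abs:
  assumes "(\<lambda>x. (cmod (f x))\<^sup>2) summable_on UNIV"
  shows "ell2_fun (Abs_ell2 f) = f"
  using assms by (simp add: Abs_ell2_inverse)

lemma finite_support_square_summable:
  assumes "finite {x. f x \<noteq> 0}"
  shows "(\<lambda>x. (cmod (f x))\<^sup>2) summable_on UNIV"
  using assms by (intro summable_on_finite_support) simp

lemma ell2_fun_ket [simp]: "ell2_fun (ket x) y = (if y = x then 1 else 0)"
  unfolding ket_def
  by (subst ell2_fun_Abs) (auto intro!: finite_support_square_summable)

lemma ell2_fun_uminus [simp]: "ell2_fun (- v) x = - ell2_fun v x"
  unfolding uminus_ell2_def ell2_fun_scale by simp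

lemma ell2_fun_diff [simp]: "ell2_fun (v - w) x = ell2_fun v x - ell2_fun w x"
  unfolding minus_ell2_def ell2_fun_add ell2_fun_uminus by simp

lemma ell2_fun_scaleR [simp]: "ell2_fun (r *\<^sub>R v) x = complex_of_real r * ell2_fun v x"
  by (simp add: scaleR_ell2_def)

lemma ell2_fun_sum [simp]: "ell2_fun (sum f F) x = (\<Sum>i\<in>F. ell2_fun (f i) x)"
  by (induction F rule: infinite_finite_induct) auto

lemma norm_ell2_sq: "(norm v)\<^sup>2 = (\<Sum>\<^sub>\<infinity>x. (cmod (ell2_fun v x))\<^sup>2)"
  by (simp add: norm_ell2_def infsum_nonneg)

lemma cinner_self: "ell2_cinner v v = complex_of_real ((norm v)\<^sup>2)"
  by (simp add: ell2_cinner_self norm_ell2_sq)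

lemma sum_cmod_sq_le:
  assumes "finite F" shows "(\<Sum>x\<in>F. (cmod (ell2_fun v x))\<^sup>2) \<le> (norm v)\<^sup>2"
  unfolding norm_ell2_sq
  by (rule finite_sum_le_infsum[OF ell2_summable assms]) auto

lemma cmod_ell2_le_norm: "cmod (ell2_fun v x) \<le> norm v"
  by (rule power2_le_imp_le) (use sum_cmod_sq_le[of "{x}" v] in auto)

lemma norm_ell2_scale [simp]: "norm (ell2_scale c v) = cmod c * norm v"
  by (simp add: norm_ell2_def norm_mult power_mult_distrib infsum_cmult_right' real_sqrt_mult)

lemma cinner_add_right: "ell2_cinner w (u + v) = ell2_cinner w u + ell2_cinner w v"
  by (subst (1 2 3) ell2_cinner_commute) (simp add: ell2_cinner_add_left)

lemma cinner_scale_right: "ell2_cinner w (ell2_scale c v) = cnj c * ell2_cinner w v"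
  by (subst (1 2) ell2_cinner_commute) (simp add: ell2_cinner_scale_left)

lemma cinner_diff_left: "ell2_cinner (u - v) w = ell2_cinner u w - ell2_cinner v w"
  using ell2_cinner_add_left[of "u - v" v w] by simp

lemma cinner_diff_right: "ell2_cinner w (u - v) = ell2_cinner w u - ell2_cinner w v"
  using cinner_add_right[of w "u - v" v] by simp

lemma cinner_zero_left [simp]: "ell2_cinner 0 w = 0"
  and cinner_zero_right [simp]: "ell2_cinner w 0 = 0"
  by (simp_all add: ell2_cinner_def)

lemma cinner_sum_left: "ell2_cinner (sum f F) w = (\<Sum>i\<in>F. ell2_cinner (f i) w)"
  by (induction F rule: infinite_finite_induct) (auto simp: ell2_cinner_add_left)

lemma cinner_sum_right: "ell2_cinner w (sum f F) = (\<Sum>i\<in>F. ell2_cinner w (f i))"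
  by (induction F rule: infinite_finite_induct) (auto simp: cinner_add_right)

lemma cinner_ket_right [simp]: "ell2_cinner v (ket x) = ell2_fun v x"
  using has_sum_singleton[of x "\<lambda>y. ell2_fun v y * cnj (ell2_fun (ket x) y)"]
  by (simp add: ell2_cinner_def infsumI)

lemma norm_ket [simp]: "norm (ket x) = 1"
proof -
  have "complex_of_real ((norm (ket x))\<^sup>2) = complex_of_real 1"
    unfolding cinner_self[symmetric] by simp
  then have "(norm (ket x))\<^sup>2 = 1" by (simp only: of_real_eq_iff)
  then show ?thesis by (metis norm_ge_zero real_sqrt_one real_sqrt_unique)
qed

lemma cmod_cinner_le: "cmod (ell2_cinner v w) \<le> norm v * norm w"
proof (cases "ell2_cinner v w = 0")
  case False
  \<comment> \<open>Rotating \<open>v\<close> makes the complex inner product real, so that the real inequality applies.\<close>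
  define c where "c = cnj (ell2_cinner v w) / complex_of_real (cmod (ell2_cinner v w))"
  have c: "cmod c = 1" using False by (simp add: c_def norm_divide)
  have "c * ell2_cinner v w = complex_of_real (cmod (ell2_cinner v w))"
    using False by (simp add: c_def complex_norm_square[symmetric] power2_eq_square mult.commute)
  then have "inner (ell2_scale c v) w = cmod (ell2_cinner v w)"
    by (simp add: inner_ell2_def ell2_cinner_scale_left)
  then have "cmod (ell2_cinner v w) \<le> norm (ell2_scale c v) * norm w"
    using norm_cauchy_schwarz[of "ell2_scale c v" w] by simp
  then show ?thesis using c by simp
qed simp

lemma cinner_eqI:
  assumes "\<And>w. ell2_cinner u w = ell2_cinner v w"
  shows "u = v"
  by (rule ell2_eqI) (metis assms cinner_ket_right)

lemma norm_add_sq: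
  "(norm (u + v))\<^sup>2 = (norm u)\<^sup>2 + 2 * Re (ell2_cinner u v) + (norm (v :: 'a ell2))\<^sup>2"
  unfolding power2_norm_eq_inner by (simp add: inner_ell2_def[of u v, symmetric] inner_simps inner_commute)

lemma norm_diff_sq:
  "(norm (u - v))\<^sup>2 = (norm u)\<^sup>2 - 2 * Re (ell2_cinner u v) + (norm (v :: 'a ell2))\<^sup>2"
  unfolding power2_norm_eq_inner by (simp add: inner_ell2_def[of u v, symmetric] inner_simps inner_commute)

lemma pythagoras:
  assumes "ell2_cinner u v = 0"
  shows "(norm (u + v))\<^sup>2 = (norm u)\<^sup>2 + (norm (v :: 'a ell2))\<^sup>2"
  using assms by (simp add: norm_add_sq)

lemma square_summable_if_finite_sums_bounded:
  assumes "\<And>F. finite F \<Longrightarrow> (\<Sum>x\<in>F. (cmod (f x))\<^sup>2) \<le> B"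
  shows "(\<lambda>x. (cmod (f x))\<^sup>2) summable_on UNIV" "(\<Sum>\<^sub>\<infinity>x. (cmod (f x))\<^sup>2) \<le> B"
proof -
  show *: "(\<lambda>x. (cmod (f x))\<^sup>2) summable_on UNIV"
    by (rule nonneg_bdd_above_summable_on) (auto intro!: bdd_aboveI assms)
  show "(\<Sum>\<^sub>\<infinity>x. (cmod (f x))\<^sup>2) \<le> B"
    by (rule infsum_le_finite_sums[OF *]) (use assms in auto)
qed

lemma Abs_ell2_bounded:
  assumes "\<And>F. finite F \<Longrightarrow> (\<Sum>x\<in>F. (cmod (f x))\<^sup>2) \<le> B\<^sup>2" "0 \<le> B"
  shows "ell2_fun (Abs_ell2 f) = f" "norm (Abs_ell2 f) \<le> B"
proof -
  note * = square_summable_if_finite_sums_bounded[OF assms(1)]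
  show "ell2_fun (Abs_ell2 f) = f" using *(1) by (rule ell2_fun_Abs)
  then have "(norm (Abs_ell2 f))\<^sup>2 \<le> B\<^sup>2" using *(2) by (simp add: norm_ell2_sq)
  then show "norm (Abs_ell2 f) \<le> B" using assms(2) power2_le_imp_le by blast
qed

instance ell2 :: (type) banach
proof
  fix X :: "nat \<Rightarrow> 'a ell2"
  assume C: "Cauchy X"
  have "Cauchy (\<lambda>n. ell2_fun (X n) x)" for x
  proof (rule CauchyI)
    fix e :: real assume "0 < e"
    then obtain N where N: "\<forall>m\<ge>N. \<forall>n\<ge>N. norm (X m - X n) < e" using CauchyD[OF C] by blast
    have "norm (ell2_fun (X m) x - ell2_fun (X n) x) < e" if "m \<ge> N" "n \<ge> N" for m n
      using cmod_ell2_le_norm[of "X m - X n" x] N that by (simp, smt (verit))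
    then show "\<exists>M. \<forall>m\<ge>M. \<forall>n\<ge>M. norm (ell2_fun (X m) x - ell2_fun (X n) x) < e" by blast
  qed
  then have "\<exists>l. (\<lambda>n. ell2_fun (X n) x) \<longlonglongrightarrow> l" for x
    by (simp add: Cauchy_convergent_iff convergent_def)
  then obtain l where l: "\<And>x. (\<lambda>n. ell2_fun (X n) x) \<longlonglongrightarrow> l x" by metis
  have key: "\<exists>N. \<forall>n\<ge>N. norm (X n - Abs_ell2 l) \<le> e \<and> ell2_fun (Abs_ell2 l) = l" if "0 < e" for e :: real
  proof -
    obtain N where N: "\<forall>m\<ge>N. \<forall>n\<ge>N. norm (X m - X n) < e" using CauchyD[OF C \<open>0 < e\<close>] by blast
    have "norm (X n - Abs_ell2 l) \<le> e \<and> ell2_fun (Abs_ell2 l) = l" if n: "n \<ge> N" for n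
    proof -
      have le: "(\<Sum>x\<in>F. (cmod (ell2_fun (X n) x - l x))\<^sup>2) \<le> e\<^sup>2" if "finite F" for F
      proof (rule LIMSEQ_le_const2)
        show "(\<lambda>m. \<Sum>x\<in>F. (cmod (ell2_fun (X n) x - ell2_fun (X m) x))\<^sup>2)
            \<longlonglongrightarrow> (\<Sum>x\<in>F. (cmod (ell2_fun (X n) x - l x))\<^sup>2)"
          by (intro tendsto_intros l)
        have "(\<Sum>x\<in>F. (cmod (ell2_fun (X n) x - ell2_fun (X m) x))\<^sup>2) \<le> e\<^sup>2" if "m \<ge> N" for m
        proof -
          have "(\<Sum>x\<in>F. (cmod (ell2_fun (X n - X m) x))\<^sup>2) \<le> (norm (X n - X m))\<^sup>2"
            by (rule sum_cmod_sq_le[OF \<open>finite F\<close>])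
          also have "\<dots> \<le> e\<^sup>2" using N n that by (intro power_mono) (auto simp: less_imp_le)
          finally show ?thesis by simp
        qed
        then show "\<exists>M. \<forall>m\<ge>M. (\<Sum>x\<in>F. (cmod (ell2_fun (X n) x - ell2_fun (X m) x))\<^sup>2) \<le> e\<^sup>2" by blast
      qed
      define d where "d = Abs_ell2 (\<lambda>x. ell2_fun (X n) x - l x)"
      have d: "ell2_fun d = (\<lambda>x. ell2_fun (X n) x - l x)" "norm d \<le> e"
        unfolding d_def using Abs_ell2_bounded[of "\<lambda>x. ell2_fun (X n) x - l x" e] le \<open>0 < e\<close> by auto
      have "l = ell2_fun (X n - d)" by (rule ext) (simp add: d)
      then have "Abs_ell2 l = X n - d" by (simp add: ell2_fun_inverse)
      then show ?thesis using d \<open>l = _\<close> by simp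
    qed
    then show ?thesis by blast
  qed
  have "X \<longlonglongrightarrow> Abs_ell2 l"
  proof (rule LIMSEQ_I)
    fix r :: real assume "0 < r"
    then obtain N where "\<forall>n\<ge>N. norm (X n - Abs_ell2 l) \<le> r / 2" using key[of "r / 2"] by auto
    then show "\<exists>N. \<forall>n\<ge>N. norm (X n - Abs_ell2 l) < r" using \<open>0 < r\<close> by (metis field_sum_of_halves less_add_same_cancel1 half_gt_zero order_le_less_trans)
  qed
  then show "convergent X" by (auto simp: convergent_def)
qed

text \<open>The expansion in point masses, by which a bounded operator is determined by its matrix.\<close>

lemma has_sum_ket: "((\<lambda>x. ell2_scale (ell2_fun v x) (ket x)) has_sum v) UNIV"
proof -
  define part where "part F = (\<Sum>x\<in>F. ell2_scale (ell2_fun v x) (ket x))" for F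
  have part: "ell2_fun (part F) y = (if y \<in> F then ell2_fun v y else 0)" if "finite F" for F y
    using that by (simp add: part_def if_distrib[of "(*) _"] cong: if_cong)
  have eq: "(norm (part F - v))\<^sup>2 = (norm v)\<^sup>2 - (\<Sum>x\<in>F. (cmod (ell2_fun v x))\<^sup>2)" if F: "finite F" for F
  proof -
    have "(norm v)\<^sup>2 = (\<Sum>x\<in>F. (cmod (ell2_fun v x))\<^sup>2) + (\<Sum>\<^sub>\<infinity>x\<in>-F. (cmod (ell2_fun v x))\<^sup>2)"
      unfolding norm_ell2_sq
      by (rule infsum_split_finite[OF ell2_summable F])
    moreover have "(norm (part F - v))\<^sup>2 = (\<Sum>\<^sub>\<infinity>x\<in>-F. (cmod (ell2_fun v x))\<^sup>2)"
      unfolding norm_ell2_sq by (rule infsum_cong_neutral) (auto simp: part[OF F])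
    ultimately show ?thesis by simp
  qed
  have "((\<lambda>F. \<Sum>x\<in>F. (cmod (ell2_fun v x))\<^sup>2) \<longlongrightarrow> (norm v)\<^sup>2) (finite_subsets_at_top UNIV)"
    using has_sum_infsum[OF ell2_summable[of v]] unfolding norm_ell2_sq has_sum_def .
  then have "((\<lambda>F. (norm v)\<^sup>2 - (\<Sum>x\<in>F. (cmod (ell2_fun v x))\<^sup>2)) \<longlongrightarrow> (norm v)\<^sup>2 - (norm v)\<^sup>2)
      (finite_subsets_at_top UNIV)"
    by (intro tendsto_intros)
  then have "((\<lambda>F. (norm (part F - v))\<^sup>2) \<longlongrightarrow> 0) (finite_subsets_at_top UNIV)"
    by (subst tendsto_cong[OF eventually_finite_subsets_at_top_weakI[OF eq]]) simp_all
  then have "((\<lambda>F. sqrt ((norm (part F - v))\<^sup>2)) \<longlongrightarrow> sqrt 0) (finite_subsets_at_top UNIV)"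
    by (rule tendsto_real_sqrt)
  then have "((\<lambda>F. part F - v) \<longlongrightarrow> 0) (finite_subsets_at_top UNIV)"
    by (simp add: tendsto_norm_zero_iff)
  then show ?thesis
    unfolding has_sum_def part_def[symmetric] by (simp add: LIM_zero_iff)
qed

section \<open>Complex-linear operators and their matrices\<close>

lemma ell2_ops_scale: "T \<in> ell2_ops \<Longrightarrow> T (ell2_scale c v) = ell2_scale c (T v)"
  by (simp add: ell2_ops_def)

lemma zero_in_ell2_ops [simp]: "0 \<in> ell2_ops"
  and id_in_ell2_ops [simp]: "id_blinfun \<in> ell2_ops"
  and add_in_ell2_ops [intro]: "S \<in> ell2_ops \<Longrightarrow> T \<in> ell2_ops \<Longrightarrow> S + T \<in> ell2_ops"
  and diff_in_ell2_ops [intro]: "S \<in> ell2_ops \<Longrightarrow> T \<in> ell2_ops \<Longrightarrow> S - T \<in> ell2_ops"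
  and uminus_in_ell2_ops [intro]: "T \<in> ell2_ops \<Longrightarrow> - T \<in> ell2_ops"
  and comp_in_ell2_ops [intro]: "S \<in> ell2_ops \<Longrightarrow> T \<in> ell2_ops \<Longrightarrow> S o\<^sub>L T \<in> ell2_ops"
  by (auto simp: ell2_ops_def blinfun.add_left blinfun.diff_left blinfun.minus_left
      ell2.scale_right_distrib ell2.scale_right_diff_distrib)

lemma scaleR_in_ell2_ops [intro]: "T \<in> ell2_ops \<Longrightarrow> r *\<^sub>R T \<in> ell2_ops"
  by (auto simp: ell2_ops_def blinfun.scaleR_left scaleR_ell2_def mult.commute)

lemma op_scale_apply [simp]: "blinfun_apply (op_scale c T) v = ell2_scale c (T v)"
proof -
  have "bounded_linear (\<lambda>v. ell2_scale c (T v))"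
  proof (rule bounded_linear_intro[where K = "cmod c * norm T"])
    show "ell2_scale c (T (x + y)) = ell2_scale c (T x) + ell2_scale c (T y)" for x y
      by (simp add: blinfun.add_right ell2.scale_right_distrib)
    show "ell2_scale c (T (r *\<^sub>R x)) = r *\<^sub>R ell2_scale c (T x)" for r x
      unfolding blinfun.scaleR_right by (simp add: scaleR_ell2_def mult.commute)
    show "norm (ell2_scale c (T x)) \<le> norm x * (cmod c * norm T)" for x
      using mult_left_mono[OF norm_blinfun[of T x], of "cmod c"] by (simp add: ac_simps)
  qed
  then show ?thesis unfolding op_scale_def by (simp add: bounded_linear_Blinfun_apply)
qed

lemma op_scale_in_ell2_ops [intro]: "T \<in> ell2_ops \<Longrightarrow> op_scale c T \<in> ell2_ops"
  by (auto simp: ell2_ops_def mult.commute)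

lemma scaleR_eq_op_scale: "r *\<^sub>R T = op_scale (complex_of_real r) T"
  by (rule blinfun_eqI) (simp add: blinfun.scaleR_left scaleR_ell2_def)

lemma closed_ell2_ops: "closed (ell2_ops :: 'a operator set)"
proof -
  have "ell2_ops = (\<Inter>c v. {T :: 'a operator. T (ell2_scale c v) - op_scale c id_blinfun (T v) = 0})"
    by (auto simp: ell2_ops_def)
  moreover have "closed {T :: 'a operator. T (ell2_scale c v) - op_scale c id_blinfun (T v) = 0}" for c v
    by (intro closed_Collect_eq continuous_intros)
  ultimately show ?thesis by (metis (no_types, lifting) closed_INT)
qed

lemma ell2_op_ex:
  assumes "\<And>u v. f (u + v) = f u + f v" "\<And>c v. f (ell2_scale c v) = ell2_scale c (f v)"
    and "\<And>v. norm (f v) \<le> B * norm v"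
  obtains T where "T \<in> ell2_ops" "blinfun_apply T = f" "B \<ge> 0 \<Longrightarrow> norm T \<le> B"
proof -
  have "bounded_linear f"
    by (rule bounded_linear_intro[where K = B])
      (use assms in \<open>auto simp: scaleR_ell2_def mult.commute\<close>)
  then have *: "blinfun_apply (Blinfun f) = f" by (simp add: bounded_linear_Blinfun_apply)
  show thesis
  proof
    show "Blinfun f \<in> ell2_ops" using assms(2) by (simp add: ell2_ops_def *)
    show "norm (Blinfun f) \<le> B" if "B \<ge> 0"
      by (rule norm_blinfun_bound) (use that assms(3) in \<open>auto simp: *\<close>)
  qed (fact *)
qed

text \<open>The adjoint is found through its coordinates; that these are square-summable follows by
  testing \<open>T\<close> on finitely supported vectors.\<close>

lemma adjoint_ex:
  assumes T: "T \<in> ell2_ops"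
  shows "\<exists>S\<in>ell2_ops. \<forall>v w. ell2_cinner (S v) w = ell2_cinner v (T w)"
proof -
  define f where "f w = Abs_ell2 (\<lambda>x. ell2_cinner w (T (ket x)))" for w
  have bd: "(\<Sum>x\<in>F. (cmod (ell2_cinner w (T (ket x))))\<^sup>2) \<le> (norm T * norm w)\<^sup>2" if "finite F" for F w
  proof -
    define a where "a x = ell2_cinner w (T (ket x))" for x
    define s where "s = (\<Sum>x\<in>F. (cmod (a x))\<^sup>2)"
    define v where "v = (\<Sum>x\<in>F. ell2_scale (a x) (ket x))"
    have s0: "0 \<le> s" by (simp add: s_def sum_nonneg)
    have vv: "ell2_cinner v v = complex_of_real s"
      using that by (simp add: v_def s_def cinner_sum_left cinner_sum_right ell2_cinner_scale_left
          cinner_scale_right mult_cnj_cmod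
          if_distrib[of "(*) _"] cong: if_cong)
    then have nv: "(norm v)\<^sup>2 = s" unfolding cinner_self of_real_eq_iff .
    have "ell2_cinner w (T v) = complex_of_real s"
      by (simp add: v_def s_def blinfun.sum_right ell2_ops_scale[OF T] cinner_sum_right
          cinner_scale_right a_def mult_cnj_cmod)
    then have "s \<le> norm w * norm (T v)" using cmod_cinner_le[of w "T v"] s0 by simp
    also have "\<dots> \<le> norm w * (norm T * norm v)" by (intro mult_left_mono norm_blinfun) auto
    finally have "(norm v)\<^sup>2 \<le> (norm T * norm w) * norm v"
      by (simp add: nv ac_simps)
    then have "norm v \<le> norm T * norm w" by (cases "norm v = 0") (auto simp: power2_eq_square)
    then have "(norm v)\<^sup>2 \<le> (norm T * norm w)\<^sup>2" by (intro power_mono) auto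
    then show ?thesis by (simp add: nv s_def a_def)
  qed
  have f: "ell2_fun (f w) x = ell2_cinner w (T (ket x))" "norm (f w) \<le> norm T * norm w" for w x
    unfolding f_def using Abs_ell2_bounded[OF bd] by auto
  have add: "f (u + v) = f u + f v" for u v by (rule ell2_eqI) (simp add: f ell2_cinner_add_left)
  have sc: "f (ell2_scale c v) = ell2_scale c (f v)" for c v
    by (rule ell2_eqI) (simp add: f ell2_cinner_scale_left)
  obtain S where S: "S \<in> ell2_ops" "blinfun_apply S = f"
    using ell2_op_ex[OF add sc f(2)] by blast
  have "ell2_cinner (S v) w = ell2_cinner v (T w)" for v w
  proof -
    have bl: "bounded_linear (\<lambda>w. cnj (ell2_cinner v (T w)))"
    proof (rule bounded_linear_intro[where K = "norm v * norm T"])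
      show "cnj (ell2_cinner v (T (x + y))) = cnj (ell2_cinner v (T x)) + cnj (ell2_cinner v (T y))" for x y
        by (simp add: blinfun.add_right cinner_add_right)
      show "cnj (ell2_cinner v (T (r *\<^sub>R x))) = r *\<^sub>R cnj (ell2_cinner v (T x))" for r x
        unfolding blinfun.scaleR_right by (simp add: scaleR_ell2_def cinner_scale_right scaleR_conv_of_real)
      have "norm v * norm (T x) \<le> norm v * (norm T * norm x)" for x
        by (intro mult_left_mono norm_blinfun) auto
      then show "norm (cnj (ell2_cinner v (T x))) \<le> norm x * (norm v * norm T)" for x
        unfolding complex_mod_cnj by (metis (no_types) cmod_cinner_le order_trans mult.assoc mult.commute)
    qed
    have "((\<lambda>x. cnj (ell2_cinner v (T (ell2_scale (ell2_fun w x) (ket x))))) has_sum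
        cnj (ell2_cinner v (T w))) UNIV"
      by (rule has_sum_bounded_linear[OF bl has_sum_ket])
    then have "((\<lambda>x. ell2_fun w x * cnj (ell2_fun (S v) x)) has_sum cnj (ell2_cinner v (T w))) UNIV"
      by (simp add: ell2_ops_scale[OF T] cinner_scale_right S f)
    then have "ell2_cinner w (S v) = cnj (ell2_cinner v (T w))"
      by (simp add: ell2_cinner_def infsumI)
    then show ?thesis by (metis ell2_cinner_commute complex_cnj_cnj)
  qed
  then show ?thesis using S(1) by blast
qed

lemma op_adj:
  assumes T: "T \<in> ell2_ops"
  shows op_adj_in_ell2_ops: "op_adj T \<in> ell2_ops"
    and cinner_op_adj_left: "ell2_cinner (op_adj T v) w = ell2_cinner v (T w)"
proof -
  have "\<exists>!S. S \<in> ell2_ops \<and> (\<forall>v w. ell2_cinner (S v) w = ell2_cinner v (T w))"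
  proof (rule ex_ex1I)
    show "\<exists>S. S \<in> ell2_ops \<and> (\<forall>v w. ell2_cinner (S v) w = ell2_cinner v (T w))"
      using adjoint_ex[OF T] by blast
    fix S S' assume "S \<in> ell2_ops \<and> (\<forall>v w. ell2_cinner (S v) w = ell2_cinner v (T w))"
      and "S' \<in> ell2_ops \<and> (\<forall>v w. ell2_cinner (S' v) w = ell2_cinner v (T w))"
    then show "S = S'" by (intro blinfun_eqI cinner_eqI) auto
  qed
  from theI'[OF this] show "op_adj T \<in> ell2_ops" "ell2_cinner (op_adj T v) w = ell2_cinner v (T w)"
    unfolding op_adj_def by auto
qed

lemma cinner_op_adj_right:
  assumes "T \<in> ell2_ops"
  shows "ell2_cinner v (op_adj T w) = ell2_cinner (T v) w"
  by (metis cinner_op_adj_left[OF assms] ell2_cinner_commute)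

lemma op_adj_unique:
  assumes "T \<in> ell2_ops" "\<And>v w. ell2_cinner (blinfun_apply S v) w = ell2_cinner v (T w)"
  shows "op_adj T = (S :: 'a operator)"
  by (intro blinfun_eqI cinner_eqI) (simp add: assms cinner_op_adj_left)

lemma op_adj_op_adj: "T \<in> ell2_ops \<Longrightarrow> op_adj (op_adj T) = T"
  by (intro op_adj_unique op_adj_in_ell2_ops) (simp_all add: cinner_op_adj_right)

lemma op_adj_comp: "S \<in> ell2_ops \<Longrightarrow> T \<in> ell2_ops \<Longrightarrow> op_adj (S o\<^sub>L T) = op_adj T o\<^sub>L op_adj S"
  by (intro op_adj_unique comp_in_ell2_ops) (simp_all add: cinner_op_adj_left)

lemma op_adj_add: "S \<in> ell2_ops \<Longrightarrow> T \<in> ell2_ops \<Longrightarrow> op_adj (S + T) = op_adj S + op_adj T"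
  by (intro op_adj_unique add_in_ell2_ops)
    (simp_all add: blinfun.add_left ell2_cinner_add_left cinner_add_right cinner_op_adj_left)

lemma op_adj_diff: "S \<in> ell2_ops \<Longrightarrow> T \<in> ell2_ops \<Longrightarrow> op_adj (S - T) = op_adj S - op_adj T"
  by (intro op_adj_unique diff_in_ell2_ops)
    (simp_all add: blinfun.diff_left cinner_diff_left cinner_diff_right cinner_op_adj_left)

lemma op_adj_scale: "T \<in> ell2_ops \<Longrightarrow> op_adj (op_scale c T) = op_scale (cnj c) (op_adj T)"
  by (intro op_adj_unique op_scale_in_ell2_ops)
    (simp_all add: ell2_cinner_scale_left cinner_scale_right cinner_op_adj_left)

lemma op_adj_id [simp]: "op_adj id_blinfun = (id_blinfun :: 'a operator)"
  by (rule op_adj_unique) auto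

lemma op_adj_zero [simp]: "op_adj 0 = (0 :: 'a operator)"
  by (rule op_adj_unique) auto

lemma op_adj_scaleR: "T \<in> ell2_ops \<Longrightarrow> op_adj (r *\<^sub>R T) = r *\<^sub>R op_adj T"
  by (simp add: scaleR_eq_op_scale op_adj_scale)

lemma norm_op_adj_le:
  assumes T: "T \<in> ell2_ops"
  shows "norm (op_adj T) \<le> norm T"
proof (rule norm_blinfun_bound)
  fix v
  have "(norm (op_adj T v))\<^sup>2 = Re (ell2_cinner v (T (op_adj T v)))"
    using cinner_op_adj_left[OF T, of v "op_adj T v"] by (metis cinner_self Re_complex_of_real)
  also have "\<dots> \<le> norm v * (norm T * norm (op_adj T v))"
    by (rule order_trans[OF complex_Re_le_cmod order_trans[OF cmod_cinner_le]])
      (intro mult_left_mono norm_blinfun norm_ge_zero)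
  finally have "norm (op_adj T v) * norm (op_adj T v) \<le> (norm T * norm v) * norm (op_adj T v)"
    by (simp add: power2_eq_square ac_simps)
  then show "norm (op_adj T v) \<le> norm T * norm v"
    by (cases "op_adj T v = 0") auto
qed auto

lemma norm_op_adj: "T \<in> ell2_ops \<Longrightarrow> norm (op_adj T) = norm T"
  by (metis antisym norm_op_adj_le op_adj_in_ell2_ops op_adj_op_adj)

lemma norm_op_adj_comp_self:
  assumes T: "T \<in> ell2_ops"
  shows "norm (op_adj T o\<^sub>L T) = (norm T)\<^sup>2"
proof (rule antisym)
  show "norm (op_adj T o\<^sub>L T) \<le> (norm T)\<^sup>2"
    using norm_blinfun_compose[of "op_adj T" T] by (simp add: norm_op_adj[OF T] power2_eq_square)
  have "norm T \<le> sqrt (norm (op_adj T o\<^sub>L T))"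
  proof (rule norm_blinfun_bound)
    fix v
    have "(norm (T v))\<^sup>2 = Re (ell2_cinner ((op_adj T o\<^sub>L T) v) v)"
      by (simp add: cinner_op_adj_left[OF T] cinner_self)
    also have "\<dots> \<le> norm (op_adj T o\<^sub>L T) * norm v * norm v"
      by (rule order_trans[OF complex_Re_le_cmod order_trans[OF cmod_cinner_le]])
        (intro mult_right_mono norm_blinfun norm_ge_zero)
    also have "\<dots> = (sqrt (norm (op_adj T o\<^sub>L T)) * norm v)\<^sup>2"
      by (simp add: power_mult_distrib power2_eq_square)
    finally show "norm (T v) \<le> sqrt (norm (op_adj T o\<^sub>L T)) * norm v"
      by (rule power2_le_imp_le) simp
  qed simp
  then show "(norm T)\<^sup>2 \<le> norm (op_adj T o\<^sub>L T)"
    using power_mono[of "norm T" "sqrt (norm (op_adj T o\<^sub>L T))" 2] by simp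
qed

definition entry :: "'a operator \<Rightarrow> 'a \<Rightarrow> 'a \<Rightarrow> complex" where
  "entry T x y = ell2_fun (T (ket y)) x"

lemma entry_add [simp]: "entry (S + T) x y = entry S x y + entry T x y"
  and entry_diff [simp]: "entry (S - T) x y = entry S x y - entry T x y"
  and entry_scaleR [simp]: "entry (r *\<^sub>R T) x y = complex_of_real r * entry T x y"
  and entry_op_scale [simp]: "entry (op_scale c T) x y = c * entry T x y"
  and entry_zero [simp]: "entry 0 x y = 0"
  and entry_id: "entry id_blinfun x y = (if x = y then 1 else 0)"
  by (simp_all add: entry_def blinfun.add_left blinfun.diff_left blinfun.minus_left blinfun.scaleR_left)

lemma entry_op_adj: "T \<in> ell2_ops \<Longrightarrow> entry (op_adj T) x y = cnj (entry T y x)"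
  using cinner_op_adj_left[of T "ket y" "ket x"] ell2_cinner_commute[of "ket y"]
  by (simp add: entry_def)

lemma cmod_entry_le: "cmod (entry T x y) \<le> norm T"
  using cmod_ell2_le_norm[of "T (ket y)" x] norm_blinfun[of T "ket y"] by (simp add: entry_def)

lemma bounded_linear_entry: "bounded_linear (\<lambda>T. entry T x y)"
  by (rule bounded_linear_intro[where K = 1])
    (auto simp: scaleR_conv_of_real cmod_entry_le)

lemma ell2_op_has_sum:
  assumes T: "T \<in> ell2_ops"
  shows "((\<lambda>y. entry T x y * ell2_fun v y) has_sum ell2_fun (T v) x) UNIV"
proof -
  have "((\<lambda>y. ell2_fun v y * cnj (ell2_fun (op_adj T (ket x)) y)) has_sum
      ell2_cinner v (op_adj T (ket x))) UNIV"
    unfolding ell2_cinner_def using has_sum_infsum[OF ell2_cinner_summable] .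
  moreover have "cnj (ell2_fun (op_adj T (ket x)) y) = entry T x y" for y
    using entry_op_adj[OF T, of y x] by (simp add: entry_def)
  ultimately show ?thesis
    by (simp add: cinner_op_adj_right[OF T] mult.commute)
qed

lemma ell2_op_eqI:
  assumes "S \<in> ell2_ops" "T \<in> ell2_ops" "\<And>x y. entry S x y = entry T x y"
  shows "S = T"
proof (intro blinfun_eqI ell2_eqI)
  fix v x
  show "ell2_fun (S v) x = ell2_fun (T v) x"
    using ell2_op_has_sum[OF assms(1), of x v] ell2_op_has_sum[OF assms(2), of x v]
    by (simp add: assms(3) has_sum_unique)
qed

lemma entry_comp_has_sum:
  assumes "S \<in> ell2_ops"
  shows "((\<lambda>z. entry S x z * entry T z y) has_sum entry (S o\<^sub>L T) x y) UNIV"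
  using ell2_op_has_sum[OF assms, of x "T (ket y)"] by (simp add: entry_def)

lemma entry_comp_eqI:
  assumes "S \<in> ell2_ops" "((\<lambda>z. entry S x z * entry T z y) has_sum c) UNIV"
  shows "entry (S o\<^sub>L T) x y = c"
  using entry_comp_has_sum[OF assms(1)] assms(2) has_sum_unique by blast

section \<open>Inverses, square roots and open mappings\<close>

interpretation blinfun_compose: bounded_bilinear "(o\<^sub>L)"
  by (rule bounded_bilinear_blinfun_compose)

lemma id_blinfun_comp [simp]: "id_blinfun o\<^sub>L T = T" "T o\<^sub>L id_blinfun = T"
  by (rule blinfun_eqI; simp)+

lemma blinfun_comp_assoc: "(R o\<^sub>L S) o\<^sub>L T = R o\<^sub>L (S o\<^sub>L T)"
  by (rule blinfun_eqI) simp

text \<open>The inverse of \<open>1 - X\<close> is the fixed point of the contraction \<open>Y \<mapsto> 1 + XY\<close>. Finding it by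
  Banach's theorem instead of summing the Neumann series shows that it lies in every nonempty closed
  set that this map leaves invariant.\<close>

lemma neumann_inverse:
  fixes X :: "'b::banach \<Rightarrow>\<^sub>L 'b"
  assumes "norm X < 1" "closed C" "C \<noteq> {}" "\<And>Y. Y \<in> C \<Longrightarrow> id_blinfun + (X o\<^sub>L Y) \<in> C"
  obtains Z where "Z \<in> C" "(id_blinfun - X) o\<^sub>L Z = id_blinfun" "Z o\<^sub>L (id_blinfun - X) = id_blinfun"
proof -
  have "\<exists>!Z\<in>C. id_blinfun + (X o\<^sub>L Z) = Z"
  proof (rule Banach_fix[where c = "norm X"])
    show "complete C" using assms(2) by (simp add: complete_eq_closed)
    show "dist (id_blinfun + (X o\<^sub>L Y)) (id_blinfun + (X o\<^sub>L Y')) \<le> norm X * dist Y Y'" for Y Y'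
      using norm_blinfun_compose[of X "Y - Y'"] by (simp add: dist_norm blinfun_compose.diff_right)
  qed (use assms in auto)
  then obtain Z where Z: "Z \<in> C" "id_blinfun + (X o\<^sub>L Z) = Z" by blast
  have "\<exists>!W\<in>UNIV. id_blinfun + (W o\<^sub>L X) = W"
  proof (rule Banach_fix[where c = "norm X"])
    show "complete (UNIV :: ('b \<Rightarrow>\<^sub>L 'b) set)" by (rule complete_UNIV)
    show "dist (id_blinfun + (Y o\<^sub>L X)) (id_blinfun + (Y' o\<^sub>L X)) \<le> norm X * dist Y Y'" for Y Y'
      using norm_blinfun_compose[of "Y - Y'" X]
      by (simp add: dist_norm blinfun_compose.diff_left mult.commute)
  qed (use assms in auto)
  then obtain W where W: "id_blinfun + (W o\<^sub>L X) = W" by blast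
  have 1: "(id_blinfun - X) o\<^sub>L Z = id_blinfun"
    unfolding blinfun_compose.diff_left id_blinfun_comp by (metis Z(2) add_diff_cancel_right')
  have 2: "W o\<^sub>L (id_blinfun - X) = id_blinfun"
    unfolding blinfun_compose.diff_right id_blinfun_comp by (metis W add_diff_cancel_right')
  have "W = W o\<^sub>L ((id_blinfun - X) o\<^sub>L Z)" by (simp add: 1)
  also have "\<dots> = Z" by (simp add: blinfun_comp_assoc[symmetric] 2)
  finally show ?thesis using that Z(1) 1 2 by blast
qed

text \<open>Likewise \<open>Y = (X + Y\<^sup>2)/2\<close> says that \<open>1 - Y\<close> is a square root of \<open>1 - X\<close>, and on a ball of
  radius less than one the right-hand side is a contraction.\<close>

lemma square_root_in_closed_set:
  fixes X :: "'b::banach \<Rightarrow>\<^sub>L 'b"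
  assumes "closed C" "0 \<in> C" "\<And>Y. Y \<in> C \<Longrightarrow> norm Y \<le> r" "r < 1"
    and inv: "\<And>Y. Y \<in> C \<Longrightarrow> (1/2) *\<^sub>R (X + (Y o\<^sub>L Y)) \<in> C"
  obtains Y where "Y \<in> C" "(id_blinfun - Y) o\<^sub>L (id_blinfun - Y) = id_blinfun - X"
proof -
  have "0 \<le> r" using assms(2,3) by force
  have "\<exists>!Y\<in>C. (1/2) *\<^sub>R (X + (Y o\<^sub>L Y)) = Y"
  proof (rule Banach_fix[where c = r])
    show "complete C" using assms(1) by (simp add: complete_eq_closed)
    fix Y Z assume YZ: "Y \<in> C" "Z \<in> C"
    have "(Y o\<^sub>L Y) - (Z o\<^sub>L Z) = (Y o\<^sub>L (Y - Z)) + ((Y - Z) o\<^sub>L Z)"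
      by (simp add: blinfun_compose.diff_left blinfun_compose.diff_right)
    then have "norm ((Y o\<^sub>L Y) - (Z o\<^sub>L Z)) \<le> norm Y * norm (Y - Z) + norm (Y - Z) * norm Z"
      by (metis norm_triangle_mono norm_blinfun_compose)
    also have "\<dots> \<le> r * norm (Y - Z) + norm (Y - Z) * r"
      by (intro add_mono mult_mono) (use YZ assms(3) \<open>0 \<le> r\<close> in auto)
    finally have "norm ((Y o\<^sub>L Y) - (Z o\<^sub>L Z)) \<le> 2 * r * norm (Y - Z)" by (simp add: algebra_simps)
    moreover have "dist ((1/2) *\<^sub>R (X + (Y o\<^sub>L Y))) ((1/2) *\<^sub>R (X + (Z o\<^sub>L Z))) = norm ((Y o\<^sub>L Y) - (Z o\<^sub>L Z)) / 2"
      by (simp add: dist_norm flip: scaleR_diff_right)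
    ultimately show "dist ((1/2) *\<^sub>R (X + (Y o\<^sub>L Y))) ((1/2) *\<^sub>R (X + (Z o\<^sub>L Z))) \<le> r * dist Y Z"
      by (simp add: dist_norm)
  qed (use assms \<open>0 \<le> r\<close> in auto)
  then obtain Y where Y: "Y \<in> C" "(1/2) *\<^sub>R (X + (Y o\<^sub>L Y)) = Y" by blast
  have "Y + Y = X + (Y o\<^sub>L Y)"
    using arg_cong[OF Y(2), of "\<lambda>Z. 2 *\<^sub>R Z"] by (simp add: scaleR_2)
  then have "(id_blinfun - Y) o\<^sub>L (id_blinfun - Y) = id_blinfun - X"
    by (simp add: blinfun_compose.diff_left blinfun_compose.diff_right algebra_simps)
  then show ?thesis using that Y(1) by blast
qed

definition selfadj :: "'a operator \<Rightarrow> bool" where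
  "selfadj T \<longleftrightarrow> T \<in> ell2_ops \<and> op_adj T = T"

lemma selfadj_iff: "selfadj T \<longleftrightarrow> T \<in> ell2_ops \<and> (\<forall>x y. entry T x y = cnj (entry T y x))"
proof -
  have "op_adj T = T" if "T \<in> ell2_ops" "\<forall>x y. entry T x y = cnj (entry T y x)"
    using entry_op_adj[OF that(1)] that by (intro ell2_op_eqI op_adj_in_ell2_ops) metis+
  moreover have "entry T x y = cnj (entry T y x)" if "T \<in> ell2_ops" "op_adj T = T" for x y
    using entry_op_adj[OF that(1), of x y] that(2) by simp
  ultimately show ?thesis unfolding selfadj_def by blast
qed

lemma closed_selfadj: "closed {T. selfadj T}"
proof -
  have "{T. selfadj T} = ell2_ops \<inter> (\<Inter>x y. {T. entry T x y = cnj (entry T y x)})"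
    by (auto simp: selfadj_iff)
  moreover have "closed {T. entry T x y = cnj (entry T y x)}" for x y
    by (intro closed_Collect_eq continuous_intros bounded_linear.continuous_on[OF bounded_linear_entry])
  ultimately show ?thesis
    using closed_ell2_ops by (metis (no_types, lifting) closed_INT closed_Int)
qed

lemma selfadj_half_add_square:
  fixes X Y :: "'a operator"
  assumes "selfadj X" "selfadj Y"
  shows "selfadj ((1/2) *\<^sub>R (X + (Y o\<^sub>L Y)))"
proof -
  have X: "X \<in> ell2_ops" "op_adj X = X" and Y: "Y \<in> ell2_ops" "op_adj Y = Y"
    using assms by (auto simp: selfadj_def)
  then show ?thesis
    unfolding selfadj_def
    by (auto simp: op_adj_scaleR op_adj_add op_adj_comp comp_in_ell2_ops add_in_ell2_ops)
qed

lemma selfadj_square_root: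
  fixes X :: "'a operator"
  assumes "selfadj X" "norm X < 1"
  obtains R where "selfadj R" "R o\<^sub>L R = id_blinfun - X"
proof -
  obtain Y :: "'a operator" where "Y \<in> {Y. selfadj Y} \<inter> cball 0 (norm X)"
    and sq: "(id_blinfun - Y) o\<^sub>L (id_blinfun - Y) = id_blinfun - X"
  proof (rule square_root_in_closed_set[of "{Y. selfadj Y} \<inter> cball 0 (norm X)" "norm X" X])
    show "closed ({Y. selfadj Y} \<inter> cball 0 (norm X))" by (intro closed_Int closed_selfadj closed_cball)
    show "0 \<in> {Y. selfadj Y} \<inter> cball 0 (norm X)" by (simp add: selfadj_def)
    fix Y :: "'a operator" assume Y: "Y \<in> {Y. selfadj Y} \<inter> cball 0 (norm X)"
    then have "norm (Y o\<^sub>L Y) \<le> norm X * norm X"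
      by (intro order_trans[OF norm_blinfun_compose] mult_mono) auto
    also have "\<dots> \<le> norm X" using assms(2) by (simp add: mult_left_le)
    finally have "norm (X + (Y o\<^sub>L Y)) \<le> 2 * norm X" by norm
    then show "(1/2) *\<^sub>R (X + (Y o\<^sub>L Y)) \<in> {Y. selfadj Y} \<inter> cball 0 (norm X)"
      using Y selfadj_half_add_square[OF assms(1)] by (auto simp: selfadj_half_add_square)
  qed (use assms in auto)
  then have "selfadj (id_blinfun - Y)" by (auto simp: selfadj_def op_adj_diff)
  then show ?thesis using that sq by blast
qed

text \<open>The open mapping theorem for an operator with closed range. By Baire's theorem the closure of the
  image of some ball has interior points in the range. Differences of such points give, for every \<open>y\<close> in
  the range, some \<open>u\<close> of comparable norm with \<open>|y - T u| \<le> |y|/2\<close>, and iteration removes the error.\<close>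

lemma bounded_preimages_if_closed_range:
  fixes T :: "'b::banach \<Rightarrow>\<^sub>L 'c::banach"
  assumes cl: "closed (range (blinfun_apply T))"
  obtains C where "C > 0" "\<And>y. y \<in> range (blinfun_apply T) \<Longrightarrow> \<exists>u. T u = y \<and> norm u \<le> C * norm y"
proof -
  define Y where "Y = range (blinfun_apply T)"
  define G where "G n = closure (T ` cball 0 (real n))" for n
  let ?X = "top_of_set Y"
  have GY: "G n \<subseteq> Y" for n
    unfolding G_def Y_def by (rule closure_minimal[OF _ cl]) auto
  have cm: "completely_metrizable_space ?X"
    using completely_metrizable_space_closedin[OF completely_metrizable_space_euclidean] cl
    by (auto simp: Y_def)
  have "\<exists>n. ?X interior_of (G n) \<noteq> {}"
  proof (rule ccontr)
    assume neg: "\<nexists>n. ?X interior_of (G n) \<noteq> {}"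
    have "?X interior_of \<Union>(range G) = {}"
    proof (intro Baire_category_alt)
      fix S assume "S \<in> range G"
      then obtain n where "S = G n" by blast
      then show "closedin ?X S \<and> ?X interior_of S = {}"
        using neg GY[of n] by (auto intro!: closed_subset simp: G_def)
    qed (use cm in auto)
    moreover have "\<Union>(range G) = Y"
    proof (intro equalityI subsetI)
      fix y assume "y \<in> Y"
      then obtain u where u: "y = T u" by (auto simp: Y_def)
      obtain n where "norm u \<le> real n" using real_arch_simple by blast
      then have "y \<in> T ` cball 0 (real n)" by (auto simp: u)
      then have "y \<in> G n" unfolding G_def by (rule subsetD[OF closure_subset])
      then show "y \<in> \<Union>(range G)" by blast
    next
      show "y \<in> Y" if "y \<in> \<Union>(range G)" for y using that GY by blast
    qed
    ultimately have "Y = {}" by (metis interior_of_topspace topspace_euclidean_subtopology)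
    then show False by (auto simp: Y_def)
  qed
  then obtain n y0 where "y0 \<in> ?X interior_of (G n)" by blast
  then obtain U where "openin ?X U" "y0 \<in> U" "U \<subseteq> G n" by (auto simp: interior_of_def)
  then obtain r where r: "r > 0" "ball y0 r \<inter> Y \<subseteq> G n" "y0 \<in> Y"
    unfolding openin_contains_ball by (meson order_trans subsetD)
  define D where "D = 4 * real n / r"
  have D0: "D \<ge> 0" using r by (simp add: D_def)
  have lin: "y + z \<in> Y" "c *\<^sub>R y \<in> Y" if "y \<in> Y" "z \<in> Y" for y z c
    using that unfolding Y_def
    by (auto simp flip: blinfun.add_right blinfun.scaleR_right)
  have approx: "\<exists>u. norm u \<le> D * norm y \<and> norm (y - T u) \<le> norm y / 2" if y: "y \<in> Y" for y
  proof (cases "y = 0")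
    case False
    define t where "t = r / 2 / norm y"
    have t: "t > 0" "norm (t *\<^sub>R y) = r / 2" using False r by (auto simp: t_def)
    have "y0 + t *\<^sub>R y \<in> G n" "y0 \<in> G n"
      using r t y lin[of y0 "t *\<^sub>R y"] lin(2)[of y y] by (auto simp: dist_norm intro!: subsetD[OF r(2)])
    moreover have "\<exists>u. norm u \<le> real n \<and> norm (T u - z) < r / 8" if z: "z \<in> G n" for z
    proof -
      have "\<exists>w \<in> T ` cball 0 (real n). dist w z < r / 8"
        using z r(1) unfolding G_def closure_approachable by (meson divide_pos_pos zero_less_numeral)
      then show ?thesis by (auto simp: dist_norm)
    qed
    ultimately obtain u1 u2 where u: "norm u1 \<le> real n" "norm (T u1 - (y0 + t *\<^sub>R y)) < r / 8"
      "norm u2 \<le> real n" "norm (T u2 - y0) < r / 8" by metis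
    define u where "u = (1/t) *\<^sub>R (u1 - u2)"
    have "norm u \<le> (2 * real n) / t"
      unfolding u_def using u(1,3) t norm_triangle_ineq4[of u1 u2] by (simp add: divide_simps)
    also have "\<dots> = D * norm y" using r False by (simp add: t_def D_def field_simps)
    finally have 1: "norm u \<le> D * norm y" .
    have "norm (t *\<^sub>R y - T (u1 - u2)) \<le> r / 4"
    proof -
      have "t *\<^sub>R y - T (u1 - u2) = (T u2 - y0) - (T u1 - (y0 + t *\<^sub>R y))"
        by (simp add: blinfun.diff_right)
      then have "norm (t *\<^sub>R y - T (u1 - u2)) \<le> norm (T u2 - y0) + norm (T u1 - (y0 + t *\<^sub>R y))"
        by (metis norm_triangle_ineq4)
      then show ?thesis using u(2,4) by linarith
    qed
    moreover have "y - T u = (1/t) *\<^sub>R (t *\<^sub>R y - T (u1 - u2))"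
      using t(1) unfolding u_def blinfun.scaleR_right scaleR_diff_right[of "1/t" "t *\<^sub>R y"] by simp
    ultimately have "norm (y - T u) \<le> (1/t) * (r / 4)" using t by (simp add: divide_simps)
    also have "\<dots> = norm y / 2" using False r by (simp add: t_def)
    finally show ?thesis using 1 by blast
  qed (auto intro: exI[of _ 0])
  then obtain g where g: "\<And>y. y \<in> Y \<Longrightarrow> norm (g y) \<le> D * norm y"
    "\<And>y. y \<in> Y \<Longrightarrow> norm (y - T (g y)) \<le> norm y / 2" by metis
  have "\<exists>u. T u = y \<and> norm u \<le> (2 * D + 1) * norm y" if y: "y \<in> Y" for y
  proof -
    define z where "z k = ((\<lambda>y. y - T (g y)) ^^ k) y" for k
    have z: "z 0 = y" "z (Suc k) = z k - T (g (z k))" for k by (auto simp: z_def)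
    have zY: "z k \<in> Y" for k
    proof (induction k)
      case (Suc k)
      have "T (- g (z k)) \<in> Y" by (simp add: Y_def)
      from lin(1)[OF Suc this] show ?case by (simp add: z blinfun.minus_right)
    qed (simp add: z y)
    have nz: "norm (z k) \<le> norm y * (1/2)^k" for k
    proof (induction k)
      case (Suc k)
      then show ?case using g(2)[OF zY[of k]] by (simp add: z)
    qed (simp add: z)
    have ng: "norm (g (z k)) \<le> (D * norm y) * (1/2)^k" for k
      using order_trans[OF g(1)[OF zY] mult_left_mono[OF nz D0]] by (simp add: mult.assoc)
    have gs: "summable (\<lambda>k. (D * norm y) * (1/2)^k)" by (intro summable_mult summable_geometric) auto
    have sn: "summable (\<lambda>k. norm (g (z k)))"
      by (rule summable_comparison_test[OF _ gs]) (use ng in auto)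
    define u where "u = suminf (\<lambda>k. g (z k))"
    have "norm u \<le> suminf (\<lambda>k. norm (g (z k)))" unfolding u_def by (rule summable_norm[OF sn])
    also have "\<dots> \<le> suminf (\<lambda>k. (D * norm y) * (1/2)^k)" by (rule suminf_le[OF ng sn gs])
    also have "\<dots> = 2 * D * norm y" by (subst suminf_mult) (auto simp: suminf_geometric)
    finally have "norm u \<le> (2 * D + 1) * norm y"
      using norm_ge_zero[of y] unfolding distrib_right by linarith
    moreover have "T u = y"
    proof -
      have part: "(\<Sum>k<m. T (g (z k))) = y - z m" for m
        by (induction m) (auto simp: z)
      have "(\<lambda>m. norm y * (1/2)^m) \<longlonglongrightarrow> norm y * 0" by (intro tendsto_intros) auto
      then have "z \<longlonglongrightarrow> 0" using nz by (intro Lim_null_comparison[of z]) auto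
      then have "(\<lambda>m. y - z m) \<longlonglongrightarrow> y - 0" by (intro tendsto_intros)
      then have "(\<lambda>k. T (g (z k))) sums y" unfolding sums_def part by simp
      moreover have "(\<lambda>k. T (g (z k))) sums T u"
        unfolding u_def by (rule bounded_linear.sums[OF blinfun.bounded_linear_right])
          (use summable_norm_cancel[OF sn] summable_sums in blast)
      ultimately show ?thesis using sums_unique2 by blast
    qed
    ultimately show ?thesis by blast
  qed
  then show ?thesis using that[of "2 * D + 1"] D0 by (auto simp: Y_def)
qed

section \<open>Finite-dimensional subspaces and finite-rank operators\<close>

definition orthonormal :: "'a ell2 set \<Rightarrow> bool" where
  "orthonormal E \<longleftrightarrow> (\<forall>e\<in>E. \<forall>f\<in>E. ell2_cinner e f = (if e = f then 1 else 0))"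

lemma orthonormal_independent:
  assumes "orthonormal E"
  shows "ell2.independent E"
proof
  assume "ell2.dependent E"
  then obtain t u v where t: "finite t" "t \<subseteq> E" "(\<Sum>v\<in>t. ell2_scale (u v) v) = 0" "v \<in> t" "u v \<noteq> 0"
    unfolding ell2.dependent_explicit by blast
  have "0 = ell2_cinner (\<Sum>v\<in>t. ell2_scale (u v) v) v" by (simp add: t)
  also have "\<dots> = (\<Sum>w\<in>t. u w * (if w = v then 1 else 0))"
    unfolding cinner_sum_left ell2_cinner_scale_left
    by (rule sum.cong) (use assms t in \<open>auto simp: orthonormal_def subset_iff\<close>)
  also have "\<dots> = u v" using t by (simp add: if_distrib[of "(*) _"] cong: if_cong)
  finally show False using t by simp
qed

text \<open>An orthonormal subset of maximal cardinality is a basis.\<close>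

lemma orthonormal_basis_ex:
  assumes V: "ell2.subspace V" and B: "finite B" "V \<subseteq> ell2.span B"
  obtains E where "finite E" "E \<subseteq> V" "orthonormal E"
    "\<And>v. v \<in> V \<Longrightarrow> v = (\<Sum>e\<in>E. ell2_scale (ell2_cinner v e) e)"
proof -
  define P where "P E \<longleftrightarrow> finite E \<and> E \<subseteq> V \<and> orthonormal E" for E
  have "\<exists>E. P E \<and> (\<forall>E'. P E' \<longrightarrow> card E' \<le> card E)"
  proof (rule Lattices_Big.ex_has_greatest_nat[where k = "{}" and b = "Suc (card B)"])
    show "P {}" by (simp add: P_def orthonormal_def)
    show "\<forall>E. P E \<longrightarrow> card E < Suc (card B)"
      using ell2.independent_span_bound[OF B(1) orthonormal_independent] B(2)
      by (auto simp: P_def less_Suc_eq_le)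
  qed
  then obtain E where E: "finite E" "E \<subseteq> V" "orthonormal E"
    and max: "\<And>E'. P E' \<Longrightarrow> card E' \<le> card E" by (auto simp: P_def)
  have "v = (\<Sum>e\<in>E. ell2_scale (ell2_cinner v e) e)" if v: "v \<in> V" for v
  proof (rule ccontr)
    define w where "w = v - (\<Sum>e\<in>E. ell2_scale (ell2_cinner v e) e)"
    assume "v \<noteq> (\<Sum>e\<in>E. ell2_scale (ell2_cinner v e) e)"
    then have w0: "norm w \<noteq> 0" by (simp add: w_def)
    have wV: "w \<in> V"
      unfolding w_def using V v E(2)
      by (intro ell2.subspace_diff ell2.subspace_sum ell2.subspace_scale) auto
    have orth: "ell2_cinner w e = 0" if "e \<in> E" for e
    proof -
      have "ell2_cinner (\<Sum>e\<in>E. ell2_scale (ell2_cinner v e) e) e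
          = (\<Sum>f\<in>E. ell2_cinner v f * (if f = e then 1 else 0))"
        unfolding cinner_sum_left ell2_cinner_scale_left
        by (rule sum.cong) (use E(3) that in \<open>auto simp: orthonormal_def\<close>)
      also have "\<dots> = ell2_cinner v e" using that E(1) by (simp add: if_distrib[of "(*) _"] cong: if_cong)
      finally show ?thesis by (simp add: w_def cinner_diff_left)
    qed
    define f where "f = ell2_scale (complex_of_real (inverse (norm w))) w"
    have ff: "ell2_cinner f f = 1"
      using w0 by (simp add: f_def cinner_self norm_inverse)
    have fe: "ell2_cinner f e = 0" "ell2_cinner e f = 0" if "e \<in> E" for e
      using orth[OF that] ell2_cinner_commute[of e w]
      by (simp_all add: f_def ell2_cinner_scale_left cinner_scale_right)
    have "f \<notin> E" using fe(1)[of f] ff by auto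
    have "P (insert f E)"
      unfolding P_def using E ff fe wV V \<open>f \<notin> E\<close>
      by (auto simp: orthonormal_def f_def ell2.subspace_scale)
    then show False using max[of "insert f E"] \<open>f \<notin> E\<close> E(1) by simp
  qed
  then show ?thesis using that E by blast
qed

text \<open>A finite-rank operator maps the unit ball into the compact set of all combinations of an
  orthonormal basis with bounded coefficients.\<close>

lemma finite_rank_compact:
  assumes K: "K \<in> ell2_ops" and B: "finite B" "range (blinfun_apply K) \<subseteq> ell2.span B"
  shows "K \<in> compact_ops"
proof -
  obtain E where E: "finite E" "E \<subseteq> ell2.span B" "orthonormal E"
    "\<And>v. v \<in> ell2.span B \<Longrightarrow> v = (\<Sum>e\<in>E. ell2_scale (ell2_cinner v e) e)"
    using orthonormal_basis_ex[of "ell2.span B" B] B(1) by auto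
  define S where "S F = {(\<Sum>e\<in>F. ell2_scale (t e) e) |t. \<forall>e. cmod (t e) \<le> norm K}" for F :: "'a ell2 set"
  have S: "compact (S F)" if "finite F" for F
    using that
  proof (induction F rule: finite_induct)
    case empty
    have "S {} = {0}" by (auto simp: S_def intro!: exI[of _ "\<lambda>_. 0"])
    then show ?case by simp
  next
    case (insert f F)
    have "bounded_linear (\<lambda>t. ell2_scale t f)"
      by (rule bounded_linear_intro[where K = "norm f"])
        (auto simp: ell2.scale_left_distrib scaleR_ell2_def scaleR_conv_of_real)
    then have "compact ((\<lambda>t. ell2_scale t f) ` cball 0 (norm K))"
      by (intro compact_continuous_image compact_cball linear_continuous_on)
    with insert have "compact {x + y |x y. x \<in> (\<lambda>t. ell2_scale t f) ` cball 0 (norm K) \<and> y \<in> S F}"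
      by (intro compact_sums) auto
    also have "\<dots> = S (insert f F)"
    proof (intro equalityI subsetI)
      fix z assume "z \<in> {x + y |x y. x \<in> (\<lambda>t. ell2_scale t f) ` cball 0 (norm K) \<and> y \<in> S F}"
      then obtain s t where st: "cmod s \<le> norm K" "\<forall>e. cmod (t e) \<le> norm K"
        "z = ell2_scale s f + (\<Sum>e\<in>F. ell2_scale (t e) e)" by (auto simp: S_def)
      have "z = (\<Sum>e\<in>insert f F. ell2_scale ((t(f := s)) e) e)"
        using insert st(3) by (auto intro!: sum.cong)
      then show "z \<in> S (insert f F)" using st unfolding S_def by (intro CollectI exI[of _ "t(f := s)"]) auto
    next
      fix z assume "z \<in> S (insert f F)"
      then obtain t where t: "\<forall>e. cmod (t e) \<le> norm K" "z = (\<Sum>e\<in>insert f F. ell2_scale (t e) e)"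
        by (auto simp: S_def)
      then have "z = ell2_scale (t f) f + (\<Sum>e\<in>F. ell2_scale (t e) e)" using insert by simp
      moreover have "ell2_scale (t f) f \<in> (\<lambda>t. ell2_scale t f) ` cball 0 (norm K)" using t(1) by auto
      moreover have "(\<Sum>e\<in>F. ell2_scale (t e) e) \<in> S F" using t(1) by (auto simp: S_def)
      ultimately show "z \<in> {x + y |x y. x \<in> (\<lambda>t. ell2_scale t f) ` cball 0 (norm K) \<and> y \<in> S F}"
        by blast
    qed
    finally show ?case .
  qed
  have "K ` cball 0 1 \<subseteq> S E"
  proof
    fix w assume "w \<in> K ` cball 0 1"
    then obtain v where v: "w = K v" "norm v \<le> 1" by auto
    have nK: "norm w \<le> norm K" using norm_blinfun[of K v] mult_left_mono[OF v(2), of "norm K"] v(1) by simp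
    define t where "t e = (if e \<in> E then ell2_cinner w e else 0)" for e
    have "cmod (t e) \<le> norm K" for e
    proof (cases "e \<in> E")
      case True
      then have "complex_of_real ((norm e)\<^sup>2) = complex_of_real 1"
        using E(3) by (simp only: cinner_self[symmetric]) (simp add: orthonormal_def)
      then have "(norm e)\<^sup>2 = 1" by (simp only: of_real_eq_iff)
      then have "norm e = 1" by (metis norm_ge_zero real_sqrt_one real_sqrt_unique)
      then show ?thesis using cmod_cinner_le[of w e] nK True by (simp add: t_def)
    qed (simp add: t_def)
    moreover have "w = (\<Sum>e\<in>E. ell2_scale (t e) e)"
      using E(4)[of w] B(2) v(1) by (auto simp: t_def)
    ultimately show "w \<in> S E" unfolding S_def by blast
  qed
  then have "closure (K ` cball 0 1) \<subseteq> S E"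
    using S[OF E(1)] compact_imp_closed closure_minimal by blast
  then have "compact (closure (K ` cball 0 1))"
    using S[OF E(1)] by (metis closed_closure compact_Int_closed inf.absorb2)
  then show ?thesis using K by (simp add: compact_ops_def)
qed

text \<open>The operator of rank one that is written \<open>|u\<rangle>\<langle>w|\<close> in Dirac's notation.\<close>

definition butterfly :: "'a ell2 \<Rightarrow> 'a ell2 \<Rightarrow> 'a operator" where
  "butterfly u w = Blinfun (\<lambda>v. ell2_scale (ell2_cinner v w) u)"

lemma butterfly_apply [simp]: "blinfun_apply (butterfly u w) v = ell2_scale (ell2_cinner v w) u"
  and butterfly_in_ell2_ops [simp]: "butterfly u w \<in> ell2_ops"
proof -
  have 1: "ell2_scale (ell2_cinner (v + v') w) u = ell2_scale (ell2_cinner v w) u + ell2_scale (ell2_cinner v' w) u" for v v'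
    by (simp add: ell2_cinner_add_left ell2.scale_left_distrib)
  have 2: "ell2_scale (ell2_cinner (ell2_scale c v) w) u = ell2_scale c (ell2_scale (ell2_cinner v w) u)" for c v
    by (simp add: ell2_cinner_scale_left)
  have 3: "norm (ell2_scale (ell2_cinner v w) u) \<le> (norm w * norm u) * norm v" for v
    using mult_right_mono[OF cmod_cinner_le[of v w] norm_ge_zero[of u]] by (simp add: ac_simps)
  obtain T where "T \<in> ell2_ops" "blinfun_apply T = (\<lambda>v. ell2_scale (ell2_cinner v w) u)"
    using ell2_op_ex[of "\<lambda>v. ell2_scale (ell2_cinner v w) u", OF 1 2 3] by blast
  moreover from this have "butterfly u w = T"
    unfolding butterfly_def by (metis blinfun_apply_inverse)
  ultimately show "butterfly u w v = ell2_scale (ell2_cinner v w) u" "butterfly u w \<in> ell2_ops" by auto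
qed

lemma op_adj_butterfly: "op_adj (butterfly u w) = butterfly w u"
  by (rule op_adj_unique)
    (auto simp: ell2_cinner_scale_left cinner_scale_right ell2_cinner_commute[of w] mult.commute)

lemma entry_butterfly: "entry (butterfly u w) x y = ell2_fun u x * cnj (ell2_fun w y)"
  unfolding entry_def butterfly_apply ell2_fun_scale
  by (subst ell2_cinner_commute) simp

lemma norm_butterfly_le: "norm (butterfly u w) \<le> norm u * norm w"
proof (rule norm_blinfun_bound)
  show "norm (butterfly u w v) \<le> norm u * norm w * norm v" for v
    using mult_right_mono[OF cmod_cinner_le[of v w] norm_ge_zero[of u]] by (simp add: ac_simps)
qed simp

lemma sum_in_ell2_ops [intro]: "(\<And>i. i \<in> F \<Longrightarrow> T i \<in> ell2_ops) \<Longrightarrow> sum T F \<in> ell2_ops"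
  by (induction F rule: infinite_finite_induct) auto

text \<open>The orthogonal projection onto \<open>V\<close>. Its decomposition into operators of rank one is kept, since
  these are easily approximated by finite matrices.\<close>

lemma projection_ex:
  assumes V: "ell2.subspace V" and B: "finite B" "V \<subseteq> ell2.span B"
  obtains P E where "finite E" "P = (\<Sum>e\<in>E. butterfly e e)" "selfadj P" "range (blinfun_apply P) \<subseteq> V"
    "\<And>v. v \<in> V \<Longrightarrow> P v = v"
proof -
  obtain E where E: "finite E" "E \<subseteq> V" "orthonormal E"
    "\<And>v. v \<in> V \<Longrightarrow> v = (\<Sum>e\<in>E. ell2_scale (ell2_cinner v e) e)"
    using orthonormal_basis_ex[OF assms] by metis
  define P where "P = (\<Sum>e\<in>E. butterfly e e)"
  have P: "P v = (\<Sum>e\<in>E. ell2_scale (ell2_cinner v e) e)" for v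
    by (simp add: P_def blinfun.sum_left)
  have entry_sum: "entry (sum T F) x y = (\<Sum>i\<in>F. entry (T i) x y)" for T and F :: "'a ell2 set" and x y
    by (induction F rule: infinite_finite_induct) auto
  have "selfadj P"
    unfolding selfadj_iff by (auto simp: P_def entry_sum entry_butterfly mult.commute)
  moreover have "range (blinfun_apply P) \<subseteq> V"
    using E(2) by (auto simp: P intro!: ell2.subspace_sum[OF V] ell2.subspace_scale[OF V])
  ultimately show ?thesis using that[OF E(1) P_def] E(4) by (metis P)
qed

section \<open>Convolution-dominated operators\<close>

text \<open>The entry \<open>(x, y)\<close> of a convolution-dominated operator is controlled by a summable function
  of \<open>x y\<inverse>\<close>, the index of the diagonal on which it lies.\<close>

definition dominated_by :: "('g::group_add \<Rightarrow> real) \<Rightarrow> 'g operator \<Rightarrow> bool" where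
  "dominated_by k T \<longleftrightarrow> T \<in> ell2_ops \<and> k summable_on UNIV \<and> (\<forall>x y. cmod (entry T x y) \<le> k (x - y))"

definition dominated :: "'g::group_add operator \<Rightarrow> bool" where
  "dominated T \<longleftrightarrow> (\<exists>k. dominated_by k T)"

lemma dominated_by_nonneg: "dominated_by k T \<Longrightarrow> 0 \<le> k g"
  unfolding dominated_by_def by (metis diff_0_right norm_ge_zero order_trans)

lemma dominated_in_ell2_ops: "dominated T \<Longrightarrow> T \<in> ell2_ops"
  by (auto simp: dominated_def dominated_by_def)

text \<open>Boundedness of the operator is Schur's test.\<close>

lemma operator_of_matrix:
  fixes M :: "'g::group_add \<Rightarrow> 'g \<Rightarrow> complex"
  assumes k: "k summable_on UNIV" and M: "\<And>x y. cmod (M x y) \<le> k (x - y)"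
  obtains T where "dominated_by k T" "\<And>x y. entry T x y = M x y" "norm T \<le> infsum k UNIV"
proof -
  have k0: "0 \<le> k g" for g using M[of g 0] by (metis diff_0_right norm_ge_zero order_trans)
  note aux = int_op_bound_aux[OF k M]
  define f where "f v = Abs_ell2 (\<lambda>x. \<Sum>\<^sub>\<infinity>y. M x y * ell2_fun v y)" for v
  have f: "ell2_fun (f v) x = (\<Sum>\<^sub>\<infinity>y. M x y * ell2_fun v y)" for v x
    unfolding f_def using aux(2) by (subst ell2_fun_Abs) auto
  have add: "f (v + w) = f v + f w" for v w
    by (rule ell2_eqI) (simp add: f distrib_left infsum_add aux(1))
  have scale: "f (ell2_scale c v) = ell2_scale c (f v)" for c v
    by (rule ell2_eqI) (simp add: f mult.left_commute infsum_cmult_right')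
  have C0: "0 \<le> infsum k UNIV" by (simp add: infsum_nonneg k0)
  have "(norm (f v))\<^sup>2 \<le> (infsum k UNIV * norm v)\<^sup>2" for v
    unfolding norm_ell2_sq f by (rule aux(3))
  then have nb: "norm (f v) \<le> infsum k UNIV * norm v" for v
    by (rule power2_le_imp_le) (simp add: C0)
  obtain T where T: "T \<in> ell2_ops" "blinfun_apply T = f" "norm T \<le> infsum k UNIV"
    using ell2_op_ex[OF add scale nb] C0 by blast
  have entry: "entry T x y = M x y" for x y
    using has_sum_singleton[of y "\<lambda>z. M x z * ell2_fun (ket y) z"] by (simp add: entry_def T f infsumI)
  show thesis using that[of T] T k M by (simp add: dominated_by_def entry)
qed

lemma norm_le_infsum_if_dominated_by:
  assumes "dominated_by k T"
  shows "norm T \<le> infsum k UNIV"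
proof -
  obtain S where "dominated_by k S" "\<And>x y. entry S x y = entry T x y" "norm S \<le> infsum k UNIV"
    using operator_of_matrix[of k "entry T"] assms unfolding dominated_by_def by blast
  then show ?thesis using ell2_op_eqI[of S T] assms by (auto simp: dominated_by_def)
qed

definition convolve :: "('g::group_add \<Rightarrow> real) \<Rightarrow> ('g \<Rightarrow> real) \<Rightarrow> 'g \<Rightarrow> real" where
  "convolve k l g = (\<Sum>\<^sub>\<infinity>h. k h * l (- h + g))"

lemma convolve_summable:
  fixes k l :: "'g::group_add \<Rightarrow> real"
  assumes k: "k summable_on UNIV" "\<And>g. 0 \<le> k g" and l: "l summable_on UNIV" "\<And>g. 0 \<le> l g"
  shows "(\<lambda>h. k h * l (- h + g)) summable_on UNIV"
    and "convolve k l summable_on UNIV"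
    and "infsum (convolve k l) UNIV = infsum k UNIV * infsum l UNIV"
proof -
  have bij: "bij_betw (\<lambda>(g, h). (h, - h + g)) (UNIV \<times> UNIV) (UNIV \<times> (UNIV :: 'g set))"
    by (rule bij_betw_byWitness[where f' = "\<lambda>(h, t). (h + t, h)"]) (auto simp: add.assoc[symmetric])
  have prod: "(\<lambda>(h, t). k h * l t) summable_on UNIV \<times> UNIV"
    by (rule summable_on_SigmaI[where g = "\<lambda>h. k h * infsum l UNIV"])
      (auto intro!: has_sum_cmult_right has_sum_infsum l summable_on_cmult_left k mult_nonneg_nonneg)
  have prod_sum: "(\<Sum>\<^sub>\<infinity>(h, t)\<in>UNIV \<times> UNIV. k h * l t) = infsum k UNIV * infsum l UNIV"
    using infsum_Sigma'_banach[of "\<lambda>h t. k h * l t" UNIV "\<lambda>_. UNIV"] prod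
    by (simp add: infsum_cmult_right' infsum_cmult_left')
  have conv: "(\<lambda>(g, h). k h * l (- h + g)) summable_on UNIV \<times> UNIV"
    using summable_on_reindex_bij_betw[OF bij, of "\<lambda>(h, t). k h * l t"] prod
    by (simp add: case_prod_unfold)
  have conv_sum: "(\<Sum>\<^sub>\<infinity>(g, h)\<in>UNIV \<times> UNIV. k h * l (- h + g)) = infsum k UNIV * infsum l UNIV"
    using infsum_reindex_bij_betw[OF bij, of "\<lambda>(h, t). k h * l t"] prod_sum
    by (simp add: case_prod_unfold)
  show "(\<lambda>h. k h * l (- h + g)) summable_on UNIV"
    using summable_on_SigmaD1[of "\<lambda>g h. k h * l (- h + g)" UNIV "\<lambda>_. UNIV" g] conv k l by auto
  show "convolve k l summable_on UNIV"
    using summable_on_Sigma_banach[of "\<lambda>g h. k h * l (- h + g)" UNIV "\<lambda>_. UNIV"] conv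
    by (simp add: convolve_def[abs_def])
  show "infsum (convolve k l) UNIV = infsum k UNIV * infsum l UNIV"
    using infsum_Sigma'_banach[of "\<lambda>g h. k h * l (- h + g)" UNIV "\<lambda>_. UNIV"] conv conv_sum
    by (simp add: convolve_def[abs_def])
qed

lemma bij_diff_left: "bij (\<lambda>z. x - z :: 'g::group_add)"
  by (rule bij_betw_byWitness[where f' = "\<lambda>h. - h + x"]) (auto simp: algebra_simps)

text \<open>The sum over \<open>z\<close> of \<open>k (x z\<inverse>) l (z y\<inverse>)\<close> depends on \<open>x y\<inverse>\<close> only.\<close>

lemma dominated_by_comp:
  assumes S: "dominated_by k S" and T: "dominated_by l T"
  shows "dominated_by (convolve k l) (S o\<^sub>L T)"
proof -
  have k: "k summable_on UNIV" "\<And>g. 0 \<le> k g" and l: "l summable_on UNIV" "\<And>g. 0 \<le> l g"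
    using S T dominated_by_nonneg by (auto simp: dominated_by_def)
  have S': "S \<in> ell2_ops" "T \<in> ell2_ops" using S T by (auto simp: dominated_by_def)
  have "cmod (entry (S o\<^sub>L T) x y) \<le> convolve k l (x - y)" for x y
  proof (rule norm_infsum_le[OF entry_comp_has_sum[OF S'(1)]])
    have "((\<lambda>h. k h * l (- h + (x - y))) has_sum convolve k l (x - y)) UNIV"
      unfolding convolve_def by (rule has_sum_infsum[OF convolve_summable(1)[OF k l]])
    then have "((\<lambda>z. k (x - z) * l (- (x - z) + (x - y))) has_sum convolve k l (x - y)) UNIV"
      using has_sum_reindex_bij_betw[OF bij_diff_left[of x], of "\<lambda>h. k h * l (- h + (x - y))"] by simp
    moreover have "- (x - z) + (x - y) = z - y" for z by (simp add: algebra_simps)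
    ultimately show "((\<lambda>z. k (x - z) * l (z - y)) has_sum convolve k l (x - y)) UNIV" by simp
    show "norm (entry S x z * entry T z y) \<le> k (x - z) * l (z - y)" for z
      unfolding norm_mult using S T by (intro mult_mono) (auto simp: dominated_by_def k)
  qed
  then show ?thesis using S' convolve_summable(2)[OF k l] by (auto simp: dominated_by_def)
qed

lemma bij_uminus_group: "bij (uminus :: 'g::group_add \<Rightarrow> 'g)"
  by (rule bij_betw_byWitness[where f' = uminus]) auto

lemma dominated_comp: "dominated S \<Longrightarrow> dominated T \<Longrightarrow> dominated (S o\<^sub>L T)"
  unfolding dominated_def using dominated_by_comp by blast

lemma dominated_add:
  assumes "dominated S" "dominated T"
  shows "dominated (S + T)"
proof -
  obtain k l where "dominated_by k S" "dominated_by l T" using assms by (auto simp: dominated_def)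
  then have "dominated_by (\<lambda>g. k g + l g) (S + T)"
    unfolding dominated_by_def
    by (auto intro!: summable_on_add order_trans[OF norm_triangle_ineq] add_mono)
  then show ?thesis by (auto simp: dominated_def)
qed

lemma dominated_op_scale:
  assumes "dominated T"
  shows "dominated (op_scale c T)"
proof -
  obtain k where "dominated_by k T" using assms by (auto simp: dominated_def)
  then have "dominated_by (\<lambda>g. cmod c * k g) (op_scale c T)"
    unfolding dominated_by_def by (auto intro!: summable_on_cmult_right mult_left_mono simp: norm_mult)
  then show ?thesis by (auto simp: dominated_def)
qed

lemma dominated_scaleR: "dominated T \<Longrightarrow> dominated (r *\<^sub>R T)"
  by (simp add: scaleR_eq_op_scale dominated_op_scale)

lemma dominated_diff: "dominated S \<Longrightarrow> dominated T \<Longrightarrow> dominated (S - T)"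
  using dominated_add[of S "(-1) *\<^sub>R T"] dominated_scaleR[of T "-1"] by simp

lemma dominated_op_adj:
  assumes "dominated T"
  shows "dominated (op_adj T)"
proof -
  obtain k where k: "dominated_by k T" using assms by (auto simp: dominated_def)
  have T: "T \<in> ell2_ops" using assms by (rule dominated_in_ell2_ops)
  have "(\<lambda>g. k (- g)) summable_on UNIV"
    using k summable_on_reindex_bij_betw[OF bij_uminus_group, of k] by (simp add: dominated_by_def)
  moreover have "cmod (entry (op_adj T) x y) \<le> k (- (x - y))" for x y
    using k by (simp add: entry_op_adj[OF T] dominated_by_def)
  ultimately have "dominated_by (\<lambda>g. k (- g)) (op_adj T)"
    using op_adj_in_ell2_ops[OF T] unfolding dominated_by_def by blast
  then show ?thesis by (auto simp: dominated_def)
qed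

lemma dominated_if_finite_matrix:
  fixes T :: "'g::group_add operator"
  assumes T: "T \<in> ell2_ops" and fin: "finite ((\<lambda>(x, y). x - y) ` {(x, y). entry T x y \<noteq> 0})"
  shows "dominated T"
proof -
  define D where "D = (\<lambda>(x, y). x - y) ` {(x, y). entry T x y \<noteq> 0}"
  have "(\<lambda>g. if g \<in> D then norm T else 0) summable_on UNIV"
    by (rule summable_on_finite_support) (rule finite_subset[OF _ fin], auto simp: D_def)
  moreover have "cmod (entry T x y) \<le> (if x - y \<in> D then norm T else 0)" for x y
  proof (cases "entry T x y = 0")
    case False
    then have "x - y \<in> D" by (force simp: D_def)
    then show ?thesis by (simp add: cmod_entry_le)
  qed simp
  ultimately show ?thesis unfolding dominated_def dominated_by_def using T by blast
qed

lemma dominated_id: "dominated id_blinfun"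
proof (rule dominated_if_finite_matrix)
  show "finite ((\<lambda>(x, y). x - y) ` {(x, y). entry (id_blinfun :: 'a operator) x y \<noteq> 0})"
    by (rule finite_subset[of _ "{0}"]) (auto simp: entry_id split: if_splits)
qed simp

text \<open>Operators dominated by a function of sum at most \<open>r\<close> are described here without reference to
  the dominating function, by finite sums over one entry from each diagonal. In this form the set is
  visibly closed.\<close>

definition dom_ball :: "real \<Rightarrow> 'g::group_add operator set" where
  "dom_ball r = {T \<in> ell2_ops. \<forall>F x. finite F \<longrightarrow> (\<Sum>g\<in>F. cmod (entry T (g + x g) (x g))) \<le> r}"

lemma closed_dom_ball: "closed (dom_ball r :: 'g::group_add operator set)"
proof -
  have "(dom_ball r :: 'g operator set) = ell2_ops \<inter>
      (\<Inter>F\<in>{F. finite F}. \<Inter>x. {T. (\<Sum>g\<in>F. cmod (entry T (g + x g) (x g))) \<le> r})"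
    by (auto simp: dom_ball_def)
  moreover have "closed {T. (\<Sum>g\<in>F. cmod (entry T (g + x g) (x g))) \<le> r}" for F and x :: "'g \<Rightarrow> 'g"
    by (intro closed_Collect_le continuous_intros linear_continuous_on[OF bounded_linear_entry])
  ultimately show ?thesis
    by (simp only:) (intro closed_Int closed_ell2_ops closed_INT ballI)
qed

lemma dom_ball_iff: "T \<in> dom_ball r \<longleftrightarrow> (\<exists>k. dominated_by k T \<and> infsum k UNIV \<le> r)"
proof
  assume "\<exists>k. dominated_by k T \<and> infsum k UNIV \<le> r"
  then obtain k where k: "dominated_by k T" "infsum k UNIV \<le> r" by blast
  have "(\<Sum>g\<in>F. cmod (entry T (g + x g) (x g))) \<le> r" if "finite F" for F x
  proof -
    have "cmod (entry T (g + x g) (x g)) \<le> k g" for g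
      using k(1) unfolding dominated_by_def by (metis add_diff_cancel)
    then have "(\<Sum>g\<in>F. cmod (entry T (g + x g) (x g))) \<le> sum k F" by (rule sum_mono)
    also have "\<dots> \<le> infsum k UNIV"
      by (rule finite_sum_le_infsum)
        (use that k(1) dominated_by_nonneg in \<open>auto simp: dominated_by_def\<close>)
    finally show ?thesis using k(2) by simp
  qed
  then show "T \<in> dom_ball r" using k(1) by (simp add: dom_ball_def dominated_by_def)
next
  assume T: "T \<in> dom_ball r"
  define k where "k g = (SUP y. cmod (entry T (g + y) y))" for g
  have bdd: "bdd_above (range (\<lambda>y. cmod (entry T (g + y) y)))" for g
    using cmod_entry_le[of T] by (auto intro!: bdd_aboveI)
  have le_k: "cmod (entry T x y) \<le> k (x - y)" for x y
    unfolding k_def using cSUP_upper[OF UNIV_I bdd, of "x - y" y] by simp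
  have k0: "0 \<le> k g" for g
    by (rule order_trans[OF norm_ge_zero]) (use le_k[of g 0] in simp)
  have finsum: "sum k F \<le> r" if F: "finite F" for F
  proof (rule field_le_epsilon)
    fix e :: real assume "0 < e"
    define d where "d = e / (real (card F) + 1)"
    have d: "d > 0" "real (card F) * d \<le> e" using \<open>0 < e\<close> by (auto simp: d_def field_simps)
    have "\<exists>y. k g - d < cmod (entry T (g + y) y)" for g
      using less_cSUP_iff[OF UNIV_not_empty bdd[of g], of "k g - d"] d(1) by (auto simp: k_def)
    then obtain x where x: "\<And>g. k g - d < cmod (entry T (g + x g) (x g))" by metis
    have "sum k F \<le> (\<Sum>g\<in>F. cmod (entry T (g + x g) (x g)) + d)"
      by (rule sum_mono) (use x in \<open>smt (verit)\<close>)
    also have "\<dots> \<le> r + e"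
      using T F d(2) by (auto simp: sum.distrib dom_ball_def intro!: add_mono)
    finally show "sum k F \<le> r + e" .
  qed
  have "k summable_on UNIV"
    by (rule nonneg_bdd_above_summable_on) (auto intro!: bdd_aboveI[where M = r] simp: k0 finsum)
  moreover from this have "infsum k UNIV \<le> r" by (rule infsum_le_finite_sums) (simp add: finsum)
  ultimately show "\<exists>k. dominated_by k T \<and> infsum k UNIV \<le> r"
    using T le_k by (auto simp: dominated_by_def dom_ball_def)
qed

lemma dom_ball_half_add_square:
  assumes X: "X \<in> dom_ball r" and Y: "Y \<in> dom_ball r" and r: "0 \<le> r" "r \<le> 1"
  shows "(1/2) *\<^sub>R (X + (Y o\<^sub>L Y)) \<in> dom_ball r"
proof -
  obtain k where k: "dominated_by k X" "infsum k UNIV \<le> r" using X by (auto simp: dom_ball_iff)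
  obtain l where l: "dominated_by l Y" "infsum l UNIV \<le> r" using Y by (auto simp: dom_ball_iff)
  have l0: "0 \<le> infsum l UNIV" using dominated_by_nonneg[OF l(1)] by (simp add: infsum_nonneg)
  have ls: "l summable_on UNIV" using l by (simp add: dominated_by_def)
  note c = dominated_by_comp[OF l(1) l(1)]
  define m where "m g = (1/2) * (k g + convolve l l g)" for g
  have s: "k summable_on UNIV" "convolve l l summable_on UNIV"
    using k c by (auto simp: dominated_by_def)
  have "m summable_on UNIV" unfolding m_def by (intro summable_on_cmult_right summable_on_add s)
  moreover have "cmod (entry ((1/2) *\<^sub>R (X + (Y o\<^sub>L Y))) x y) \<le> m (x - y)" for x y
  proof -
    have "cmod (entry X x y + entry (Y o\<^sub>L Y) x y) \<le> k (x - y) + convolve l l (x - y)"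
      using k(1) c by (intro order_trans[OF norm_triangle_ineq] add_mono) (auto simp: dominated_by_def)
    then show ?thesis by (simp add: m_def norm_mult norm_divide)
  qed
  moreover have "infsum m UNIV \<le> r"
  proof -
    have "infsum m UNIV = (1/2) * (infsum k UNIV + infsum (convolve l l) UNIV)"
      unfolding m_def by (simp add: infsum_cmult_right' infsum_add s del: times_divide_eq_left)
    also have "infsum (convolve l l) UNIV = infsum l UNIV * infsum l UNIV"
      using convolve_summable(3)[OF ls dominated_by_nonneg[OF l(1)] ls dominated_by_nonneg[OF l(1)]] .
    also have "\<dots> \<le> r * 1" by (intro mult_mono) (use l0 l r in auto)
    finally show ?thesis using k(2) by simp
  qed
  ultimately have "dominated_by m ((1/2) *\<^sub>R (X + (Y o\<^sub>L Y)))"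
    using k(1) l(1) by (auto simp: dominated_by_def)
  then show ?thesis using \<open>infsum m UNIV \<le> r\<close> dom_ball_iff by blast
qed

text \<open>For \<open>r \<le> 1\<close> the iteration \<open>Y \<mapsto> (X + Y\<^sup>2)/2\<close> maps \<open>dom_ball r\<close> into itself, because the function that
  dominates \<open>Y\<^sup>2\<close> has sum at most \<open>r\<^sup>2\<close>. As the set is closed, the square root found by iteration is
  convolution-dominated.\<close>

lemma dominated_square_root:
  fixes X :: "'g::group_add operator"
  assumes X: "selfadj X" "dominated_by k X" "infsum k UNIV < 1"
  obtains R where "selfadj R" "dominated R" "R o\<^sub>L R = id_blinfun - X"
proof -
  define r where "r = infsum k UNIV"
  have r: "0 \<le> r" "r < 1" using X dominated_by_nonneg[OF X(2)] by (auto simp: r_def infsum_nonneg)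
  have Xr: "X \<in> dom_ball r" using X by (auto simp: dom_ball_iff r_def)
  obtain Y :: "'g operator" where Y: "Y \<in> {Y. selfadj Y} \<inter> dom_ball r"
    and sq: "(id_blinfun - Y) o\<^sub>L (id_blinfun - Y) = id_blinfun - X"
  proof (rule square_root_in_closed_set[of "{Y. selfadj Y} \<inter> dom_ball r" r X])
    show "closed ({Y. selfadj Y} \<inter> dom_ball r)" by (intro closed_Int closed_selfadj closed_dom_ball)
    show "0 \<in> {Y. selfadj Y} \<inter> dom_ball r" using r by (simp add: selfadj_def dom_ball_def)
    fix Y :: "'g operator" assume Y: "Y \<in> {Y. selfadj Y} \<inter> dom_ball r"
    then show "norm Y \<le> r" by (auto simp: dom_ball_iff intro: order_trans[OF norm_le_infsum_if_dominated_by])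
    show "(1/2) *\<^sub>R (X + (Y o\<^sub>L Y)) \<in> {Y. selfadj Y} \<inter> dom_ball r"
      using Y dom_ball_half_add_square[OF Xr, of Y] selfadj_half_add_square[OF X(1)] r by auto
  qed (use r in auto)
  have "selfadj (id_blinfun - Y)" using Y by (auto simp: selfadj_def op_adj_diff)
  moreover have "dominated (id_blinfun - Y)"
    using Y dominated_diff[OF dominated_id] by (auto simp: dom_ball_iff dominated_def)
  ultimately show ?thesis using that sq by blast
qed

section \<open>The twisted algebra of kernels\<close>

lemma group_diff_add_add: "(x + w) - (u + w) = x - (u :: 'g::group_add)"
proof -
  have "x + w - (u + w) = x + (w + (- w + - u))"
    by (simp only: diff_conv_add_uminus minus_add add.assoc)
  also have "\<dots> = x - u" by (simp only: add.assoc[symmetric] right_minus) simp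
  finally show ?thesis .
qed

locale twisted_kernels =
  fixes A :: "('g::group_add \<Rightarrow> complex) set" and \<omega> :: "'g \<Rightarrow> 'g \<Rightarrow> 'g \<Rightarrow> complex"
  assumes A: "unital_cstar_subalgebra_linf A"
    and A_translate: "translation_invariant A"
    and cocycle: "two_cocycle A \<omega>"
begin

abbreviation lam :: "'g \<Rightarrow> 'g \<Rightarrow> complex" where
  "lam \<equiv> cocycle_lambda \<omega>"

lemma A_add: "f \<in> A \<Longrightarrow> g \<in> A \<Longrightarrow> (\<lambda>x. f x + g x) \<in> A"
  and A_scale: "f \<in> A \<Longrightarrow> (\<lambda>x. c * f x) \<in> A"
  and A_mult: "f \<in> A \<Longrightarrow> g \<in> A \<Longrightarrow> (\<lambda>x. f x * g x) \<in> A"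
  and A_cnj: "f \<in> A \<Longrightarrow> (\<lambda>x. cnj (f x)) \<in> A"
  and A_limit: "(\<And>n. s n \<in> A) \<Longrightarrow> uniform_limit UNIV s f sequentially \<Longrightarrow> f \<in> A"
  using A unfolding unital_cstar_subalgebra_linf_def by blast+

lemma A_const: "(\<lambda>x. c) \<in> A"
  using A A_scale[of "\<lambda>_. 1" c] by (simp add: unital_cstar_subalgebra_linf_def)

lemma A_sum: "(\<And>i. i \<in> F \<Longrightarrow> f i \<in> A) \<Longrightarrow> (\<lambda>x. \<Sum>i\<in>F. f i x) \<in> A"
  by (induction F rule: infinite_finite_induct) (auto simp: A_const A_add)

lemma A_shift: "f \<in> A \<Longrightarrow> (\<lambda>w. f (x + w)) \<in> A"
  using A_translate unfolding translation_invariant_def translate_def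
  by (auto dest!: spec[of _ "- x"] simp: image_subset_iff)

text \<open>By the Weierstrass test finite partial sums converge uniformly, and \<open>A\<close> is closed.\<close>

lemma A_infsum:
  fixes f :: "'i \<Rightarrow> 'g \<Rightarrow> complex"
  assumes f: "\<And>i. f i \<in> A" and c: "c summable_on UNIV" and le: "\<And>i x. cmod (f i x) \<le> c i"
  shows "(\<lambda>x. \<Sum>\<^sub>\<infinity>i. f i x) \<in> A"
proof -
  have abs: "(\<lambda>i. norm (f i x)) summable_on UNIV" for x
    by (rule summable_on_comparison_test[OF c]) (use le in auto)
  note fs = abs_summable_summable[OF abs]
  have "\<exists>F. finite F \<and> (\<forall>x. dist (\<Sum>i\<in>F. f i x) (\<Sum>\<^sub>\<infinity>i. f i x) < e)" if "0 < e" for e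
  proof -
    obtain F where F: "finite F" "infsum c (- F) < e" using finite_sum_near_infsum[OF c \<open>0 < e\<close>] .
    have "dist (\<Sum>i\<in>F. f i x) (\<Sum>\<^sub>\<infinity>i. f i x) < e" for x
    proof -
      have "dist (\<Sum>i\<in>F. f i x) (\<Sum>\<^sub>\<infinity>i. f i x) = norm (\<Sum>\<^sub>\<infinity>i\<in>-F. f i x)"
        by (simp add: infsum_split_finite[OF fs F(1)] dist_norm)
      also have "\<dots> \<le> infsum c (- F)"
        by (rule norm_infsum_le[OF has_sum_infsum has_sum_infsum])
          (use le summable_on_subset_banach[OF fs] summable_on_subset_banach[OF c] in auto)
      finally show ?thesis using F(2) by simp
    qed
    then show ?thesis using F(1) by blast
  qed
  then have "\<exists>F. finite F \<and> (\<forall>x. dist (\<Sum>i\<in>F. f i x) (\<Sum>\<^sub>\<infinity>i. f i x) < inverse (real (Suc n)))" for n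
    by simp
  then obtain F where F: "\<And>n. finite (F n)"
    "\<And>n x. dist (\<Sum>i\<in>F n. f i x) (\<Sum>\<^sub>\<infinity>i. f i x) < inverse (real (Suc n))" by metis
  show ?thesis
  proof (rule A_limit)
    show "(\<lambda>x. \<Sum>i\<in>F n. f i x) \<in> A" for n using f by (intro A_sum)
    show "uniform_limit UNIV (\<lambda>n x. \<Sum>i\<in>F n. f i x) (\<lambda>x. \<Sum>\<^sub>\<infinity>i. f i x) sequentially"
    proof (rule uniform_limitI)
      fix e :: real assume "0 < e"
      then obtain N where "inverse (real (Suc N)) < e" using reals_Archimedean by blast
      then have "inverse (real (Suc n)) < e" if "n \<ge> N" for n
        using that by (smt (verit) le_imp_inverse_le of_nat_0_less_iff of_nat_mono Suc_le_mono zero_less_Suc)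
      then show "\<forall>\<^sub>F n in sequentially. \<forall>x\<in>UNIV. dist (\<Sum>i\<in>F n. f i x) (\<Sum>\<^sub>\<infinity>i. f i x) < e"
        using F(2) unfolding eventually_sequentially by (meson less_trans)
    qed
  qed
qed

lemma omega_in_A: "\<omega> x y \<in> A"
  and cmod_omega [simp]: "cmod (\<omega> x y q) = 1"
  and omega_cocycle: "\<omega> x y q * \<omega> (x + y) z q = \<omega> y z (- x + q) * \<omega> x (y + z) q"
  and omega_zero [simp]: "\<omega> x 0 q = 1" "\<omega> 0 x q = 1"
  using cocycle unfolding two_cocycle_def translate_def by blast+

lemma cmod_lam [simp]: "cmod (lam x y) = 1"
  by (simp add: cocycle_lambda_def)

lemma lam_nonzero [simp]: "lam x y \<noteq> 0"
  using cmod_lam[of x y] by force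

lemma lam_self [simp]: "lam x x = 1"
  by (simp add: cocycle_lambda_def)

text \<open>The cocycle identity at \<open>(x\<inverse>, x z\<inverse>, z y\<inverse>)\<close>, evaluated at the neutral element.\<close>

lemma lam_mult: "lam x z * lam z y = \<omega> (x - z) (z - y) x * lam x y"
proof -
  have e: "- x + (x - z) = - z" "(x - z) + (z - y) = x - y" "- (- x) + 0 = x"
    by (simp_all add: algebra_simps)
  show ?thesis
    using omega_cocycle[of "- x" "x - z" 0 "z - y"] unfolding e cocycle_lambda_def .
qed

text \<open>The kernel \<open>K\<close> with \<open>T = Int\<^sub>\<lambda>(K)\<close>, if there is one.\<close>

definition symbol :: "'g operator \<Rightarrow> 'g \<Rightarrow> 'g \<Rightarrow> complex" where
  "symbol T x y = entry T x y / lam x y"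

lemma entry_eq_symbol: "entry T x y = symbol T x y * lam x y"
  by (simp add: symbol_def)

lemma cmod_symbol [simp]: "cmod (symbol T x y) = cmod (entry T x y)"
  by (simp add: symbol_def norm_divide)

text \<open>The operators whose kernel has its diagonals in \<open>A\<close>. In contrast to domination this is
  preserved under limits in the operator norm.\<close>

definition diag_in_A :: "'g operator set" where
  "diag_in_A = {T \<in> ell2_ops. \<forall>x y. (\<lambda>w. symbol T (x + w) (y + w)) \<in> A}"

lemma diag_in_A_ops: "T \<in> diag_in_A \<Longrightarrow> T \<in> ell2_ops"
  by (simp add: diag_in_A_def)

lemma int_ops_iff: "T \<in> int_ops A lam \<longleftrightarrow> T \<in> diag_in_A \<and> dominated T"
proof
  assume "T \<in> int_ops A lam"
  then obtain K where K: "K \<in> kernels A" "T = int_op lam K" by (auto simp: int_ops_def)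
  have T: "T \<in> ell2_ops" unfolding K(2) by (rule int_op_in_ell2_ops[OF K(1)]) simp
  have entry: "entry T x y = K x y * lam x y" for x y
  proof -
    have "entry T x y = (\<Sum>\<^sub>\<infinity>z. K x z * lam x z * ell2_fun (ket y) z)"
      unfolding K(2) entry_def by (rule int_op_apply[OF K(1)]) simp
    then show ?thesis
      using has_sum_singleton[of y "\<lambda>z. K x z * lam x z * ell2_fun (ket y) z"] by (simp add: infsumI)
  qed
  obtain k where k: "(\<lambda>x. cmod (k x)) summable_on UNIV" "\<And>x y. cmod (K x y) \<le> cmod (k (x - y))"
    "\<And>x y. (\<lambda>z. K (x + z) (y + z)) \<in> A"
    using K(1) by (auto simp: kernels_def)
  have "dominated_by (\<lambda>x. cmod (k x)) T"
    using k T by (simp add: dominated_by_def entry norm_mult)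
  moreover have "T \<in> diag_in_A" using T k(3) by (simp add: diag_in_A_def symbol_def entry)
  ultimately show "T \<in> diag_in_A \<and> dominated T" by (auto simp: dominated_def)
next
  assume T: "T \<in> diag_in_A \<and> dominated T"
  then obtain k where k: "dominated_by k T" by (auto simp: dominated_def)
  note k0 = dominated_by_nonneg[OF k]
  have K: "symbol T \<in> kernels A"
    unfolding kernels_def using k k0 T
    by (auto simp: diag_in_A_def dominated_by_def intro!: exI[of _ "\<lambda>g. complex_of_real (k g)"])
  have "T = int_op lam (symbol T)"
  proof (rule ell2_op_eqI)
    show "T \<in> ell2_ops" using T by (simp add: diag_in_A_def)
    show "int_op lam (symbol T) \<in> ell2_ops" by (rule int_op_in_ell2_ops[OF K]) simp
    fix x y
    have "entry (int_op lam (symbol T)) x y = (\<Sum>\<^sub>\<infinity>z. symbol T x z * lam x z * ell2_fun (ket y) z)"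
      unfolding entry_def by (rule int_op_apply[OF K]) simp
    then show "entry T x y = entry (int_op lam (symbol T)) x y"
      using has_sum_singleton[of y "\<lambda>z. symbol T x z * lam x z * ell2_fun (ket y) z"]
      by (simp add: entry_eq_symbol infsumI)
  qed
  then show "T \<in> int_ops A lam" using K unfolding int_ops_def by blast
qed

lemma closed_diag_in_A: "closed diag_in_A"
  unfolding closed_sequential_limits
proof (intro allI impI, elim conjE)
  fix T :: "nat \<Rightarrow> 'g operator" and S
  assume T: "\<forall>n. T n \<in> diag_in_A" and lim: "T \<longlonglongrightarrow> S"
  have "S \<in> ell2_ops"
    using closed_ell2_ops T lim unfolding closed_sequential_limits by (meson diag_in_A_ops)
  moreover have "(\<lambda>w. symbol S (x + w) (y + w)) \<in> A" for x y
  proof (rule A_limit)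
    show "(\<lambda>w. symbol (T n) (x + w) (y + w)) \<in> A" for n using T by (simp add: diag_in_A_def)
    show "uniform_limit UNIV (\<lambda>n w. symbol (T n) (x + w) (y + w)) (\<lambda>w. symbol S (x + w) (y + w)) sequentially"
    proof (rule uniform_limitI)
      fix e :: real assume "0 < e"
      have "dist (symbol (T n) u v) (symbol S u v) \<le> dist (T n) S" for n u v
        using cmod_entry_le[of "T n - S" u v]
        by (simp add: dist_norm symbol_def norm_divide flip: diff_divide_distrib)
      then show "\<forall>\<^sub>F n in sequentially. \<forall>w\<in>UNIV. dist (symbol (T n) (x + w) (y + w)) (symbol S (x + w) (y + w)) < e"
        using tendstoD[OF lim \<open>0 < e\<close>] by (auto elim!: eventually_mono intro: le_less_trans)
    qed
  qed
  ultimately show "S \<in> diag_in_A" by (simp add: diag_in_A_def)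
qed

lemma diag_in_A_add: "S \<in> diag_in_A \<Longrightarrow> T \<in> diag_in_A \<Longrightarrow> S + T \<in> diag_in_A"
  by (auto simp: diag_in_A_def symbol_def add_divide_distrib intro: A_add)

lemma diag_in_A_op_scale: "T \<in> diag_in_A \<Longrightarrow> op_scale c T \<in> diag_in_A"
  using A_scale[of "\<lambda>w. symbol T (x + w) (y + w)" c for x y]
  by (auto simp: diag_in_A_def symbol_def)

lemma diag_in_A_scaleR: "T \<in> diag_in_A \<Longrightarrow> r *\<^sub>R T \<in> diag_in_A"
  by (simp add: scaleR_eq_op_scale diag_in_A_op_scale)

lemma diag_in_A_diff: "S \<in> diag_in_A \<Longrightarrow> T \<in> diag_in_A \<Longrightarrow> S - T \<in> diag_in_A"
  using diag_in_A_add[of S "(-1) *\<^sub>R T"] diag_in_A_scaleR[of T "-1"] by simp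

lemma diag_in_A_zero: "0 \<in> diag_in_A"
  by (simp add: diag_in_A_def symbol_def A_const)

lemma diag_in_A_id: "id_blinfun \<in> diag_in_A"
proof -
  have "symbol id_blinfun (x + w) (y + w) = (if x = y then 1 else 0)" for x y w
    by (simp add: symbol_def entry_id)
  then show ?thesis by (simp add: diag_in_A_def A_const)
qed

text \<open>The values \<open>\<lambda>(y, x)\<close> and \<open>\<lambda>(x, y)\<close> are inverse to each other up to a value of \<open>\<omega>\<close>, which along a
  diagonal is a translate of an element of \<open>A\<close>.\<close>

lemma diag_in_A_op_adj:
  assumes T: "T \<in> diag_in_A"
  shows "op_adj T \<in> diag_in_A"
proof -
  have T': "T \<in> ell2_ops" using T by (rule diag_in_A_ops)
  have "(\<lambda>w. symbol (op_adj T) (x + w) (y + w)) \<in> A" for x y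
  proof -
    have "symbol (op_adj T) (x + w) (y + w)
        = cnj (symbol T (y + w) (x + w)) * cnj (\<omega> (y - x) (x - y) (y + w))" for w
    proof -
      have "lam (y + w) (x + w) * lam (x + w) (y + w) = \<omega> (y - x) (x - y) (y + w)"
        using lam_mult[of "y + w" "x + w" "y + w"] by (simp add: group_diff_add_add)
      then have w: "cnj (lam (y + w) (x + w)) * cnj (lam (x + w) (y + w)) = cnj (\<omega> (y - x) (x - y) (y + w))"
        by (metis complex_cnj_mult)
      have inv: "1 / lam (x + w) (y + w) = cnj (lam (x + w) (y + w))"
        using mult_cnj_cmod(2)[of "lam (x + w) (y + w)"] by (simp add: field_simps)
      have "symbol (op_adj T) (x + w) (y + w) = cnj (entry T (y + w) (x + w)) * (1 / lam (x + w) (y + w))"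
        unfolding symbol_def entry_op_adj[OF T'] by simp
      also have "\<dots> = cnj (symbol T (y + w) (x + w)) * (cnj (lam (y + w) (x + w)) * cnj (lam (x + w) (y + w)))"
        unfolding inv entry_eq_symbol by simp
      finally show ?thesis unfolding w .
    qed
    moreover have "(\<lambda>w. cnj (symbol T (y + w) (x + w)) * cnj (\<omega> (y - x) (x - y) (y + w))) \<in> A"
      using T by (intro A_mult A_cnj A_shift omega_in_A) (simp add: diag_in_A_def)
    ultimately show ?thesis by simp
  qed
  then show ?thesis using op_adj_in_ell2_ops[OF T'] by (simp add: diag_in_A_def)
qed

lemma bij_add_right: "bij (\<lambda>u. u + w :: 'g)"
  by (rule bij_betw_byWitness[where f' = "\<lambda>u. u - w"]) auto

text \<open>Domination of the left factor makes the series for a product converge uniformly.\<close>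

lemma diag_in_A_comp:
  assumes S: "S \<in> diag_in_A" "dominated S" and T: "T \<in> diag_in_A"
  shows "S o\<^sub>L T \<in> diag_in_A"
proof -
  obtain k where k: "dominated_by k S" using S(2) by (auto simp: dominated_def)
  have ops: "S \<in> ell2_ops" "T \<in> ell2_ops" using S T diag_in_A_ops by auto
  have "(\<lambda>w. symbol (S o\<^sub>L T) (x + w) (y + w)) \<in> A" for x y
  proof -
    define f where "f u w = symbol S (x + w) (u + w) * symbol T (u + w) (y + w) * \<omega> (x - u) (u - y) (x + w)" for u w
    have "((\<lambda>u. f u w) has_sum symbol (S o\<^sub>L T) (x + w) (y + w)) UNIV" for w
    proof -
      have "((\<lambda>z. entry S (x + w) z * entry T z (y + w) / lam (x + w) (y + w)) has_sum symbol (S o\<^sub>L T) (x + w) (y + w)) UNIV"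
        using has_sum_cmult_left[OF entry_comp_has_sum[OF ops(1), of "x + w" T "y + w"], of "inverse (lam (x + w) (y + w))"]
        by (simp add: symbol_def divide_inverse)
      then have "((\<lambda>u. entry S (x + w) (u + w) * entry T (u + w) (y + w) / lam (x + w) (y + w)) has_sum symbol (S o\<^sub>L T) (x + w) (y + w)) UNIV"
        using has_sum_reindex_bij_betw[OF bij_add_right[of w], of "\<lambda>z. entry S (x + w) z * entry T z (y + w) / lam (x + w) (y + w)"]
        by simp
      moreover have "entry S (x + w) (u + w) * entry T (u + w) (y + w) / lam (x + w) (y + w) = f u w" for u
      proof -
        have "lam (x + w) (u + w) * lam (u + w) (y + w) = \<omega> (x - u) (u - y) (x + w) * lam (x + w) (y + w)"
          using lam_mult[of "x + w" "u + w" "y + w"] by (simp only: group_diff_add_add)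
        then show ?thesis
          by (simp add: entry_eq_symbol f_def field_simps)
      qed
      ultimately show ?thesis by simp
    qed
    then have "(\<lambda>w. symbol (S o\<^sub>L T) (x + w) (y + w)) = (\<lambda>w. \<Sum>\<^sub>\<infinity>u. f u w)"
      by (intro ext) (metis infsumI)
    also have "\<dots> \<in> A"
    proof (rule A_infsum)
      show "f u \<in> A" for u
        using S T unfolding f_def by (intro A_mult A_shift omega_in_A) (auto simp: diag_in_A_def)
      have ks: "k summable_on UNIV" using k by (simp add: dominated_by_def)
      then have "(\<lambda>u. k (x - u)) summable_on UNIV"
        using summable_on_reindex_bij_betw[OF bij_diff_left[of x], of k] by simp
      then show "(\<lambda>u. k (x - u) * norm T) summable_on UNIV" by (rule summable_on_cmult_left)
      show "cmod (f u w) \<le> k (x - u) * norm T" for u w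
      proof -
        have "cmod (entry S (x + w) (u + w)) \<le> k ((x + w) - (u + w))"
          using k unfolding dominated_by_def by blast
        also have "(x + w) - (u + w) = x - u" by (rule group_diff_add_add)
        finally have "cmod (entry S (x + w) (u + w)) \<le> k (x - u)" .
        then show ?thesis
          by (simp add: f_def norm_mult mult_mono cmod_entry_le dominated_by_nonneg[OF k])
      qed
    qed
    finally show ?thesis .
  qed
  then show ?thesis using ops by (auto simp: diag_in_A_def)
qed

theorem star_subalgebra_int_ops: "star_subalgebra (int_ops A lam)"
  unfolding star_subalgebra_def
proof (intro conjI ballI allI)
  show "int_ops A lam \<subseteq> ell2_ops" by (auto simp: int_ops_iff diag_in_A_def)
  have "dominated (0 :: 'g operator)" using dominated_scaleR[OF dominated_id, of 0] by simp
  then show "0 \<in> int_ops A lam" by (simp add: int_ops_iff diag_in_A_zero)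
qed (auto simp: int_ops_iff diag_in_A_add diag_in_A_op_scale diag_in_A_comp diag_in_A_op_adj
    dominated_add dominated_op_scale dominated_comp dominated_op_adj)

end

section \<open>The Hahn--Banach theorem\<close>

definition sublinear :: "('v::real_vector \<Rightarrow> real) \<Rightarrow> bool" where
  "sublinear p \<longleftrightarrow> (\<forall>x y. p (x + y) \<le> p x + p y) \<and> (\<forall>r>0. \<forall>x. p (r *\<^sub>R x) \<le> r * p x)"

lemma sublinear_zero:
  assumes "sublinear p"
  shows "p 0 = 0"
proof -
  have "p (2 *\<^sub>R 0) \<le> 2 * p 0" "p ((1/2) *\<^sub>R 0) \<le> (1/2) * p 0"
    using assms unfolding sublinear_def by (meson zero_less_numeral zero_less_divide_1_iff)+
  then show ?thesis by simp
qed

lemma sublinear_scale: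
  assumes p: "sublinear p" and r: "0 \<le> r"
  shows "p (r *\<^sub>R x) = r * p x"
proof (cases "r = 0")
  case False
  then have r: "r > 0" using r by simp
  have "p (inverse r *\<^sub>R (r *\<^sub>R x)) \<le> inverse r * p (r *\<^sub>R x)"
    using p r unfolding sublinear_def by (meson positive_imp_inverse_positive)
  then have "r * p x \<le> p (r *\<^sub>R x)" using r by (simp add: field_simps)
  moreover have "p (r *\<^sub>R x) \<le> r * p x" using p r unfolding sublinear_def by blast
  ultimately show ?thesis by simp
qed (simp add: sublinear_zero[OF p])

lemma sublinear_lower:
  assumes "sublinear p"
  shows "- p (- x) \<le> p x"
proof -
  have "p (x + (- x)) \<le> p x + p (- x)" using assms unfolding sublinear_def by blast
  then show ?thesis by (simp add: sublinear_zero[OF assms])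
qed

text \<open>The last two hypotheses hold for chains as well as for families indexed by a convex cone.\<close>

lemma sublinear_INF:
  fixes q :: "'i \<Rightarrow> 'v::real_vector \<Rightarrow> real"
  assumes I: "I \<noteq> {}" and bdd: "\<And>x. bdd_below ((\<lambda>i. q i x) ` I)"
    and add: "\<And>i j x y. i \<in> I \<Longrightarrow> j \<in> I \<Longrightarrow> \<exists>k\<in>I. q k (x + y) \<le> q i x + q j y"
    and scale: "\<And>i r x. i \<in> I \<Longrightarrow> 0 < r \<Longrightarrow> \<exists>k\<in>I. q k (r *\<^sub>R x) \<le> r * q i x"
  shows "sublinear (\<lambda>x. INF i\<in>I. q i x)"
  unfolding sublinear_def
proof (intro conjI allI impI)
  let ?p = "\<lambda>x. INF i\<in>I. q i x"
  have lower: "?p x \<le> q i x" if "i \<in> I" for i x by (rule cINF_lower[OF bdd that])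
  fix x y
  have "?p (x + y) - q j y \<le> q i x" if "i \<in> I" "j \<in> I" for i j
  proof -
    obtain k where "k \<in> I" "q k (x + y) \<le> q i x + q j y"
      using add[OF \<open>i \<in> I\<close> \<open>j \<in> I\<close>] by blast
    then show ?thesis using lower[of k "x + y"] by linarith
  qed
  then have "?p (x + y) - q j y \<le> ?p x" if "j \<in> I" for j using that by (intro cINF_greatest[OF I])
  then have "?p (x + y) - ?p x \<le> q j y" if "j \<in> I" for j using that by (simp add: algebra_simps)
  then have "?p (x + y) - ?p x \<le> ?p y" by (rule cINF_greatest[OF I])
  then show "?p (x + y) \<le> ?p x + ?p y" by simp
next
  let ?p = "\<lambda>x. INF i\<in>I. q i x"
  fix r :: real and x assume r: "0 < r"
  have "?p (r *\<^sub>R x) / r \<le> q i x" if "i \<in> I" for i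
  proof -
    obtain k where "k \<in> I" "q k (r *\<^sub>R x) \<le> r * q i x" using scale[OF \<open>i \<in> I\<close> r] by blast
    then have "?p (r *\<^sub>R x) \<le> r * q i x" using cINF_lower[OF bdd, of k "r *\<^sub>R x"] by linarith
    then show ?thesis using r by (simp add: field_simps)
  qed
  then have "?p (r *\<^sub>R x) / r \<le> ?p x" by (rule cINF_greatest[OF I])
  then show "?p (r *\<^sub>R x) \<le> r * ?p x" using r by (simp add: field_simps)
qed

text \<open>For fixed \<open>a\<close> the functional \<open>x \<mapsto> inf\<^bsub>t \<ge> 0\<^esub> (q (x + t a) - t q a)\<close> is sublinear and below \<open>q\<close>, so
  minimality of \<open>q\<close> gives \<open>q x + q a \<le> q (x + a)\<close>.\<close>

lemma minimal_sublinear_linear: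
  fixes q :: "'v::real_vector \<Rightarrow> real"
  assumes q: "sublinear q" and min: "\<And>q'. sublinear q' \<Longrightarrow> (\<And>x. q' x \<le> q x) \<Longrightarrow> q' = q"
  shows "linear q"
proof -
  have sub: "q (x + y) \<le> q x + q y" for x y using q by (simp add: sublinear_def)
  have add: "q (x + a) = q x + q a" for x a
  proof -
    define q' where "q' x = (INF t\<in>{0..}. q (x + t *\<^sub>R a) - t * q a)" for x
    have bd: "- q (- x) \<le> q (x + t *\<^sub>R a) - t * q a" if "t \<in> {0..}" for x t
    proof -
      have "t * q a = q ((x + t *\<^sub>R a) + - x)" using that by (simp add: sublinear_scale[OF q])
      also have "\<dots> \<le> q (x + t *\<^sub>R a) + q (- x)" by (rule sub)
      finally show ?thesis by simp
    qed
    have bdd: "bdd_below ((\<lambda>t. q (x + t *\<^sub>R a) - t * q a) ` {0..})" for x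
      using bd by (auto intro!: bdd_belowI2)
    have upper: "q' x \<le> q (x + t *\<^sub>R a) - t * q a" if "0 \<le> t" for x t
      unfolding q'_def by (rule cINF_lower[OF bdd]) (use that in simp)
    have "sublinear (\<lambda>x. INF t\<in>{0..}. q (x + t *\<^sub>R a) - t * q a)"
    proof (rule sublinear_INF[OF _ bdd])
      fix s t :: real and x y assume st: "s \<in> {0..}" "t \<in> {0..}"
      have "q ((x + s *\<^sub>R a) + (y + t *\<^sub>R a)) \<le> q (x + s *\<^sub>R a) + q (y + t *\<^sub>R a)" by (rule sub)
      moreover have "(x + y) + (s + t) *\<^sub>R a = (x + s *\<^sub>R a) + (y + t *\<^sub>R a)" by (simp add: algebra_simps)
      ultimately have "q (x + y + (s + t) *\<^sub>R a) - (s + t) * q a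
          \<le> q (x + s *\<^sub>R a) - s * q a + (q (y + t *\<^sub>R a) - t * q a)"
        by (simp only: distrib_right)
      then show "\<exists>k\<in>{0..}. q (x + y + k *\<^sub>R a) - k * q a
          \<le> q (x + s *\<^sub>R a) - s * q a + (q (y + t *\<^sub>R a) - t * q a)"
        using st by (intro bexI[of _ "s + t"]) auto
    next
      fix t r :: real and x assume t: "t \<in> {0..}" "0 < r"
      have "q (r *\<^sub>R (x + t *\<^sub>R a)) = r * q (x + t *\<^sub>R a)" using t by (intro sublinear_scale[OF q]) simp
      moreover have "r *\<^sub>R x + (r * t) *\<^sub>R a = r *\<^sub>R (x + t *\<^sub>R a)" by (simp add: scaleR_add_right)
      ultimately show "\<exists>k\<in>{0..}. q (r *\<^sub>R x + k *\<^sub>R a) - k * q a \<le> r * (q (x + t *\<^sub>R a) - t * q a)"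
        using t by (intro bexI[of _ "r * t"]) (auto simp: right_diff_distrib)
    qed simp
    then have "sublinear q'" unfolding q'_def[abs_def] .
    moreover have "q' x \<le> q x" for x using upper[of 0 x] by simp
    ultimately have "q' = q" by (rule min)
    then have "q x \<le> q (x + a) - q a" using upper[of 1 x] by simp
    then show ?thesis using sub[of x a] by simp
  qed
  have neg: "q (- x) = - q x" for x using add[of x "- x"] by (simp add: sublinear_zero[OF q])
  show ?thesis
  proof (rule linearI[OF add])
    fix r x
    show "q (r *\<^sub>R x) = r *\<^sub>R q x"
    proof (cases "0 \<le> r")
      case False
      then have "q ((- r) *\<^sub>R x) = (- r) * q x" by (intro sublinear_scale[OF q]) simp
      then show ?thesis using neg[of "r *\<^sub>R x"] by simp
    qed (simp add: sublinear_scale[OF q])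
  qed
qed

text \<open>Zorn's lemma applies to the sublinear functionals below \<open>p\<close>, since the infimum of a chain of them is
  again sublinear.\<close>

lemma hahn_banach:
  fixes p :: "'v::real_vector \<Rightarrow> real"
  assumes p: "sublinear p"
  obtains f where "linear f" "\<And>x. f x \<le> p x"
proof -
  define S where "S = {q. sublinear q \<and> (\<forall>x. q x \<le> p x)}"
  define R where "R = (\<lambda>q q' :: 'v \<Rightarrow> real. \<forall>x. q' x \<le> q x)"
  have "\<exists>m\<in>S. \<forall>q\<in>S. R m q \<longrightarrow> q = m"
  proof (rule predicate_Zorn)
    show "partial_order_on S (relation_of R S)"
      by (rule partial_order_on_relation_ofI) (auto simp: R_def intro!: ext intro: order_trans antisym)
    fix C assume C: "C \<in> Chains (relation_of R S)"
    then have CS: "C \<subseteq> S" by (rule Chains_relation_of)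
    have tot: "R q q' \<or> R q' q" if "q \<in> C" "q' \<in> C" for q q'
      using C that by (auto simp: Chains_def relation_of_def)
    show "\<exists>u\<in>S. \<forall>a\<in>C. R a u"
    proof (cases "C = {}")
      case True then show ?thesis using p by (auto simp: S_def)
    next
      case False
      define u where "u x = (INF q\<in>C. q x)" for x
      have lb: "- p (- x) \<le> q x" if "q \<in> C" for q x
        using that CS sublinear_lower[of q x] by (auto simp: S_def subset_iff) (smt (verit))
      have bdd: "bdd_below ((\<lambda>q. q x) ` C)" for x using lb by (auto intro!: bdd_belowI2)
      have upper: "u x \<le> q x" if "q \<in> C" for q x unfolding u_def by (rule cINF_lower[OF bdd that])
      have sl: "sublinear q" if "q \<in> C" for q using that CS by (auto simp: S_def)
      have "sublinear (\<lambda>x. INF q\<in>C. q x)"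
      proof (rule sublinear_INF[OF False bdd])
        fix q q' x y assume q: "q \<in> C" "q' \<in> C"
        obtain r where r: "r \<in> C" "r x \<le> q x" "r y \<le> q' y"
          using tot[OF q] q by (auto simp: R_def)
        have "r (x + y) \<le> r x + r y" using sl[OF r(1)] by (simp add: sublinear_def)
        then have "r (x + y) \<le> q x + q' y" using r by linarith
        then show "\<exists>k\<in>C. k (x + y) \<le> q x + q' y" using r(1) by blast
      next
        fix q and r :: real and x assume "q \<in> C" "0 < r"
        then have "q (r *\<^sub>R x) \<le> r * q x" using sl[of q] by (simp add: sublinear_def)
        then show "\<exists>k\<in>C. k (r *\<^sub>R x) \<le> r * q x" using \<open>q \<in> C\<close> by blast
      qed
      then have "sublinear u" unfolding u_def[abs_def] .
      moreover obtain q where "q \<in> C" using False by blast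
      ultimately have "u \<in> S" using upper[OF \<open>q \<in> C\<close>] CS by (auto simp: S_def subset_iff) (meson order_trans)
      then show ?thesis using upper by (auto simp: R_def)
    qed
  qed
  then obtain m where m: "m \<in> S" "\<And>q. q \<in> S \<Longrightarrow> R m q \<Longrightarrow> q = m" by blast
  have "linear m"
  proof (rule minimal_sublinear_linear)
    show "sublinear m" using m(1) by (simp add: S_def)
    fix q' assume "sublinear q'" "\<And>x. q' x \<le> m x"
    moreover from this have "q' \<in> S" using m(1) by (auto simp: S_def) (meson order_trans)
    ultimately show "q' = m" using m(2) by (simp add: R_def)
  qed
  then show ?thesis using that m(1) by (auto simp: S_def)
qed

text \<open>The Hahn--Banach theorem is applied to \<open>p w = inf\<^bsub>t \<ge> 0, c \<in> C\<^esub> (|w + t c| - t \<eta>)\<close>, which is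
  sublinear since \<open>C\<close> is convex, finite since \<open>C\<close> avoids the open ball of radius \<open>\<eta>\<close>, at most \<open>|w|\<close>, and at
  most \<open>- \<eta>\<close> on \<open>- C\<close>.\<close>

lemma separating_functional:
  fixes C :: "'v::real_normed_vector set"
  assumes C: "convex C" "C \<noteq> {}" and far: "\<And>c. c \<in> C \<Longrightarrow> \<eta> \<le> norm c"
  obtains f where "linear f" "\<And>w. f w \<le> norm w" "\<And>c. c \<in> C \<Longrightarrow> \<eta> \<le> f c"
proof -
  define I where "I = {0::real..} \<times> C"
  define p where "p w = (INF (t, c)\<in>I. norm (w + t *\<^sub>R c) - t * \<eta>)" for w
  have I0: "I \<noteq> {}" using C by (auto simp: I_def)
  have bd: "- norm w \<le> norm (w + t *\<^sub>R c) - t * \<eta>" if "(t, c) \<in> I" for w t c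
  proof -
    have "t * \<eta> \<le> t * norm c" using that far by (intro mult_left_mono) (auto simp: I_def)
    also have "\<dots> = norm (t *\<^sub>R c)" using that by (simp add: I_def)
    also have "\<dots> \<le> norm (w + t *\<^sub>R c) + norm w" using norm_triangle_ineq4[of "w + t *\<^sub>R c" w] by simp
    finally show ?thesis by simp
  qed
  have bdd: "bdd_below ((\<lambda>(t, c). norm (w + t *\<^sub>R c) - t * \<eta>) ` I)" for w
    using bd by (auto intro!: bdd_belowI2[where m = "- norm w"])
  have upper: "p w \<le> norm (w + t *\<^sub>R c) - t * \<eta>" if "0 \<le> t" "c \<in> C" for w t c
    unfolding p_def using cINF_lower[OF bdd, of "(t, c)"] that by (auto simp: I_def)
  have "sublinear (\<lambda>w. INF i\<in>I. (\<lambda>(t, c). norm (w + t *\<^sub>R c) - t * \<eta>) i)"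
  proof (rule sublinear_INF[OF I0 bdd])
    fix i j x y assume "i \<in> I" "j \<in> I"
    then obtain s c t d where st: "i = (s, c)" "j = (t, d)" "0 \<le> s" "c \<in> C" "0 \<le> t" "d \<in> C"
      by (auto simp: I_def)
    obtain e where e: "e \<in> C" "(s + t) *\<^sub>R e = s *\<^sub>R c + t *\<^sub>R d"
    proof (cases "s + t = 0")
      case True
      then show ?thesis using that[of c] st by (simp add: add_nonneg_eq_0_iff)
    next
      case False
      have "(s / (s + t)) *\<^sub>R c + (t / (s + t)) *\<^sub>R d \<in> C"
        using C(1) st False by (intro convexD) (auto simp: add_divide_distrib[symmetric])
      then show ?thesis using that[of "(s / (s + t)) *\<^sub>R c + (t / (s + t)) *\<^sub>R d"] False
        by (simp add: scaleR_add_right)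
    qed
    have "(x + y) + (s + t) *\<^sub>R e = (x + s *\<^sub>R c) + (y + t *\<^sub>R d)" by (simp add: e(2))
    then have "norm ((x + y) + (s + t) *\<^sub>R e) \<le> norm (x + s *\<^sub>R c) + norm (y + t *\<^sub>R d)"
      by (metis norm_triangle_ineq)
    then show "\<exists>k\<in>I. (case k of (t, c) \<Rightarrow> norm (x + y + t *\<^sub>R c) - t * \<eta>)
        \<le> (case i of (t, c) \<Rightarrow> norm (x + t *\<^sub>R c) - t * \<eta>) + (case j of (t, c) \<Rightarrow> norm (y + t *\<^sub>R c) - t * \<eta>)"
      using st e(1) by (intro bexI[of _ "(s + t, e)"]) (auto simp: I_def distrib_right)
  next
    fix i and r :: real and x assume "i \<in> I" and r: "0 < r"
    then obtain t c where tc: "i = (t, c)" "0 \<le> t" "c \<in> C" by (auto simp: I_def)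
    have "r *\<^sub>R x + (r * t) *\<^sub>R c = r *\<^sub>R (x + t *\<^sub>R c)" by (simp add: scaleR_add_right)
    then have "norm (r *\<^sub>R x + (r * t) *\<^sub>R c) = r * norm (x + t *\<^sub>R c)" using r by simp
    then show "\<exists>k\<in>I. (case k of (t, c) \<Rightarrow> norm (r *\<^sub>R x + t *\<^sub>R c) - t * \<eta>)
        \<le> r * (case i of (t, c) \<Rightarrow> norm (x + t *\<^sub>R c) - t * \<eta>)"
      using tc r by (intro bexI[of _ "(r * t, c)"]) (auto simp: I_def right_diff_distrib)
  qed
  then have "sublinear p" unfolding p_def[abs_def] .
  then obtain f where f: "linear f" "\<And>x. f x \<le> p x" using hahn_banach by blast
  obtain c0 where c0: "c0 \<in> C" using C by blast
  have "f w \<le> norm w" for w using f(2)[of w] upper[of 0 c0 w] c0 by simp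
  moreover have "\<eta> \<le> f c" if "c \<in> C" for c
    using f(2)[of "- c"] upper[of 1 c "- c"] that by (simp add: linear_neg[OF f(1)])
  ultimately show ?thesis using that f(1) by blast
qed

section \<open>Reiter's condition for amenable groups\<close>

lemma lookup_scaleR: "Poly_Mapping.lookup (r *\<^sub>R x) i = r *\<^sub>R Poly_Mapping.lookup x i"
proof -
  have "finite {i. r *\<^sub>R Poly_Mapping.lookup x i \<noteq> 0}"
    by (rule finite_subset[OF _ finite_lookup[of x]]) auto
  then show ?thesis unfolding scaleR_poly_mapping_def by (simp add: Abs_poly_mapping_inverse)
qed

lemma norm_poly_mapping_eq_sum:
  "norm x = (\<Sum>i\<in>Poly_Mapping.keys x. norm (Poly_Mapping.lookup x i))"
  using dist_norm[of x 0] unfolding dist_poly_mapping_def by simp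

lemma sum_lookup_le_norm:
  assumes "finite F"
  shows "(\<Sum>i\<in>F. norm (Poly_Mapping.lookup x i)) \<le> norm x"
proof -
  have "(\<Sum>i\<in>F. norm (Poly_Mapping.lookup x i)) = (\<Sum>i\<in>F \<inter> Poly_Mapping.keys x. norm (Poly_Mapping.lookup x i))"
    by (rule sum.mono_neutral_right) (use assms in \<open>auto simp: in_keys_iff\<close>)
  also have "\<dots> \<le> norm x"
    unfolding norm_poly_mapping_eq_sum by (intro sum_mono2) auto
  finally show ?thesis .
qed

lemma norm_poly_mapping_single: "norm (Poly_Mapping.single i (r::real)) = \<bar>r\<bar>"
  by (simp add: norm_poly_mapping_eq_sum)

text \<open>If no finitely supported probability density were almost invariant, the convex set of all families
  \<open>(\<lambda>\<^sub>g f - f)\<^sub>g\<close> in \<open>\<ell>\<^sup>1\<close> would be at positive distance from zero. A separating functional would yield bounded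
  functions \<open>u\<^sub>g\<close> for which \<open>\<Sum>\<^sub>g (u\<^sub>g (g x) - u\<^sub>g x)\<close> is bounded below by a positive constant, although
  the invariant mean of this function vanishes.\<close>

lemma reiter_condition:
  fixes G :: "'g::group_add set"
  assumes am: "amenable TYPE('g)" and G: "finite G" and \<eta>: "0 < \<eta>"
  obtains F and f :: "'g \<Rightarrow> real" where "finite F" "\<And>x. 0 \<le> f x" "\<And>x. x \<notin> F \<Longrightarrow> f x = 0"
    "sum f F = 1" "\<And>g E. g \<in> G \<Longrightarrow> finite E \<Longrightarrow> (\<Sum>y\<in>E. \<bar>f (- g + y) - f y\<bar>) < \<eta>"
proof -
  define d :: "'g \<Rightarrow> 'g \<times> 'g \<Rightarrow>\<^sub>0 real" where
    "d x = (\<Sum>g\<in>G. Poly_Mapping.single (g, g + x) 1 - Poly_Mapping.single (g, x) 1)" for x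
  define P where "P F f \<longleftrightarrow> finite F \<and> (\<forall>x. 0 \<le> f x) \<and> (\<forall>x. x \<notin> F \<longrightarrow> f x = 0) \<and> sum f F = 1"
    for F :: "'g set" and f :: "'g \<Rightarrow> real"
  define C where "C = {(\<Sum>x\<in>F. f x *\<^sub>R d x) |F f. P F f}"
  have dC: "d x \<in> C" for x
  proof -
    have "P {x} (\<lambda>y. if y = x then 1 else 0)" by (simp add: P_def)
    moreover have "d x = (\<Sum>y\<in>{x}. (if y = x then 1 else 0) *\<^sub>R d y)" by simp
    ultimately show ?thesis
      unfolding C_def by (intro CollectI exI[of _ "{x}"] exI[of _ "\<lambda>y. if y = x then 1 else 0"] conjI)
  qed
  have "convex C"
  proof (rule convexI)
    fix c c' and u v :: real
    assume cc: "c \<in> C" "c' \<in> C" and uv: "0 \<le> u" "0 \<le> v" "u + v = 1"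
    obtain F f where F: "P F f" "c = (\<Sum>x\<in>F. f x *\<^sub>R d x)" using cc(1) by (auto simp: C_def)
    obtain F' f' where F': "P F' f'" "c' = (\<Sum>x\<in>F'. f' x *\<^sub>R d x)" using cc(2) by (auto simp: C_def)
    have fin: "finite F" "finite F'" using F F' by (auto simp: P_def)
    have c: "c = (\<Sum>x\<in>F \<union> F'. f x *\<^sub>R d x)" "c' = (\<Sum>x\<in>F \<union> F'. f' x *\<^sub>R d x)"
      unfolding F F' by (rule sum.mono_neutral_left; use F F' in \<open>auto simp: P_def\<close>)+
    have s: "sum f (F \<union> F') = 1" "sum f' (F \<union> F') = 1"
      using sum.mono_neutral_left[of "F \<union> F'" F f] sum.mono_neutral_left[of "F \<union> F'" F' f'] F F'
      by (auto simp: P_def)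
    have "P (F \<union> F') (\<lambda>x. u * f x + v * f' x)"
      using F(1) F'(1) s uv by (auto simp: P_def sum.distrib simp flip: sum_distrib_left)
    moreover have "u *\<^sub>R c + v *\<^sub>R c' = (\<Sum>x\<in>F \<union> F'. (u * f x + v * f' x) *\<^sub>R d x)"
      unfolding c by (simp add: scaleR_sum_right sum.distrib scaleR_add_left)
    ultimately show "u *\<^sub>R c + v *\<^sub>R c' \<in> C"
      unfolding C_def by (intro CollectI exI[of _ "F \<union> F'"] exI[of _ "\<lambda>x. u * f x + v * f' x"] conjI)
  qed
  have "\<exists>c\<in>C. norm c < \<eta>"
  proof (rule ccontr)
    assume "\<not> ?thesis"
    then have far: "\<eta> \<le> norm c" if "c \<in> C" for c using that by force
    obtain \<phi> where \<phi>: "linear \<phi>" "\<And>w. \<phi> w \<le> norm w" "\<And>c. c \<in> C \<Longrightarrow> \<eta> \<le> \<phi> c"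
      using separating_functional[OF \<open>convex C\<close> _ far] dC by blast
    define u where "u g x = \<phi> (Poly_Mapping.single (g, x) 1)" for g x
    have u: "\<bar>u g x\<bar> \<le> 1" for g x
    proof -
      have "\<phi> (- Poly_Mapping.single (g, x) 1) \<le> norm (- Poly_Mapping.single (g, x) (1::real))" by (rule \<phi>(2))
      then show ?thesis
        using \<phi>(2)[of "Poly_Mapping.single (g, x) 1"]
        by (simp add: u_def linear_neg[OF \<phi>(1)] norm_poly_mapping_single)
    qed
    have ge: "\<eta> \<le> (\<Sum>g\<in>G. u g (g + x) - u g x)" for x
      using \<phi>(3)[OF dC[of x]] by (simp add: d_def u_def linear_sum[OF \<phi>(1)] linear_diff[OF \<phi>(1)])
    obtain m :: "('g \<Rightarrow> real) \<Rightarrow> real" where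
      m: "\<forall>f g. bounded (range f) \<and> bounded (range g) \<longrightarrow> m (\<lambda>x. f x + g x) = m f + m g"
        "\<forall>c f. bounded (range f) \<longrightarrow> m (\<lambda>x. c * f x) = c * m f"
        "\<forall>f. bounded (range f) \<and> (\<forall>x. 0 \<le> f x) \<longrightarrow> 0 \<le> m f"
        "m (\<lambda>x. 1) = 1" "\<forall>x f. bounded (range f) \<longrightarrow> m (translate x f) = m f"
      using am unfolding amenable_def by (elim exE conjE) (rule that; assumption)
    note madd = m(1)[rule_format, OF conjI] and mscale = m(2)[rule_format]
      and mpos = m(3)[rule_format, OF conjI] and mone = m(4) and minv = m(5)[rule_format]
    have bI: "bounded (range h)" if "\<And>x. \<bar>h x\<bar> \<le> B" for h :: "'g \<Rightarrow> real" and B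
      using that by (auto simp: bounded_iff)
    have bu: "bounded (range (u g))" "bounded (range (\<lambda>x. u g (g + x)))" for g
      by (rule bI[where B = 1], rule u)+
    have le2: "\<bar>u g (g + x) - u g x\<bar> \<le> 2" for g x using u[of g "g + x"] u[of g x] by linarith
    then have bd: "bounded (range (\<lambda>x. u g (g + x) - u g x))" for g by (rule bI)
    have m0: "m (\<lambda>x. u g (g + x) - u g x) = 0" for g
    proof -
      have "m (\<lambda>x. u g (g + x)) = m (u g)"
        using minv[OF bu(1), of "- g" g] by (simp add: translate_def)
      moreover have "m (\<lambda>x. - 1 * u g x) = - 1 * m (u g)" by (rule mscale[OF bu(1)])
      moreover have "m (\<lambda>x. u g (g + x) + (- 1 * u g x)) = m (\<lambda>x. u g (g + x)) + m (\<lambda>x. - 1 * u g x)"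
        by (rule madd[OF bu(2)]) (rule bI[where B = 1], use u in simp)
      ultimately show ?thesis by simp
    qed
    have bsum: "bounded (range (\<lambda>x. \<Sum>g\<in>E. u g (g + x) - u g x))" for E
    proof (rule bI)
      fix x
      show "\<bar>\<Sum>g\<in>E. u g (g + x) - u g x\<bar> \<le> (\<Sum>g\<in>E. 2)"
        by (rule order_trans[OF sum_abs]) (rule sum_mono, rule le2)
    qed
    have msum: "m (\<lambda>x. \<Sum>g\<in>E. u g (g + x) - u g x) = 0" if "finite E" for E
      using that
    proof (induction E rule: finite_induct)
      case empty
      show ?case using mscale[of "\<lambda>_. 1" 0] bI[of "\<lambda>_. 1" 1] by simp
    next
      case (insert g E)
      then show ?case using madd[OF bd[of g] bsum[of E]] m0[of g] by simp
    qed
    have "0 \<le> m (\<lambda>x. (\<Sum>g\<in>G. u g (g + x) - u g x) + (- \<eta>) * 1)"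
    proof (rule mpos)
      obtain B where B: "\<And>x. \<bar>\<Sum>g\<in>G. u g (g + x) - u g x\<bar> \<le> B"
        using bsum[of G] by (auto simp: bounded_iff)
      have "\<bar>(\<Sum>g\<in>G. u g (g + x) - u g x) + (- \<eta>) * 1\<bar> \<le> B + \<eta>" for x
        using B[of x] \<eta> by linarith
      then show "bounded (range (\<lambda>x. (\<Sum>g\<in>G. u g (g + x) - u g x) + (- \<eta>) * 1))" by (rule bI)
    qed (use ge in auto)
    also have "\<dots> = m (\<lambda>x. \<Sum>g\<in>G. u g (g + x) - u g x) + m (\<lambda>x. (- \<eta>) * 1)"
      by (rule madd[OF bsum]) (rule bI[where B = \<eta>], use \<eta> in simp)
    also have "\<dots> = - \<eta>"
      using msum[OF G] mscale[OF bI[of "\<lambda>_. 1" 1], of "- \<eta>"] by (simp add: mone)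
    finally show False using \<eta> by simp
  qed
  then obtain F f where F: "P F f" "norm (\<Sum>x\<in>F. f x *\<^sub>R d x) < \<eta>" by (auto simp: C_def)
  have "(\<Sum>y\<in>E. \<bar>f (- g + y) - f y\<bar>) < \<eta>" if g: "g \<in> G" and E: "finite E" for g E
  proof -
    have lk: "Poly_Mapping.lookup (\<Sum>x\<in>F. f x *\<^sub>R d x) (g, y) = f (- g + y) - f y" for y
    proof -
      have "Poly_Mapping.lookup (d x) (g, y) = (if x = - g + y then 1 else 0) - (if x = y then 1 else 0)" for x
      proof -
        have "Poly_Mapping.lookup (d x) (g, y)
            = (\<Sum>h\<in>G. if h = g then (if x = - g + y then 1 else 0) - (if x = y then 1 else 0) else 0)"
          unfolding d_def lookup_sum lookup_minus lookup_single
          by (rule sum.cong) (auto simp: when_def add.assoc[symmetric])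
        then show ?thesis using g G by simp
      qed
      then have "Poly_Mapping.lookup (\<Sum>x\<in>F. f x *\<^sub>R d x) (g, y)
          = (\<Sum>x\<in>F. (if x = - g + y then f x else 0) - (if x = y then f x else 0))"
        unfolding lookup_sum lookup_scaleR by (intro sum.cong) auto
      also have "\<dots> = f (- g + y) - f y"
        using F(1) by (simp add: sum_subtractf P_def)
      finally show ?thesis .
    qed
    have "(\<Sum>y\<in>E. \<bar>f (- g + y) - f y\<bar>) = (\<Sum>i\<in>Pair g ` E. norm (Poly_Mapping.lookup (\<Sum>x\<in>F. f x *\<^sub>R d x) i))"
      by (subst sum.reindex) (auto simp: inj_on_def lk)
    also have "\<dots> \<le> norm (\<Sum>x\<in>F. f x *\<^sub>R d x)" by (rule sum_lookup_le_norm) (use E in simp)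
    finally show ?thesis using F(2) by simp
  qed
  then show ?thesis using that[of F f] F(1) by (auto simp: P_def)
qed

text \<open>For \<open>\<xi> \<ge> 0\<close> supported in the finite set \<open>F\<close>, the function \<open>g \<mapsto> \<langle>\<lambda>\<^sub>g \<xi>, \<xi>\<rangle>\<close> of positive type.\<close>

definition coefficient :: "'g::group_add set \<Rightarrow> ('g \<Rightarrow> real) \<Rightarrow> 'g \<Rightarrow> real" where
  "coefficient F \<xi> g = (\<Sum>x\<in>F. \<xi> x * \<xi> (- g + x))"

text \<open>Take \<open>\<xi> = \<surd>f\<close> for an almost invariant density \<open>f\<close>. Then \<open>1 - \<langle>\<lambda>\<^sub>g \<xi>, \<xi>\<rangle> = |\<xi> - \<lambda>\<^sub>g \<xi>|\<^sup>2 / 2\<close>, and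
  \<open>(\<surd>s - \<surd>t)\<^sup>2 \<le> |s - t|\<close> bounds this by the \<open>\<ell>\<^sup>1\<close>-distance of \<open>f\<close> and \<open>\<lambda>\<^sub>g f\<close>.\<close>

lemma coefficient_near_one:
  fixes G :: "'g::group_add set"
  assumes am: "amenable TYPE('g)" and G: "finite G" and \<eta>: "0 < \<eta>"
  obtains F \<xi> where "finite F" "\<And>x. 0 \<le> \<xi> x" "\<And>x. x \<notin> F \<Longrightarrow> \<xi> x = 0" "(\<Sum>x\<in>F. (\<xi> x)\<^sup>2) = 1"
    "\<And>g. 0 \<le> coefficient F \<xi> g" "\<And>g. coefficient F \<xi> g \<le> 1" "\<And>g. g \<in> G \<Longrightarrow> 1 - coefficient F \<xi> g < \<eta>"
proof -
  obtain F and f :: "'g \<Rightarrow> real" where F: "finite F" and f0: "\<And>x. 0 \<le> f x" and fF: "\<And>x. x \<notin> F \<Longrightarrow> f x = 0"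
    and f1: "sum f F = 1" and inv: "\<And>g E. g \<in> G \<Longrightarrow> finite E \<Longrightarrow> (\<Sum>y\<in>E. \<bar>f (- g + y) - f y\<bar>) < \<eta>"
    using reiter_condition[OF am G \<eta>] by metis
  define \<xi> where "\<xi> x = sqrt (f x)" for x
  have \<xi>: "0 \<le> \<xi> x" "(\<xi> x)\<^sup>2 = f x" "x \<notin> F \<Longrightarrow> \<xi> x = 0" for x by (auto simp: \<xi>_def f0 fF)
  have eq: "1 - coefficient F \<xi> g = (\<Sum>x\<in>F \<union> (+) g ` F. (\<xi> x - \<xi> (- g + x))\<^sup>2) / 2" for g
  proof -
    let ?E = "F \<union> (+) g ` F"
    have 1: "(\<Sum>x\<in>?E. (\<xi> x)\<^sup>2) = 1"
      unfolding \<xi>(2) using sum.mono_neutral_right[of ?E F f] F f1 fF by auto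
    have "(\<Sum>x\<in>?E. (\<xi> (- g + x))\<^sup>2) = (\<Sum>x\<in>(+) g ` F. (\<xi> (- g + x))\<^sup>2)"
    proof (rule sum.mono_neutral_right)
      show "\<forall>x\<in>?E - (+) g ` F. (\<xi> (- g + x))\<^sup>2 = 0"
      proof
        fix x assume x: "x \<in> ?E - (+) g ` F"
        have "x = g + (- g + x)" by (simp add: add.assoc[symmetric])
        then have "- g + x \<notin> F" using x by blast
        then show "(\<xi> (- g + x))\<^sup>2 = 0" by (simp add: \<xi>(3))
      qed
    qed (use F in auto)
    also have "\<dots> = (\<Sum>x\<in>F. f x)" by (subst sum.reindex) (auto simp: \<xi>(2) add.assoc[symmetric])
    finally have 2: "(\<Sum>x\<in>?E. (\<xi> (- g + x))\<^sup>2) = 1" using f1 by simp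
    have 3: "(\<Sum>x\<in>?E. \<xi> x * \<xi> (- g + x)) = coefficient F \<xi> g"
      unfolding coefficient_def by (rule sum.mono_neutral_right) (use F \<xi>(3) in auto)
    have "(\<Sum>x\<in>?E. (\<xi> x - \<xi> (- g + x))\<^sup>2)
        = (\<Sum>x\<in>?E. (\<xi> x)\<^sup>2) + (\<Sum>x\<in>?E. (\<xi> (- g + x))\<^sup>2) - 2 * (\<Sum>x\<in>?E. \<xi> x * \<xi> (- g + x))"
      by (simp add: power2_diff sum.distrib sum_subtractf sum_distrib_left mult.assoc)
    then show ?thesis unfolding 1 2 3 by simp
  qed
  have near: "1 - coefficient F \<xi> g < \<eta>" if g: "g \<in> G" for g
  proof -
    let ?E = "F \<union> (+) g ` F"
    have "(\<xi> x - \<xi> y)\<^sup>2 \<le> \<bar>f y - f x\<bar>" for x y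
    proof -
      have "(\<xi> x - \<xi> y)\<^sup>2 = \<bar>\<xi> x - \<xi> y\<bar> * \<bar>\<xi> x - \<xi> y\<bar>" by (simp add: power2_eq_square)
      also have "\<dots> \<le> \<bar>\<xi> x - \<xi> y\<bar> * \<bar>\<xi> x + \<xi> y\<bar>"
        using \<xi>(1)[of x] \<xi>(1)[of y] by (intro mult_left_mono) auto
      also have "\<dots> = \<bar>(\<xi> x)\<^sup>2 - (\<xi> y)\<^sup>2\<bar>" by (simp add: abs_mult[symmetric] power2_eq_square algebra_simps)
      finally show ?thesis by (simp add: \<xi>(2) abs_minus_commute)
    qed
    then have "(\<Sum>x\<in>?E. (\<xi> x - \<xi> (- g + x))\<^sup>2) \<le> (\<Sum>x\<in>?E. \<bar>f (- g + x) - f x\<bar>)" by (intro sum_mono)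
    also have "\<dots> < \<eta>" using inv[OF g] F by simp
    finally show ?thesis using \<eta> unfolding eq by linarith
  qed
  have "coefficient F \<xi> g \<le> 1" for g
    using eq[of g] sum_nonneg[of "F \<union> (+) g ` F" "\<lambda>x. (\<xi> x - \<xi> (- g + x))\<^sup>2"] by simp
  moreover have "0 \<le> coefficient F \<xi> g" for g
    unfolding coefficient_def by (intro sum_nonneg mult_nonneg_nonneg \<xi>(1))
  ultimately show ?thesis using that[of F \<xi>] F \<xi> f1 near by auto
qed

text \<open>A finite set carries most of the sum of \<open>k\<close>; there the coefficient is close to one, elsewhere it
  lies between zero and one.\<close>

lemma coefficient_absorbs_summable:
  fixes k :: "'g::group_add \<Rightarrow> real"
  assumes am: "amenable TYPE('g)" and k: "k summable_on UNIV" "\<And>g. 0 \<le> k g" and e: "0 < e"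
  obtains F \<xi> where "finite F" "\<And>x. 0 \<le> \<xi> x" "\<And>x. x \<notin> F \<Longrightarrow> \<xi> x = 0" "(\<Sum>x\<in>F. (\<xi> x)\<^sup>2) = 1"
    "\<And>g. 0 \<le> coefficient F \<xi> g" "\<And>g. coefficient F \<xi> g \<le> 1"
    "(\<lambda>g. k g * (1 - coefficient F \<xi> g)) summable_on UNIV"
    "(\<Sum>\<^sub>\<infinity>g. k g * (1 - coefficient F \<xi> g)) < e"
proof -
  obtain G where G: "finite G" "infsum k (- G) < e / 2"
    using finite_sum_near_infsum[OF k(1), of "e / 2"] e by auto
  define \<eta> where "\<eta> = e / (2 * (infsum k UNIV + 1))"
  have K0: "0 \<le> infsum k UNIV" by (simp add: infsum_nonneg k)
  have \<eta>: "0 < \<eta>" "infsum k UNIV * \<eta> \<le> e / 2"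
    using e K0 by (auto simp: \<eta>_def divide_simps mult.commute)
  obtain F \<xi> where F: "finite F" "\<And>x. 0 \<le> \<xi> x" "\<And>x. x \<notin> F \<Longrightarrow> \<xi> x = 0" "(\<Sum>x\<in>F. (\<xi> x)\<^sup>2) = 1"
    "\<And>g. 0 \<le> coefficient F \<xi> g" "\<And>g. coefficient F \<xi> g \<le> 1" "\<And>g. g \<in> G \<Longrightarrow> 1 - coefficient F \<xi> g < \<eta>"
    using coefficient_near_one[OF am G(1) \<eta>(1)] by metis
  let ?h = "\<lambda>g. k g * (1 - coefficient F \<xi> g)"
  have hle: "?h g \<le> k g" "0 \<le> ?h g" for g
    using F(5,6)[of g] k(2)[of g] by (auto intro: mult_left_le)
  have hs: "?h summable_on UNIV"
    by (rule summable_on_comparison_test[OF k(1)]) (use hle in auto)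
  have "sum ?h G \<le> (\<Sum>g\<in>G. k g * \<eta>)"
    using F(7) k(2) by (intro sum_mono mult_left_mono) (auto simp: less_imp_le)
  also have "\<dots> = sum k G * \<eta>" by (simp add: sum_distrib_right)
  also have "\<dots> \<le> infsum k UNIV * \<eta>"
    using \<eta>(1) finite_sum_le_infsum[OF k(1) G(1)] k(2) by (intro mult_right_mono) auto
  finally have 1: "sum ?h G \<le> e / 2" using \<eta>(2) by simp
  have "infsum ?h (- G) \<le> infsum k (- G)"
    by (rule infsum_mono) (use summable_on_subset_banach[OF hs] summable_on_subset_banach[OF k(1)] hle in auto)
  then have "infsum ?h UNIV < e" using infsum_split_finite[OF hs G(1)] G(2) 1 by simp
  then show ?thesis using that[of F \<xi>] F hs by blast
qed

section \<open>The group algebra with coefficients in the bounded operators\<close>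

definition ops_alg :: "'a operator star_alg" where
  "ops_alg = \<lparr>carrier = ell2_ops, alg_zero = 0, alg_add = (+), alg_scale = op_scale,
     alg_mult = (o\<^sub>L), alg_star = op_adj, alg_norm = norm\<rparr>"

lemma ops_alg_simps [simp]:
  "carrier ops_alg = ell2_ops" "alg_zero ops_alg = 0" "alg_add ops_alg = (+)"
  "alg_scale ops_alg = op_scale" "alg_mult ops_alg = (o\<^sub>L)" "alg_star ops_alg = op_adj"
  "alg_norm ops_alg = norm"
  by (simp_all add: ops_alg_def)

lemma op_scale_minus_one [simp]: "op_scale (- 1) T = - T"
  by (rule blinfun_eqI) (simp add: blinfun.minus_left)

lemma norm_op_scale [simp]: "norm (op_scale c T) = cmod c * norm T"
proof -
  have le: "norm (op_scale c T) \<le> cmod c * norm T" for c T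
    by (rule norm_blinfun_bound) (auto simp: mult.assoc intro!: mult_left_mono norm_blinfun)
  show ?thesis
  proof (cases "c = 0")
    case False
    have "op_scale (inverse c) (op_scale c T) = T"
      by (rule blinfun_eqI) (use False in simp)
    then have "norm T \<le> cmod (inverse c) * norm (op_scale c T)" using le by metis
    then have "cmod c * norm T \<le> norm (op_scale c T)"
      using False by (simp only: norm_inverse) (simp add: field_simps)
    then show ?thesis using le[of c T] by simp
  next
    case True
    then have "op_scale c T = 0" by (intro blinfun_eqI) simp
    then show ?thesis using True by simp
  qed
qed

lemma alg_diff_ops_alg [simp]: "alg_diff ops_alg S T = S - T"
  by (simp add: alg_diff_def)

lemma comm_group_ops_alg: "comm_group (add_group (ops_alg :: 'a operator star_alg))"
proof (rule comm_groupI)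
  fix x :: "'a operator"
  assume "x \<in> carrier (add_group ops_alg)"
  then show "\<exists>y\<in>carrier (add_group ops_alg). y \<otimes>\<^bsub>add_group ops_alg\<^esub> x = \<one>\<^bsub>add_group ops_alg\<^esub>"
    by (intro bexI[of _ "- x"]) (auto simp: add_group_def)
qed (auto simp: add_group_def add_ac)

lemma cstar_algebra_ops_alg: "cstar_algebra (ops_alg :: 'a operator star_alg)"
proof (intro cstar_algebra.intro banach_star_algebra.intro cstar_algebra_axioms.intro,
    unfold ops_alg_simps alg_diff_ops_alg)
  show "comm_group (add_group (ops_alg :: 'a operator star_alg))" by (rule comm_group_ops_alg)
next
  fix s :: "nat \<Rightarrow> 'a operator"
  assume s: "\<And>n. s n \<in> ell2_ops"
    and c: "\<And>e. 0 < e \<Longrightarrow> \<exists>N. \<forall>m\<ge>N. \<forall>n\<ge>N. norm (s m - s n) < e"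
  have "Cauchy s" by (rule CauchyI) (rule c)
  then obtain l where l: "s \<longlonglongrightarrow> l" by (auto simp: Cauchy_convergent_iff convergent_def)
  then have "l \<in> ell2_ops" using closed_ell2_ops s unfolding closed_sequential_limits by blast
  moreover have "(\<lambda>n. norm (s n - l)) \<longlonglongrightarrow> 0" using l by (simp add: LIM_zero_iff tendsto_norm_zero)
  ultimately show "\<exists>l\<in>ell2_ops. (\<lambda>n. norm (s n - l)) \<longlonglongrightarrow> 0" by blast
qed (auto intro!: blinfun_eqI norm_triangle_ineq norm_blinfun_compose
    simp: op_adj_in_ell2_ops op_adj_op_adj op_adj_add op_adj_scale op_adj_comp norm_op_adj norm_op_adj_comp_self
    ell2_ops_scale blinfun.add_left blinfun.add_right ell2.scale_right_distrib ell2.scale_left_distrib)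

lemma infsum_in_ell2_ops:
  assumes "\<And>i. h i \<in> ell2_ops" "(h has_sum s) UNIV"
  shows "s \<in> ell2_ops"
proof (rule Lim_in_closed_set[OF closed_ell2_ops])
  show "(sum h \<longlongrightarrow> s) (finite_subsets_at_top UNIV)" using assms(2) by (simp add: has_sum_def)
qed (auto intro: assms(1))

lemma alg_infsum_ops_alg:
  fixes h :: "'i \<Rightarrow> 'a operator"
  assumes h: "\<And>i. h i \<in> ell2_ops" and s: "(h has_sum s) UNIV"
  shows "alg_infsum ops_alg h = s"
proof -
  interpret comm_group "add_group (ops_alg :: 'a operator star_alg)"
    by (rule comm_group_ops_alg)
  have fin: "finprod (add_group ops_alg) h F = sum h F" if "finite F" for F
    using that
  proof (induction F rule: finite_induct)
    case (insert i F)
    then have "finprod (add_group ops_alg) h (insert i F) = h i + finprod (add_group ops_alg) h F"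
      using h by (subst finprod_insert) (auto simp: add_group_def)
    then show ?case using insert by simp
  next
    case empty
    then show ?case by (simp only: finprod_empty) (simp add: add_group_def)
  qed
  have lim: "((\<lambda>F. norm (finprod (add_group ops_alg) h F - t)) \<longlongrightarrow> 0) (finite_subsets_at_top UNIV)
      \<longleftrightarrow> (h has_sum t) UNIV" for t
  proof -
    have "((\<lambda>F. norm (finprod (add_group ops_alg) h F - t)) \<longlongrightarrow> 0) (finite_subsets_at_top UNIV)
        \<longleftrightarrow> ((\<lambda>F. norm (sum h F - t)) \<longlongrightarrow> 0) (finite_subsets_at_top UNIV)"
      by (rule tendsto_cong) (auto intro!: eventually_finite_subsets_at_top_weakI simp: fin)
    then show ?thesis by (simp add: has_sum_def tendsto_norm_zero_iff LIM_zero_iff)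
  qed
  show ?thesis
    unfolding alg_infsum_def alg_diff_ops_alg ops_alg_simps lim
    using infsum_in_ell2_ops[OF h s] s has_sum_unique by (intro the_equality) blast+
qed

text \<open>The operations of \<open>l1_algebra ops_alg\<close>, with the norm limits that define the convolution expressed as
  ordinary infinite sums of bounded operators.\<close>

definition l1_ops :: "('g \<Rightarrow> 'a operator) set" where
  "l1_ops = {f. (\<forall>x. f x \<in> ell2_ops) \<and> (\<lambda>x. norm (f x)) summable_on UNIV}"

definition op_convolve ::
  "('g::group_add \<Rightarrow> 'a operator) \<Rightarrow> ('g \<Rightarrow> 'a operator) \<Rightarrow> 'g \<Rightarrow> 'a operator" where
  "op_convolve f g x = (\<Sum>\<^sub>\<infinity>y. f y o\<^sub>L g (- y + x))"

definition op_star :: "('g::group_add \<Rightarrow> 'a operator) \<Rightarrow> 'g \<Rightarrow> 'a operator" where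
  "op_star f x = op_adj (f (- x))"

definition op_unit :: "'g::group_add \<Rightarrow> 'a operator" where
  "op_unit x = (if x = 0 then id_blinfun else 0)"

lemma op_convolve_has_sum:
  assumes f: "f \<in> l1_ops" and g: "g \<in> l1_ops"
  shows "((\<lambda>y. f y o\<^sub>L g (- y + x)) has_sum op_convolve f g x) UNIV"
proof -
  have "norm (g z) \<le> (\<Sum>\<^sub>\<infinity>x. norm (g x))" for z
    using finite_sum_le_infsum[of "\<lambda>x. norm (g x)" UNIV "{z}"] g by (simp add: l1_ops_def)
  then have le: "norm (f y o\<^sub>L g (- y + x)) \<le> norm (f y) * (\<Sum>\<^sub>\<infinity>x. norm (g x))" for y
    by (intro order_trans[OF norm_blinfun_compose] mult_left_mono) auto
  have fs: "(\<lambda>y. norm (f y)) summable_on UNIV" using f by (simp add: l1_ops_def)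
  have "(\<lambda>y. norm (f y o\<^sub>L g (- y + x))) summable_on UNIV"
    by (rule summable_on_comparison_test[OF summable_on_cmult_left[OF fs]]) (rule le, rule norm_ge_zero)
  then show ?thesis unfolding op_convolve_def by (rule has_sum_infsum[OF abs_summable_summable])
qed

lemma op_convolve_eqI:
  "((\<lambda>y. f y o\<^sub>L g (- y + x)) has_sum s) UNIV \<Longrightarrow> op_convolve f g x = s"
  unfolding op_convolve_def by (rule infsumI)

lemma l1_algebra_ops_alg_simps:
  fixes f g :: "'g::group_add \<Rightarrow> 'a operator"
  shows "carrier (l1_algebra ops_alg) = (l1_ops :: ('g \<Rightarrow> 'a operator) set)"
    and "alg_star (l1_algebra ops_alg) f = op_star f"
    and "alg_diff (l1_algebra ops_alg) (alg_scale (l1_algebra ops_alg) z f) g = (\<lambda>x. op_scale z (f x) - g x)"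
    and "f \<in> l1_ops \<Longrightarrow> g \<in> l1_ops \<Longrightarrow> alg_mult (l1_algebra ops_alg) f g = op_convolve f g"
proof -
  show "carrier (l1_algebra ops_alg) = (l1_ops :: ('g \<Rightarrow> 'a operator) set)"
    by (simp add: l1_algebra_def l1_ops_def)
  show "alg_star (l1_algebra ops_alg) f = op_star f"
    by (rule ext) (simp add: l1_algebra_def op_star_def)
  show "alg_diff (l1_algebra ops_alg) (alg_scale (l1_algebra ops_alg) z f) g = (\<lambda>x. op_scale z (f x) - g x)"
    by (simp add: l1_algebra_def alg_diff_def)
  assume fg: "f \<in> l1_ops" "g \<in> l1_ops"
  have "alg_infsum ops_alg (\<lambda>y. f y o\<^sub>L g (- y + x)) = op_convolve f g x" for x
    using fg by (intro alg_infsum_ops_alg op_convolve_has_sum) (auto simp: l1_ops_def)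
  then show "alg_mult (l1_algebra ops_alg) f g = op_convolve f g" by (simp add: l1_algebra_def)
qed

lemma op_unit_in_l1_ops: "op_unit \<in> l1_ops"
  unfolding l1_ops_def
proof safe
  show "op_unit x \<in> ell2_ops" for x :: 'a by (simp add: op_unit_def)
  show "(\<lambda>x::'a. norm (op_unit x :: 'b operator)) summable_on UNIV"
    by (rule summable_on_finite_support, rule finite_subset[of _ "{0}"])
      (auto simp: op_unit_def split: if_splits)
qed

lemma op_convolve_unit:
  fixes f :: "'g::group_add \<Rightarrow> 'a operator"
  shows "op_convolve op_unit f = f" and "op_convolve f op_unit = f"
proof -
  show "op_convolve op_unit f = f"
  proof
    fix x
    show "op_convolve op_unit f x = f x"
      using has_sum_singleton[of 0 "\<lambda>y. op_unit y o\<^sub>L f (- y + x)"]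
      by (intro op_convolve_eqI) (simp add: op_unit_def)
  qed
  show "op_convolve f op_unit = f"
  proof
    fix x :: 'g
    have "- y + x \<noteq> 0" if "y \<noteq> x" for y
    proof
      assume "- y + x = 0"
      have "x = y + (- y + x)" by (simp add: add.assoc[symmetric])
      then show False using that \<open>- y + x = 0\<close> by simp
    qed
    then show "op_convolve f op_unit x = f x"
      using has_sum_singleton[of x "\<lambda>y. f y o\<^sub>L op_unit (- y + x)"]
      by (intro op_convolve_eqI) (simp add: op_unit_def)
  qed
qed

lemma op_star_in_l1_ops:
  fixes f :: "'g::group_add \<Rightarrow> 'a operator"
  assumes "f \<in> l1_ops"
  shows "op_star f \<in> l1_ops"
proof -
  have f: "f x \<in> ell2_ops" for x using assms by (simp add: l1_ops_def)
  have "(\<lambda>x. norm (f (- x))) summable_on UNIV"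
    using assms summable_on_reindex_bij_betw[OF bij_uminus_group, of "\<lambda>x. norm (f x)"] by (simp add: l1_ops_def)
  then show ?thesis by (simp add: l1_ops_def op_star_def op_adj_in_ell2_ops norm_op_adj f)
qed

lemma op_convolve_in_l1_ops:
  assumes f: "f \<in> l1_ops" and g: "g \<in> l1_ops"
  shows "op_convolve f g \<in> l1_ops"
proof -
  let ?k = "convolve (\<lambda>x. norm (f x)) (\<lambda>x. norm (g x))"
  have s: "(\<lambda>x. norm (f x)) summable_on UNIV" "(\<lambda>x. norm (g x)) summable_on UNIV"
    using f g by (auto simp: l1_ops_def)
  note c = convolve_summable[OF s(1) _ s(2)]
  have "norm (op_convolve f g x) \<le> ?k x" for x
  proof (rule norm_infsum_le[OF op_convolve_has_sum[OF f g]])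
    show "((\<lambda>y. norm (f y) * norm (g (- y + x))) has_sum ?k x) UNIV"
      unfolding convolve_def using c(1) by (intro has_sum_infsum) auto
  qed (rule norm_blinfun_compose)
  moreover have "?k summable_on UNIV" by (rule c(2)) auto
  ultimately have "(\<lambda>x. norm (op_convolve f g x)) summable_on UNIV"
    by (intro summable_on_comparison_test[of ?k UNIV "\<lambda>x. norm (op_convolve f g x)"]) simp_all
  moreover have "op_convolve f g x \<in> ell2_ops" for x
    by (rule infsum_in_ell2_ops[OF _ op_convolve_has_sum[OF f g]]) (use f g in \<open>auto simp: l1_ops_def\<close>)
  ultimately show ?thesis by (simp add: l1_ops_def)
qed

text \<open>Symmetry says that \<open>- \<delta>\<close> is not in the spectrum of \<open>b\<^sup>* b\<close>.\<close>

lemma symmetric_left_inverse: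
  fixes b :: "'g::group_add \<Rightarrow> 'a operator"
  assumes sym: "symmetric_algebra (l1_algebra ops_alg :: ('g \<Rightarrow> 'a operator) star_alg)"
    and b: "b \<in> l1_ops" and \<delta>: "0 < \<delta>"
  obtains c where "c \<in> l1_ops"
    "op_convolve c (\<lambda>x. \<delta> *\<^sub>R op_unit x + op_convolve (op_star b) b x) = op_unit"
proof -
  let ?L = "l1_algebra ops_alg :: ('g \<Rightarrow> 'a operator) star_alg"
  note L = l1_algebra_ops_alg_simps
  have unit: "is_unit_of ?L op_unit"
    by (simp add: is_unit_of_def L op_unit_in_l1_ops op_convolve_unit)
  have "(THE u. is_unit_of ?L u) = op_unit"
  proof (rule the_equality, rule unit)
    show "u = op_unit" if "is_unit_of ?L u" for u
      using that unit unfolding is_unit_of_def by metis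
  qed
  then have "alg_spectrum ?L a = spectrum_wrt ?L op_unit a" for a
    using unit unfolding alg_spectrum_def by auto
  moreover have star: "alg_mult ?L (alg_star ?L b) b = op_convolve (op_star b) b"
    by (simp add: L b op_star_in_l1_ops)
  ultimately have "spectrum_wrt ?L op_unit (op_convolve (op_star b) b) \<subseteq> complex_of_real ` {0..}"
    using sym b unfolding symmetric_algebra_def L by metis
  moreover have "complex_of_real (- \<delta>) \<notin> complex_of_real ` {0..}"
    using \<delta> by (auto simp del: of_real_minus)
  ultimately have "complex_of_real (- \<delta>) \<notin> spectrum_wrt ?L op_unit (op_convolve (op_star b) b)" by blast
  then obtain c where c: "c \<in> l1_ops"
    "alg_mult ?L c (\<lambda>x. op_scale (complex_of_real (- \<delta>)) (op_unit x) - op_convolve (op_star b) b x) = op_unit"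
    unfolding spectrum_wrt_def L by blast
  define h where "h x = op_scale (complex_of_real (- \<delta>)) (op_unit x) - op_convolve (op_star b) b x" for x
  have bb: "op_convolve (op_star b) b \<in> l1_ops" by (intro op_convolve_in_l1_ops op_star_in_l1_ops b)
  have h: "h \<in> l1_ops"
  proof -
    have s: "(\<lambda>x. norm (op_unit x :: 'a operator)) summable_on UNIV"
      "(\<lambda>x. norm (op_convolve (op_star b) b x)) summable_on UNIV"
      using op_unit_in_l1_ops bb by (auto simp: l1_ops_def)
    have "(\<lambda>x. norm (h x)) summable_on UNIV"
      by (rule summable_on_comparison_test[OF summable_on_add[OF summable_on_cmult_right[OF s(1), of \<delta>] s(2)]])
        (use \<delta> in \<open>auto simp: h_def intro!: order_trans[OF norm_triangle_ineq4]\<close>)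
    then show ?thesis
      using bb op_unit_in_l1_ops by (auto simp: l1_ops_def h_def)
  qed
  have ch: "op_convolve c h = op_unit"
    using c h unfolding h_def[abs_def] by (simp add: L)
  have "op_convolve (\<lambda>y. - c y) (\<lambda>x. \<delta> *\<^sub>R op_unit x + op_convolve (op_star b) b x) x = op_unit x" for x
  proof (rule op_convolve_eqI)
    have "- c y o\<^sub>L (\<delta> *\<^sub>R op_unit z + op_convolve (op_star b) b z) = c y o\<^sub>L h z" for y z
    proof -
      have "h z = - (\<delta> *\<^sub>R op_unit z + op_convolve (op_star b) b z)"
        by (rule blinfun_eqI)
          (simp add: h_def blinfun.diff_left blinfun.minus_left blinfun.add_left blinfun.scaleR_left scaleR_ell2_def)
      then show ?thesis by (simp only: blinfun_compose.minus_left blinfun_compose.minus_right)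
    qed
    then show "((\<lambda>y. - c y o\<^sub>L (\<delta> *\<^sub>R op_unit (- y + x) + op_convolve (op_star b) b (- y + x))) has_sum op_unit x) UNIV"
      using op_convolve_has_sum[OF c(1) h, of x] by (simp add: ch)
  qed
  moreover have "(\<lambda>y. - c y) \<in> l1_ops" using c(1) by (auto simp: l1_ops_def)
  ultimately show ?thesis using that by blast
qed

section \<open>Inverses of convolution-dominated operators\<close>

text \<open>The columns of the operator have disjoint supports, so its norm is the largest norm of a column.\<close>

lemma weighted_composition_operator:
  fixes m :: "'a \<Rightarrow> complex" and \<pi> :: "'a \<Rightarrow> 'a"
  assumes B: "0 \<le> B" and col: "\<And>w F. finite F \<Longrightarrow> (\<Sum>x | x \<in> F \<and> \<pi> x = w. (cmod (m x))\<^sup>2) \<le> B\<^sup>2"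
  obtains T where "T \<in> ell2_ops" "norm T \<le> B" "\<And>v x. ell2_fun (blinfun_apply T v) x = m x * ell2_fun v (\<pi> x)"
proof -
  define f where "f v = Abs_ell2 (\<lambda>x. m x * ell2_fun v (\<pi> x))" for v
  have bd: "(\<Sum>x\<in>F. (cmod (m x * ell2_fun v (\<pi> x)))\<^sup>2) \<le> (B * norm v)\<^sup>2" if F: "finite F" for F v
  proof -
    have "(\<Sum>x\<in>F. (cmod (m x * ell2_fun v (\<pi> x)))\<^sup>2)
        = (\<Sum>w\<in>\<pi> ` F. \<Sum>x | x \<in> F \<and> \<pi> x = w. (cmod (m x * ell2_fun v (\<pi> x)))\<^sup>2)"
      using F by (rule sum.image_gen)
    also have "\<dots> = (\<Sum>w\<in>\<pi> ` F. (\<Sum>x | x \<in> F \<and> \<pi> x = w. (cmod (m x))\<^sup>2) * (cmod (ell2_fun v w))\<^sup>2)"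
      unfolding sum_distrib_right
      by (intro sum.cong refl) (auto simp: norm_mult power_mult_distrib)
    also have "\<dots> \<le> (\<Sum>w\<in>\<pi> ` F. B\<^sup>2 * (cmod (ell2_fun v w))\<^sup>2)"
      by (intro sum_mono mult_right_mono col[OF F]) auto
    also have "\<dots> \<le> B\<^sup>2 * (norm v)\<^sup>2"
      unfolding sum_distrib_left[symmetric] by (intro mult_left_mono sum_cmod_sq_le) (use F in auto)
    finally show ?thesis by (simp add: power_mult_distrib)
  qed
  have f: "ell2_fun (f v) x = m x * ell2_fun v (\<pi> x)" "norm (f v) \<le> B * norm v" for v x
    unfolding f_def using Abs_ell2_bounded[OF bd] B by auto
  have "f (u + v) = f u + f v" for u v by (rule ell2_eqI) (simp add: f distrib_left)
  moreover have "f (ell2_scale c v) = ell2_scale c (f v)" for c v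
    by (rule ell2_eqI) (simp add: f mult.left_commute)
  ultimately obtain T where "T \<in> ell2_ops" "blinfun_apply T = f" "norm T \<le> B"
    using ell2_op_ex[of f B, OF _ _ f(2)] B by blast
  then show ?thesis using that f(1) by metis
qed

text \<open>By this bijection operators from \<open>\<ell>\<^sup>2(G)\<close> to \<open>\<ell>\<^sup>2(G) \<oplus> \<ell>\<^sup>2(G \<times> G)\<close> become operators on \<open>\<ell>\<^sup>2(G)\<close>.\<close>

lemma infinite_bij_Plus_Times:
  assumes "infinite (UNIV :: 'a set)"
  obtains \<rho> :: "'a \<Rightarrow> 'a + 'a \<times> 'a" where "bij \<rho>"
proof -
  have "\<exists>p. bij_betw p (UNIV \<times> UNIV :: ('a \<times> 'a) set) (UNIV :: 'a set)"
    using card_of_Times_same_infinite[OF assms] unfolding card_of_ordIso[symmetric] .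
  then obtain p :: "'a \<times> 'a \<Rightarrow> 'a" where p: "bij p" by auto
  have "\<exists>r. bij_betw r (UNIV <+> UNIV :: ('a + 'a) set) (UNIV :: 'a set)"
    using card_of_Plus_infinite1[OF assms card_of_mono1[OF subset_refl]] unfolding card_of_ordIso[symmetric] .
  then obtain r :: "'a + 'a \<Rightarrow> 'a" where "bij r" by auto
  then have q: "bij (inv_into UNIV r)" by (rule bij_imp_bij_inv)
  have "bij (map_sum id (inv_into UNIV p) \<circ> inv_into UNIV r)"
  proof (rule bij_comp[OF q])
    have "p (inv_into UNIV p z) = z" "inv_into UNIV p (p y) = y" for z y
      using p by (simp_all add: bij_is_surj surj_f_inv_f bij_is_inj)
    then have "map_sum id p (map_sum id (inv_into UNIV p) a) = a"
      "map_sum id (inv_into UNIV p) (map_sum id p b) = b" for a :: "'a + 'a" and b :: "'a + 'a \<times> 'a"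
      by (cases a; cases b; simp)+
    then show "bij (map_sum id (inv_into UNIV p) :: 'a + 'a \<Rightarrow> 'a + 'a \<times> 'a)"
      by (intro bij_betw_byWitness[where f' = "map_sum id p"]) auto
  qed
  then show ?thesis using that by blast
qed

lemma coefficient_has_sum:
  assumes "finite F" "\<And>x. x \<notin> F \<Longrightarrow> \<xi> x = 0"
  shows "((\<lambda>x. \<xi> x * \<xi> (- g + x)) has_sum coefficient F \<xi> g) UNIV"
proof -
  have "((\<lambda>x. \<xi> x * \<xi> (- g + x)) has_sum coefficient F \<xi> g) F"
    unfolding coefficient_def by (rule has_sum_finite[OF assms(1)])
  then show ?thesis
    by (subst has_sum_cong_neutral[of F UNIV "\<lambda>x. \<xi> x * \<xi> (- g + x)" "\<lambda>x. \<xi> x * \<xi> (- g + x)"])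
      (use assms in auto)
qed

lemma coefficient_uminus:
  fixes F :: "'g::group_add set"
  assumes "finite F" "\<And>x. x \<notin> F \<Longrightarrow> \<xi> x = 0"
  shows "coefficient F \<xi> (- g) = coefficient F \<xi> g"
proof -
  have bij: "bij ((+) (- g) :: 'g \<Rightarrow> 'g)"
    by (rule bij_betw_byWitness[where f' = "(+) g"]) (auto simp: add.assoc[symmetric])
  have "((\<lambda>x. \<xi> x * \<xi> (- (- g) + x)) has_sum coefficient F \<xi> (- g)) UNIV"
    by (rule coefficient_has_sum[OF assms])
  then have "((\<lambda>x. \<xi> (- g + x) * \<xi> (- (- g) + (- g + x))) has_sum coefficient F \<xi> (- g)) UNIV"
    using has_sum_reindex_bij_betw[OF bij, of "\<lambda>x. \<xi> x * \<xi> (- (- g) + x)"] by simp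
  then have "((\<lambda>x. \<xi> x * \<xi> (- g + x)) has_sum coefficient F \<xi> (- g)) UNIV"
    by (simp add: add.assoc[symmetric] mult.commute)
  from has_sum_unique[OF this coefficient_has_sum[of F \<xi> g, OF assms]] show ?thesis .
qed

lemma entry_adj_comp:
  assumes "S \<in> ell2_ops"
  shows "entry (op_adj S o\<^sub>L T) u w = ell2_cinner (T (ket w)) (S (ket u))"
  using cinner_op_adj_left[OF assms, of "T (ket w)" "ket u"] by (simp add: entry_def)

lemma uminus_add_eq_iff: "- g + z = w \<longleftrightarrow> z = g + (w :: 'g::group_add)"
  by (auto simp: add.assoc[symmetric])

text \<open>Every operator \<open>R\<close> gives rise to squares in the group algebra: for finitely supported \<open>\<xi>\<close> the
  element \<open>b\<^sub>g = \<xi>(g\<inverse>) V\<^sub>g\<close> with \<open>V\<^sub>g \<delta>\<^sub>w = R \<delta>\<^sub>w \<otimes> \<delta>\<^bsub>g w\<^esub>\<close> satisfies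
  \<open>(b\<^sup>* b)\<^sub>x = \<langle>\<lambda>\<^sub>x \<xi>, \<xi>\<rangle> (R\<^sup>* R)\<^sub>x\<close>, where the index on the right denotes the \<open>x\<close>-th diagonal. A
  convolution-dominated \<open>d\<close> is embedded as the family of its diagonals. Infinity of the group makes
  room for both: \<open>\<ell>\<^sup>2(G) \<oplus> \<ell>\<^sup>2(G \<times> G)\<close> is identified with \<open>\<ell>\<^sup>2(G)\<close>.\<close>

lemma diagonals_of_gram_operators:
  fixes d R :: "'g::group_add operator" and \<xi> :: "'g \<Rightarrow> real"
  assumes inf: "infinite (UNIV :: 'g set)" and d: "dominated_by k d" and R: "R \<in> ell2_ops"
    and F: "finite F" "\<And>x. x \<notin> F \<Longrightarrow> \<xi> x = 0"
  obtains b where "b \<in> l1_ops"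
    "\<And>x u w. entry (op_convolve (op_star b) b x) u w =
      (if u - w = x then entry (op_adj d o\<^sub>L d) u w
          + complex_of_real (coefficient F \<xi> x) * entry (op_adj R o\<^sub>L R) u w else 0)"
proof -
  obtain \<rho> :: "'g \<Rightarrow> 'g + 'g \<times> 'g" where \<rho>: "bij \<rho>" using infinite_bij_Plus_Times[OF inf] .
  have dops: "d \<in> ell2_ops" using d by (simp add: dominated_by_def)
  define n where "n g p = (case p of Inl z \<Rightarrow> entry d z (- g + z)
    | Inr (z, c) \<Rightarrow> complex_of_real (\<xi> (- g)) * entry R z (- g + c))" for g p
  define q where "q g p = (case p of Inl z \<Rightarrow> - g + z | Inr (z, c) \<Rightarrow> - g + c)" for g and p :: "'g + 'g \<times> 'g"
  have n_simps: "n g (Inl z) = entry d z (- g + z)"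
    "n g (Inr (z, c)) = complex_of_real (\<xi> (- g)) * entry R z (- g + c)" for g z c by (simp_all add: n_def)
  have q_simps: "q g (Inl z) = - g + z" "q g (Inr (z, c)) = - g + c" for g z c by (simp_all add: q_def)
  define B where "B g = k g + \<bar>\<xi> (- g)\<bar> * norm R" for g
  have B0: "0 \<le> B g" for g by (simp add: B_def dominated_by_nonneg[OF d])
  have col: "(\<Sum>x | x \<in> E \<and> q g (\<rho> x) = w. (cmod (n g (\<rho> x)))\<^sup>2) \<le> (B g)\<^sup>2" if E: "finite E" for E g w
  proof -
    define S where "S = {x \<in> E. q g (\<rho> x) = w}"
    define Z where "Z = (\<lambda>p. case p of Inl z \<Rightarrow> z | Inr (z, c) \<Rightarrow> z) ` \<rho> ` S"
    have fin: "finite S" "finite Z" using E by (auto simp: S_def Z_def)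
    have sub: "\<rho> ` S \<subseteq> insert (Inl (g + w)) ((\<lambda>z. Inr (z, g + w)) ` Z)"
    proof
      fix p assume p: "p \<in> \<rho> ` S"
      then have qw: "q g p = w" by (auto simp: S_def)
      show "p \<in> insert (Inl (g + w)) ((\<lambda>z. Inr (z, g + w)) ` Z)"
      proof (cases p)
        case (Inl z)
        then show ?thesis using qw by (simp add: q_simps uminus_add_eq_iff)
      next
        case (Inr zc)
        obtain z c where zc: "zc = (z, c)" by (cases zc)
        have "z \<in> Z" unfolding Z_def by (rule image_eqI[of _ _ p]) (use p Inr zc in auto)
        then show ?thesis using qw Inr zc by (auto simp: q_simps uminus_add_eq_iff)
      qed
    qed
    have "(\<Sum>x\<in>S. (cmod (n g (\<rho> x)))\<^sup>2) = (\<Sum>p\<in>\<rho> ` S. (cmod (n g p))\<^sup>2)"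
      using \<rho> by (subst sum.reindex) (auto intro: inj_on_subset[OF bij_is_inj])
    also have "\<dots> \<le> (\<Sum>p\<in>insert (Inl (g + w)) ((\<lambda>z. Inr (z, g + w)) ` Z). (cmod (n g p))\<^sup>2)"
      by (rule sum_mono2) (use sub fin in auto)
    also have "\<dots> = (cmod (entry d (g + w) w))\<^sup>2 + (\<Sum>z\<in>Z. (cmod (complex_of_real (\<xi> (- g)) * entry R z w))\<^sup>2)"
      using fin by (subst sum.insert) (auto simp: sum.reindex inj_on_def n_simps add.assoc[symmetric])
    also have "(\<Sum>z\<in>Z. (cmod (complex_of_real (\<xi> (- g)) * entry R z w))\<^sup>2) = (\<xi> (- g))\<^sup>2 * (\<Sum>z\<in>Z. (cmod (entry R z w))\<^sup>2)"
      by (simp add: norm_mult power_mult_distrib sum_distrib_left)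
    also have "(cmod (entry d (g + w) w))\<^sup>2 + \<dots> \<le> (k g)\<^sup>2 + (\<xi> (- g))\<^sup>2 * (norm R)\<^sup>2"
    proof (intro add_mono mult_left_mono)
      have "cmod (entry d (g + w) w) \<le> k (g + w - w)" using d unfolding dominated_by_def by blast
      then show "(cmod (entry d (g + w) w))\<^sup>2 \<le> (k g)\<^sup>2" by (intro power_mono) auto
      have "(\<Sum>z\<in>Z. (cmod (entry R z w))\<^sup>2) \<le> (norm (R (ket w)))\<^sup>2"
        unfolding entry_def by (rule sum_cmod_sq_le[OF fin(2)])
      also have "\<dots> \<le> (norm R)\<^sup>2" using norm_blinfun[of R "ket w"] by (intro power_mono) auto
      finally show "(\<Sum>z\<in>Z. (cmod (entry R z w))\<^sup>2) \<le> (norm R)\<^sup>2" .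
    qed simp
    also have "\<dots> \<le> (B g)\<^sup>2"
      unfolding B_def power2_sum by (simp add: power_mult_distrib dominated_by_nonneg[OF d])
    finally show ?thesis by (simp add: S_def)
  qed
  have "\<exists>T. T \<in> ell2_ops \<and> norm T \<le> B g \<and>
      (\<forall>v x. ell2_fun (blinfun_apply T v) x = n g (\<rho> x) * ell2_fun v (q g (\<rho> x)))" for g
    using weighted_composition_operator[OF B0 col] by metis
  then obtain b where b: "\<And>g. b g \<in> ell2_ops" "\<And>g. norm (b g) \<le> B g"
    "\<And>g v x. ell2_fun (blinfun_apply (b g) v) x = n g (\<rho> x) * ell2_fun v (q g (\<rho> x))" by metis
  have b_l1: "b \<in> l1_ops"
  proof -
    have "(\<lambda>g. \<bar>\<xi> (- g)\<bar> * norm R) summable_on UNIV"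
    proof (rule summable_on_finite_support)
      have "g \<in> uminus ` F" if "\<xi> (- g) \<noteq> 0" for g
        using F(2)[of "- g"] that by (intro image_eqI[of _ _ "- g"]) auto
      then show "finite {g. \<bar>\<xi> (- g)\<bar> * norm R \<noteq> 0}"
        by (intro finite_subset[OF _ finite_imageI[OF F(1), of uminus]]) auto
    qed
    then have "B summable_on UNIV"
      unfolding B_def[abs_def] using d by (intro summable_on_add) (auto simp: dominated_by_def)
    then have "(\<lambda>g. norm (b g)) summable_on UNIV"
      by (rule summable_on_comparison_test) (use b in auto)
    then show ?thesis using b by (simp add: l1_ops_def)
  qed
  \<comment> \<open>Both components of \<open>b h' \<delta>\<^sub>w\<close> live over the point \<open>h' w\<close>.\<close>
  have cin: "ell2_cinner (b h' (ket w)) (b h (ket u)) = (if h' + w = h + u then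
      entry d (h' + w) w * cnj (entry d (h' + w) u)
      + complex_of_real (\<xi> (- h) * \<xi> (- h')) * ell2_cinner (R (ket w)) (R (ket u)) else 0)" for h h' u w
  proof -
    define G where "G p = n h' p * (if q h' p = w then 1 else 0) * cnj (n h p * (if q h p = u then 1 else 0))" for p
    have "((\<lambda>x. ell2_fun (b h' (ket w)) x * cnj (ell2_fun (b h (ket u)) x)) has_sum
        ell2_cinner (b h' (ket w)) (b h (ket u))) UNIV"
      unfolding ell2_cinner_def using ell2_cinner_summable by (rule has_sum_infsum)
    then have "((\<lambda>x. G (\<rho> x)) has_sum ell2_cinner (b h' (ket w)) (b h (ket u))) UNIV"
      unfolding b(3) G_def ell2_fun_ket .
    then have G: "(G has_sum ell2_cinner (b h' (ket w)) (b h (ket u))) UNIV"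
      using has_sum_reindex_bij_betw[OF \<rho>, of G] by simp
    show ?thesis
    proof (cases "h' + w = h + u")
      case False
      have "G p = 0" for p
        using False by (cases p) (auto simp: G_def q_simps uminus_add_eq_iff)
      then have "(G has_sum 0) UNIV" by (rule has_sum_0)
      then show ?thesis using False has_sum_unique[OF G] by simp
    next
      case True
      define c where "c = h' + w"
      have c: "- h' + c = w" "- h + c = u" "c = h + u"
        by (simp_all add: c_def True uminus_add_eq_iff)
      have 1: "(G has_sum entry d c w * cnj (entry d c u)) {Inl c}"
        using has_sum_finite[of "{Inl c}" G] by (simp add: G_def n_simps q_simps c(1,2))
      have GInr: "G (Inr (z, c)) = complex_of_real (\<xi> (- h) * \<xi> (- h')) * (entry R z w * cnj (entry R z u))" for z
        by (simp add: G_def n_simps q_simps c(1,2))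
      have "((\<lambda>z. entry R z w * cnj (entry R z u)) has_sum ell2_cinner (R (ket w)) (R (ket u))) UNIV"
        unfolding entry_def ell2_cinner_def using ell2_cinner_summable by (rule has_sum_infsum)
      then have "((\<lambda>z. G (Inr (z, c))) has_sum
          complex_of_real (\<xi> (- h) * \<xi> (- h')) * ell2_cinner (R (ket w)) (R (ket u))) UNIV"
        unfolding GInr by (rule has_sum_cmult_right)
      then have 2: "(G has_sum
          complex_of_real (\<xi> (- h) * \<xi> (- h')) * ell2_cinner (R (ket w)) (R (ket u))) (range (\<lambda>z. Inr (z, c)))"
        by (subst has_sum_reindex) (auto simp: inj_on_def o_def)
      have "(G has_sum (entry d c w * cnj (entry d c u)
          + complex_of_real (\<xi> (- h) * \<xi> (- h')) * ell2_cinner (R (ket w)) (R (ket u))))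
          ({Inl c} \<union> range (\<lambda>z. Inr (z, c)))"
        by (rule has_sum_Un_disjoint[OF 1 2]) auto
      moreover have "G p = 0" if "p \<notin> {Inl c} \<union> range (\<lambda>z. Inr (z, c))" for p
      proof (cases p)
        case (Inl z)
        then have "z \<noteq> c" using that by auto
        then show ?thesis using Inl by (auto simp: G_def q_simps uminus_add_eq_iff c_def)
      next
        case (Inr zx)
        obtain z x where zx: "zx = (z, x)" by (cases zx)
        then have "x \<noteq> c" using that Inr by auto
        then show ?thesis using Inr zx by (auto simp: G_def q_simps uminus_add_eq_iff c_def)
      qed
      then have "(G has_sum s) UNIV \<longleftrightarrow> (G has_sum s) ({Inl c} \<union> range (\<lambda>z. Inr (z, c)))" for s
        by (intro has_sum_cong_neutral) auto
      ultimately have "(G has_sum (entry d c w * cnj (entry d c u)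
          + complex_of_real (\<xi> (- h) * \<xi> (- h')) * ell2_cinner (R (ket w)) (R (ket u)))) UNIV" by blast
      then show ?thesis using has_sum_unique[OF G] True by (simp add: c_def)
    qed
  qed
  have "entry (op_convolve (op_star b) b x) u w =
      (if u - w = x then entry (op_adj d o\<^sub>L d) u w
          + complex_of_real (coefficient F \<xi> x) * entry (op_adj R o\<^sub>L R) u w else 0)" for x u w
  proof -
    have sum: "((\<lambda>y. ell2_cinner (b (- y + x) (ket w)) (b (- y) (ket u))) has_sum
        entry (op_convolve (op_star b) b x) u w) UNIV"
      using has_sum_bounded_linear[OF bounded_linear_entry op_convolve_has_sum[OF op_star_in_l1_ops[OF b_l1] b_l1], of x u w]
      by (simp add: op_star_def entry_adj_comp b(1))
    have iff: "- y + x + w = - y + u \<longleftrightarrow> u - w = x" for y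
      by (auto simp: add.assoc eq_diff_eq diff_eq_eq)
    show ?thesis
    proof (cases "u - w = x")
      case False
      then have "ell2_cinner (b (- y + x) (ket w)) (b (- y) (ket u)) = 0" for y by (simp add: cin iff)
      then have "((\<lambda>y. ell2_cinner (b (- y + x) (ket w)) (b (- y) (ket u))) has_sum 0) UNIV" by (rule has_sum_0)
      then show ?thesis using False has_sum_unique[OF sum] by simp
    next
      case True
      then have xw: "x + w = u" by (auto simp: diff_eq_eq)
      have bij: "bij (\<lambda>y. - y + u :: 'g)"
        by (rule bij_betw_byWitness[where f' = "\<lambda>z. u - z"]) (auto simp: algebra_simps)
      have "((\<lambda>z. entry d z w * cnj (entry d z u)) has_sum entry (op_adj d o\<^sub>L d) u w) UNIV"
        unfolding entry_adj_comp[OF dops] unfolding entry_def ell2_cinner_def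
        using ell2_cinner_summable by (rule has_sum_infsum)
      then have 1: "((\<lambda>y. entry d (- y + u) w * cnj (entry d (- y + u) u)) has_sum entry (op_adj d o\<^sub>L d) u w) UNIV"
        using has_sum_reindex_bij_betw[OF bij, of "\<lambda>z. entry d z w * cnj (entry d z u)"] by simp
      have 2: "((\<lambda>y. complex_of_real (\<xi> y * \<xi> (- x + y)) * entry (op_adj R o\<^sub>L R) u w) has_sum
          complex_of_real (coefficient F \<xi> x) * entry (op_adj R o\<^sub>L R) u w) UNIV"
        by (intro has_sum_cmult_left has_sum_of_real coefficient_has_sum F)
      have "ell2_cinner (b (- y + x) (ket w)) (b (- y) (ket u)) =
          entry d (- y + u) w * cnj (entry d (- y + u) u)
          + complex_of_real (\<xi> y * \<xi> (- x + y)) * entry (op_adj R o\<^sub>L R) u w" for y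
      proof -
        have "- y + x + w = - y + u" by (simp add: iff True)
        moreover have "- (- y + x) = - x + y" by (simp add: minus_add)
        ultimately show ?thesis by (simp add: cin entry_adj_comp[OF R])
      qed
      then show ?thesis using has_sum_unique[OF sum] has_sum_add[OF 1 2] True by simp
    qed
  qed
  then show ?thesis using that b_l1 by blast
qed

text \<open>Amenability lets one write the diagonals of \<open>T\<^sup>* T\<close> as \<open>\<delta> + b\<^sup>* b\<close> in the symmetric group algebra:
  with \<open>R\<^sup>* R = T\<^sup>* T - \<epsilon>\<close> and a function \<open>\<phi> = \<langle>\<lambda>\<xi>, \<xi>\<rangle>\<close> close to one, \<open>\<phi> T\<^sup>* T = \<epsilon> + \<phi> R\<^sup>* R\<close> is a square up
  to \<open>\<epsilon>\<close>, and the small remainder \<open>(1 - \<phi>) T\<^sup>* T\<close> is absorbed by half of this \<open>\<epsilon>\<close>, because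
  \<open>\<epsilon>/2 + (1 - \<phi>) T\<^sup>* T\<close> has a convolution-dominated square root. The left inverse in the group algebra is
  then compressed to an operator on \<open>\<ell>\<^sup>2(G)\<close>.\<close>

theorem dominated_gram_inverse:
  fixes T S :: "'g::group_add operator"
  assumes am: "amenable TYPE('g)" and rs: "rigidly_symmetric TYPE('g) TYPE('g operator)"
    and T: "dominated T" and S: "S \<in> ell2_ops" "S o\<^sub>L T = id_blinfun" "T o\<^sub>L S = id_blinfun"
  shows "dominated (S o\<^sub>L op_adj S)"
proof (cases "finite (UNIV :: 'g set)")
  case True
  have "S o\<^sub>L op_adj S \<in> ell2_ops" using S op_adj_in_ell2_ops by blast
  then show ?thesis by (rule dominated_if_finite_matrix) (rule finite_subset[OF subset_UNIV True])
next
  case inf: False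
  have Tops: "T \<in> ell2_ops" using T by (rule dominated_in_ell2_ops)
  note adj = op_adj_in_ell2_ops[OF Tops] op_adj_in_ell2_ops[OF S(1)]
  define a where "a = op_adj T o\<^sub>L T"
  have aops: "a \<in> ell2_ops" using adj Tops by (auto simp: a_def)
  have TS': "op_adj T o\<^sub>L op_adj S = id_blinfun"
    using op_adj_comp[OF S(1) Tops] S(2) by simp
  have "dominated a" unfolding a_def by (intro dominated_comp dominated_op_adj T)
  then obtain k where k: "dominated_by k a" by (auto simp: dominated_def)
  have ks: "k summable_on UNIV" "\<And>g. 0 \<le> k g" using k dominated_by_nonneg by (auto simp: dominated_by_def)
  \<comment> \<open>\<open>R\<^sup>* R = T\<^sup>* (1 - \<epsilon> S\<^sup>* S) T\<close>, and \<open>\<epsilon>\<close> is small enough for the middle factor to have a square root.\<close>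
  define \<epsilon> where "\<epsilon> = 1 / (2 * ((norm S)\<^sup>2 + 1))"
  have \<epsilon>: "\<epsilon> > 0" by (simp add: \<epsilon>_def add_nonneg_pos)
  define X where "X = \<epsilon> *\<^sub>R (op_adj S o\<^sub>L S)"
  have "norm X < 1"
  proof -
    have "norm X = \<epsilon> * (norm S)\<^sup>2" using \<epsilon> by (simp add: X_def norm_op_adj_comp_self[OF S(1)])
    also have "\<dots> < 1" by (simp add: \<epsilon>_def divide_simps add_nonneg_pos)
    finally show ?thesis .
  qed
  moreover have "selfadj X"
    using S(1) adj
    by (auto simp: selfadj_def X_def op_adj_scaleR[OF comp_in_ell2_ops] op_adj_comp op_adj_op_adj)
  ultimately obtain Y where Y: "selfadj Y" "Y o\<^sub>L Y = id_blinfun - X" using selfadj_square_root by blast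
  define R where "R = Y o\<^sub>L T"
  have Rops: "R \<in> ell2_ops" using Y Tops by (auto simp: R_def selfadj_def)
  have RR: "op_adj R o\<^sub>L R = a - \<epsilon> *\<^sub>R id_blinfun"
  proof -
    have "op_adj R o\<^sub>L R = op_adj T o\<^sub>L ((Y o\<^sub>L Y) o\<^sub>L T)"
      using Y(1) Tops by (simp add: R_def op_adj_comp selfadj_def blinfun_comp_assoc)
    also have "\<dots> = a - \<epsilon> *\<^sub>R ((op_adj T o\<^sub>L op_adj S) o\<^sub>L (S o\<^sub>L T))"
      by (simp add: Y(2) X_def a_def blinfun_compose.diff_left blinfun_compose.diff_right
          blinfun_compose.scaleR_left blinfun_compose.scaleR_right blinfun_comp_assoc)
    finally show ?thesis by (simp add: TS' S(2))
  qed
  obtain F \<xi> where F: "finite F" "\<And>x. 0 \<le> \<xi> x" "\<And>x. x \<notin> F \<Longrightarrow> \<xi> x = 0" "(\<Sum>x\<in>F. (\<xi> x)\<^sup>2) = 1"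
    "\<And>g. 0 \<le> coefficient F \<xi> g" "\<And>g. coefficient F \<xi> g \<le> 1"
    "(\<lambda>g. k g * (1 - coefficient F \<xi> g)) summable_on UNIV"
    "(\<Sum>\<^sub>\<infinity>g. k g * (1 - coefficient F \<xi> g)) < \<epsilon> / 2"
    using coefficient_absorbs_summable[OF am ks, of "\<epsilon> / 2"] \<epsilon> by auto
  define \<phi> where "\<phi> = coefficient F \<xi>"
  have \<phi>0: "\<phi> 0 = 1" using F(4) by (simp add: \<phi>_def coefficient_def power2_eq_square)
  have \<phi>sym: "\<phi> (- g) = \<phi> g" for g unfolding \<phi>_def by (rule coefficient_uminus) (use F in auto)
  have asym: "entry a x y = cnj (entry a y x)" for x y
  proof -
    have "op_adj a = a" using Tops adj by (simp add: a_def op_adj_comp op_adj_op_adj)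
    then show ?thesis using entry_op_adj[OF aops, of x y] by simp
  qed
  \<comment> \<open>The square root \<open>d\<close> of \<open>\<epsilon>/2 + (1 - \<phi>) a\<close>.\<close>
  define l where "l g = (2 / \<epsilon>) * (k g * (1 - \<phi> g))" for g
  have ls: "l summable_on UNIV" unfolding l_def using F(7) by (intro summable_on_cmult_right) (simp add: \<phi>_def)
  have l1: "infsum l UNIV < 1"
  proof -
    have "infsum l UNIV = (2 / \<epsilon>) * (\<Sum>\<^sub>\<infinity>g. k g * (1 - \<phi> g))" unfolding l_def by (rule infsum_cmult_right')
    also have "\<dots> < (2 / \<epsilon>) * (\<epsilon> / 2)" using F(8) \<epsilon> by (intro mult_strict_left_mono) (auto simp: \<phi>_def)
    finally show ?thesis using \<epsilon> by simp
  qed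
  define M where "M x y = complex_of_real (- (2 / \<epsilon>) * (1 - \<phi> (x - y))) * entry a x y" for x y
  have Ml: "cmod (M x y) \<le> l (x - y)" for x y
  proof -
    have "\<bar>- (2 / \<epsilon>) * (1 - \<phi> (x - y))\<bar> = (2 / \<epsilon>) * (1 - \<phi> (x - y))"
      using \<epsilon> F(6)[of "x - y"] unfolding abs_mult by (simp add: \<phi>_def)
    then have "cmod (M x y) = (2 / \<epsilon>) * (cmod (entry a x y) * (1 - \<phi> (x - y)))"
      unfolding M_def norm_mult norm_of_real by simp
    also have "\<dots> \<le> l (x - y)"
      unfolding l_def using \<epsilon> F(6)[of "x - y"] k
      by (intro mult_left_mono mult_right_mono) (auto simp: dominated_by_def \<phi>_def)
    finally show ?thesis .
  qed
  obtain X' where X': "dominated_by l X'" "\<And>x y. entry X' x y = M x y"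
    using operator_of_matrix[OF ls Ml] by metis
  have "selfadj X'"
    unfolding selfadj_iff
  proof (intro conjI allI)
    show "X' \<in> ell2_ops" using X' by (simp add: dominated_by_def)
    fix x y
    have "\<phi> (y - x) = \<phi> (x - y)" using \<phi>sym[of "x - y"] by simp
    then show "entry X' x y = cnj (entry X' y x)" unfolding X'(2) M_def using asym[of x y] by simp
  qed
  then obtain D where D: "selfadj D" "dominated D" "D o\<^sub>L D = id_blinfun - X'"
    using dominated_square_root[OF _ X'(1) l1] by blast
  define d where "d = sqrt (\<epsilon> / 2) *\<^sub>R D"
  have Dops: "D \<in> ell2_ops" "op_adj D = D" using D by (auto simp: selfadj_def)
  have "dominated d" unfolding d_def by (intro dominated_scaleR D)
  then obtain \<kappa> where \<kappa>: "dominated_by \<kappa> d" by (auto simp: dominated_def)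
  have dd: "op_adj d o\<^sub>L d = (\<epsilon> / 2) *\<^sub>R (id_blinfun - X')"
    using \<epsilon> by (simp add: d_def op_adj_scaleR Dops D(3) blinfun_compose.scaleR_left
        blinfun_compose.scaleR_right del: scaleR_right_diff_distrib)
  obtain b where b: "b \<in> l1_ops" and bb: "\<And>x u w. entry (op_convolve (op_star b) b x) u w =
      (if u - w = x then entry (op_adj d o\<^sub>L d) u w
          + complex_of_real (coefficient F \<xi> x) * entry (op_adj R o\<^sub>L R) u w else 0)"
    by (rule diagonals_of_gram_operators[OF inf \<kappa> Rops F(1), of \<xi>]) (use F(3) in blast, erule that, assumption)
  define h where "h x = (\<epsilon> / 2) *\<^sub>R op_unit x + op_convolve (op_star b) b x" for x
  \<comment> \<open>The two halves of \<open>\<epsilon>\<close>, from \<open>h\<close> and from \<open>d\<close>, cancel against \<open>\<phi> R\<^sup>* R = \<phi> a - \<epsilon>\<close>.\<close>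
  have h: "entry (h x) u w = (if u - w = x then entry a u w else 0)" for x u w
  proof (cases "u - w = x")
    case True
    have u: "entry (op_unit x) u w = (if u = w then 1 else 0)"
      using True by (auto simp: op_unit_def entry_id)
    have "entry (op_adj d o\<^sub>L d) u w = complex_of_real (\<epsilon> / 2) * (if u = w then 1 else 0)
        + complex_of_real (1 - \<phi> x) * entry a u w"
      using \<epsilon> True by (simp add: dd X'(2) M_def entry_id field_simps)
    moreover have "complex_of_real (\<phi> x) * entry (op_adj R o\<^sub>L R) u w
        = complex_of_real (\<phi> x) * entry a u w - complex_of_real \<epsilon> * (if u = w then 1 else 0)"
    proof -
      have "\<phi> x = 1" if "u = w" using True that \<phi>0 by auto
      then show ?thesis by (simp add: RR entry_id algebra_simps)
    qed
    ultimately show ?thesis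
      using True by (simp add: h_def bb u flip: \<phi>_def) (simp add: algebra_simps)
  next
    case False
    then show ?thesis by (auto simp: h_def bb op_unit_def entry_id)
  qed
  have sym: "symmetric_algebra (l1_algebra ops_alg :: ('g \<Rightarrow> 'g operator) star_alg)"
    using rs cstar_algebra_ops_alg unfolding rigidly_symmetric_def by blast
  obtain c where c: "c \<in> l1_ops" "op_convolve c h = op_unit"
    using symmetric_left_inverse[OF sym b, of "\<epsilon> / 2"] \<epsilon> unfolding h_def[abs_def] by auto
  have h_l1: "h \<in> l1_ops"
  proof -
    have bl: "op_convolve (op_star b) b \<in> l1_ops" by (intro op_convolve_in_l1_ops op_star_in_l1_ops b)
    have "(\<lambda>x. (\<epsilon> / 2) * norm (op_unit x :: 'g operator) + norm (op_convolve (op_star b) b x)) summable_on UNIV"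
      using bl op_unit_in_l1_ops by (intro summable_on_add summable_on_cmult_right) (auto simp: l1_ops_def)
    then have "(\<lambda>x. norm (h x)) summable_on UNIV"
      by (rule summable_on_comparison_test)
        (use \<epsilon> in \<open>auto simp: h_def intro!: order_trans[OF norm_triangle_ineq]\<close>)
    then show ?thesis using bl op_unit_in_l1_ops by (auto simp: l1_ops_def h_def)
  qed
  \<comment> \<open>\<open>N\<close> keeps the \<open>g\<close>-th diagonal of each \<open>c\<^sub>g\<close>; this suffices since \<open>h\<^sub>g\<close> lives on the \<open>g\<close>-th diagonal.\<close>
  have cs: "(\<lambda>g. norm (c g)) summable_on UNIV" using c by (simp add: l1_ops_def)
  have cle: "cmod (entry (c (x - y)) x y) \<le> norm (c (x - y))" for x y by (rule cmod_entry_le)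
  obtain N where N: "dominated_by (\<lambda>g. norm (c g)) N" "\<And>x y. entry N x y = entry (c (x - y)) x y"
    using operator_of_matrix[of "\<lambda>g. norm (c g)" "\<lambda>x y. entry (c (x - y)) x y", OF cs cle] by metis
  have Nops: "N \<in> ell2_ops" using N by (simp add: dominated_by_def)
  have "N o\<^sub>L a = id_blinfun"
  proof (rule ell2_op_eqI)
    fix p q
    have summand: "entry (c y o\<^sub>L h (- y + (p - q))) p q = entry (c y) p (- y + p) * entry a (- y + p) q" for y
    proof (rule entry_comp_eqI)
      show "c y \<in> ell2_ops" using c by (simp add: l1_ops_def)
      have "z - q = - y + (p - q) \<longleftrightarrow> z = - y + p" for z
        by (simp add: diff_eq_eq add.assoc)
      then have "entry (c y) p z * entry (h (- y + (p - q))) z q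
          = (if z = - y + p then entry (c y) p (- y + p) * entry a (- y + p) q else 0)" for z
        by (simp add: h)
      then show "((\<lambda>z. entry (c y) p z * entry (h (- y + (p - q))) z q) has_sum
          entry (c y) p (- y + p) * entry a (- y + p) q) UNIV"
        using has_sum_singleton[of "- y + p" "\<lambda>z. entry (c y) p z * entry (h (- y + (p - q))) z q"] by simp
    qed
    have "((\<lambda>y. entry (c y) p (- y + p) * entry a (- y + p) q) has_sum entry (op_unit (p - q)) p q) UNIV"
      using has_sum_bounded_linear[OF bounded_linear_entry op_convolve_has_sum[OF c(1) h_l1], of "p - q" p q]
      by (simp add: summand c(2))
    then have "((\<lambda>z. entry (c (p - z)) p (- (p - z) + p) * entry a (- (p - z) + p) q) has_sum
        entry (op_unit (p - q)) p q) UNIV"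
      using has_sum_reindex_bij_betw[OF bij_diff_left[of p], of "\<lambda>y. entry (c y) p (- y + p) * entry a (- y + p) q"]
      by simp
    moreover have "- (p - z) + p = z" for z by (simp add: algebra_simps)
    ultimately have "entry (N o\<^sub>L a) p q = entry (op_unit (p - q)) p q"
      by (intro entry_comp_eqI[OF Nops]) (simp add: N(2))
    then show "entry (N o\<^sub>L a) p q = entry id_blinfun p q" by (auto simp: op_unit_def entry_id)
  qed (use Nops aops in auto)
  moreover have "a o\<^sub>L (S o\<^sub>L op_adj S) = id_blinfun"
  proof -
    have "a o\<^sub>L (S o\<^sub>L op_adj S) = op_adj T o\<^sub>L ((T o\<^sub>L S) o\<^sub>L op_adj S)"
      by (simp add: a_def blinfun_comp_assoc)
    then show ?thesis by (simp add: S(3) TS')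
  qed
  ultimately have "N = S o\<^sub>L op_adj S"
    by (metis blinfun_comp_assoc id_blinfun_comp)
  then show ?thesis using N(1) by (auto simp: dominated_def)
qed

text \<open>\<open>S = (S S\<^sup>*) T\<^sup>*\<close>.\<close>

lemma dominated_inverse:
  fixes T S :: "'g::group_add operator"
  assumes am: "amenable TYPE('g)" and rs: "rigidly_symmetric TYPE('g) TYPE('g operator)"
    and T: "dominated T" and S: "S \<in> ell2_ops" "S o\<^sub>L T = id_blinfun" "T o\<^sub>L S = id_blinfun"
  shows "dominated S"
proof -
  have "op_adj S o\<^sub>L op_adj T = id_blinfun"
    using op_adj_comp[OF dominated_in_ell2_ops[OF T] S(1)] S(3) by simp
  then have "S = (S o\<^sub>L op_adj S) o\<^sub>L op_adj T" by (simp add: blinfun_comp_assoc)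
  then show ?thesis
    using dominated_comp[OF dominated_gram_inverse[OF assms] dominated_op_adj[OF T]] by simp
qed

section \<open>Inverse closedness\<close>

text \<open>This makes \<open>1 - s T\<^sup>* T\<close> a strict contraction wherever \<open>T\<close> is bounded below.\<close>

lemma norm_id_minus_gram:
  assumes T: "T \<in> ell2_ops" and s: "0 \<le> s" "s * (norm T)\<^sup>2 \<le> 1"
  shows "(norm (v - s *\<^sub>R op_adj T (T v)))\<^sup>2 \<le> (norm v)\<^sup>2 - s * (norm (T v))\<^sup>2"
proof -
  have "ell2_cinner v (op_adj T (T v)) = complex_of_real ((norm (T v))\<^sup>2)"
    by (simp only: cinner_op_adj_right[OF T] cinner_self)
  then have 1: "Re (ell2_cinner v (s *\<^sub>R op_adj T (T v))) = s * (norm (T v))\<^sup>2"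
    by (simp add: scaleR_ell2_def cinner_scale_right flip: of_real_power)
  have "norm (op_adj T (T v)) \<le> norm T * norm (T v)"
    using norm_blinfun[of "op_adj T" "T v"] by (simp add: norm_op_adj[OF T])
  then have "(norm (op_adj T (T v)))\<^sup>2 \<le> (norm T)\<^sup>2 * (norm (T v))\<^sup>2"
    by (metis norm_ge_zero power_mono power_mult_distrib)
  then have "s * (s * (norm (op_adj T (T v)))\<^sup>2) \<le> s * (s * ((norm T)\<^sup>2 * (norm (T v))\<^sup>2))"
    using s by (intro mult_left_mono) auto
  also have "\<dots> = s * ((s * (norm T)\<^sup>2) * (norm (T v))\<^sup>2)" by simp
  also have "\<dots> \<le> s * (1 * (norm (T v))\<^sup>2)" using s by (intro mult_left_mono mult_right_mono) auto
  finally have 2: "(norm (s *\<^sub>R op_adj T (T v)))\<^sup>2 \<le> s * (norm (T v))\<^sup>2"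
    using s by (simp add: power_mult_distrib power2_eq_square mult_ac)
  show ?thesis using 2 unfolding norm_diff_sq 1 by simp
qed

context twisted_kernels
begin

text \<open>Domination of the inverse comes from the symmetric group algebra. That its diagonals lie in \<open>A\<close> follows
  from the Neumann series of \<open>(s T\<^sup>* T)\<inverse>\<close>, which converges in the operator norm.\<close>

theorem inverse_closed_int_ops:
  assumes am: "amenable TYPE('g)" and rs: "rigidly_symmetric TYPE('g) TYPE('g operator)"
  shows "inverse_closed (int_ops A lam)"
  unfolding inverse_closed_def
proof (intro ballI impI, elim conjE)
  fix T S :: "'g operator"
  assume "T \<in> int_ops A lam" and S: "S \<in> ell2_ops" "S o\<^sub>L T = id_blinfun" "T o\<^sub>L S = id_blinfun"
  then have T: "T \<in> diag_in_A" "dominated T" by (auto simp: int_ops_iff)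
  have Tops: "T \<in> ell2_ops" using T(1) by (rule diag_in_A_ops)
  define N where "N = S o\<^sub>L op_adj S"
  have N: "dominated N" unfolding N_def by (rule dominated_gram_inverse[OF am rs T(2) S])
  define a where "a = op_adj T o\<^sub>L T"
  have a: "a \<in> diag_in_A" "dominated a"
    unfolding a_def using T by (auto intro: diag_in_A_comp diag_in_A_op_adj dominated_comp dominated_op_adj)
  have TS': "op_adj T o\<^sub>L op_adj S = id_blinfun" "op_adj S o\<^sub>L op_adj T = id_blinfun"
    using op_adj_comp[OF S(1) Tops] op_adj_comp[OF Tops S(1)] S(2,3) by auto
  have "a o\<^sub>L N = op_adj T o\<^sub>L ((T o\<^sub>L S) o\<^sub>L op_adj S)" by (simp add: a_def N_def blinfun_comp_assoc)
  then have aN: "a o\<^sub>L N = id_blinfun" by (simp add: S(3) TS')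
  define s where "s = 1 / ((norm T)\<^sup>2 + 1)"
  have s: "s > 0" "s * (norm T)\<^sup>2 \<le> 1" by (simp_all add: s_def add_nonneg_pos divide_simps)
  define X where "X = id_blinfun - s *\<^sub>R a"
  define \<beta> where "\<beta> = 1 / ((norm S)\<^sup>2 + 1)"
  have \<beta>: "\<beta> > 0" by (simp add: \<beta>_def add_nonneg_pos)
  have lower: "\<beta> * (norm v)\<^sup>2 \<le> (norm (T v))\<^sup>2" for v
  proof -
    have "S (T v) = v" by (metis S(2) blinfun_apply_blinfun_compose blinfun_apply_id_blinfun)
    then have "norm v \<le> norm S * norm (T v)" using norm_blinfun[of S "T v"] by simp
    then have "(norm v)\<^sup>2 \<le> (norm S)\<^sup>2 * (norm (T v))\<^sup>2" by (metis norm_ge_zero power_mono power_mult_distrib)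
    also have "\<dots> \<le> ((norm S)\<^sup>2 + 1) * (norm (T v))\<^sup>2" by (intro mult_right_mono) auto
    finally show ?thesis by (simp add: \<beta>_def divide_simps add_nonneg_pos mult.commute)
  qed
  have "norm X \<le> sqrt (max 0 (1 - s * \<beta>))"
  proof (rule norm_blinfun_bound)
    fix v
    have "(norm (X v))\<^sup>2 \<le> (norm v)\<^sup>2 - s * (norm (T v))\<^sup>2"
      using norm_id_minus_gram[OF Tops _ s(2), of v] s(1)
      by (simp add: X_def a_def blinfun.diff_left blinfun.scaleR_left)
    also have "\<dots> \<le> (norm v)\<^sup>2 - s * (\<beta> * (norm v)\<^sup>2)"
      using mult_left_mono[OF lower[of v], of s] s(1) by simp
    also have "\<dots> = (1 - s * \<beta>) * (norm v)\<^sup>2" by (simp add: algebra_simps)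
    also have "\<dots> \<le> max 0 (1 - s * \<beta>) * (norm v)\<^sup>2" by (intro mult_right_mono) auto
    also have "\<dots> = (sqrt (max 0 (1 - s * \<beta>)) * norm v)\<^sup>2" by (simp add: power_mult_distrib)
    finally show "norm (X v) \<le> sqrt (max 0 (1 - s * \<beta>)) * norm v"
      by (rule power2_le_imp_le) simp
  qed simp
  also have "\<dots> < 1" using s(1) \<beta> by simp
  finally have X1: "norm X < 1" .
  have X: "X \<in> diag_in_A" "dominated X"
    unfolding X_def using a
    by (auto intro: diag_in_A_diff diag_in_A_id diag_in_A_scaleR dominated_diff dominated_id dominated_scaleR)
  obtain Z where Z: "Z \<in> diag_in_A" "Z o\<^sub>L (id_blinfun - X) = id_blinfun"
  proof (rule neumann_inverse[OF X1 closed_diag_in_A])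
    show "diag_in_A \<noteq> {}" using diag_in_A_id by blast
    show "id_blinfun + (X o\<^sub>L Y) \<in> diag_in_A" if "Y \<in> diag_in_A" for Y
      by (intro diag_in_A_add diag_in_A_id diag_in_A_comp X that)
  qed
  have "s *\<^sub>R Z = N"
  proof -
    have "(s *\<^sub>R Z) o\<^sub>L a = id_blinfun"
      using Z(2) by (simp add: X_def blinfun_compose.scaleR_left blinfun_compose.scaleR_right)
    then have "(s *\<^sub>R Z) o\<^sub>L (a o\<^sub>L N) = N" by (simp add: blinfun_comp_assoc[symmetric])
    then show ?thesis by (simp add: aN)
  qed
  then have "N \<in> diag_in_A" using diag_in_A_scaleR[OF Z(1), of s] by simp
  then have "N o\<^sub>L op_adj T \<in> diag_in_A" "dominated (N o\<^sub>L op_adj T)"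
    using N T by (auto intro: diag_in_A_comp diag_in_A_op_adj dominated_comp dominated_op_adj)
  moreover have "N o\<^sub>L op_adj T = S" by (simp add: N_def blinfun_comp_assoc TS')
  ultimately show "S \<in> int_ops A lam" by (simp add: int_ops_iff)
qed

end

section \<open>Fredholm inverse closedness\<close>

lemma bounded_bilinear_butterfly: "bounded_bilinear (butterfly :: 'a ell2 \<Rightarrow> 'a ell2 \<Rightarrow> _)"
proof
  fix u u' w w' :: "'a ell2" and r :: real
  show "butterfly (u + u') w = butterfly u w + butterfly u' w"
    by (rule blinfun_eqI) (simp add: blinfun.add_left ell2.scale_right_distrib)
  show "butterfly u (w + w') = butterfly u w + butterfly u w'"
    by (rule blinfun_eqI) (simp add: blinfun.add_left cinner_add_right ell2.scale_left_distrib)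
  show "butterfly (r *\<^sub>R u) w = r *\<^sub>R butterfly u w"
    by (rule blinfun_eqI) (simp add: blinfun.scaleR_left scaleR_ell2_def mult.commute)
  show "butterfly u (r *\<^sub>R w) = r *\<^sub>R butterfly u w"
    by (rule blinfun_eqI) (simp add: blinfun.scaleR_left scaleR_ell2_def cinner_scale_right)
  show "\<exists>K. \<forall>u w :: 'a ell2. norm (butterfly u w) \<le> norm u * norm w * K"
    using norm_butterfly_le by (intro exI[of _ 1]) auto
qed

lemma butterfly_finite_support_approx:
  fixes e :: "'a ell2"
  assumes "0 < \<delta>"
  obtains f where "finite {x. ell2_fun f x \<noteq> 0}" "norm (butterfly e e - butterfly f f) < \<delta>"
proof -
  let ?p = "\<lambda>F. \<Sum>x\<in>F. ell2_scale (ell2_fun e x) (ket x)"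
  have "(?p \<longlongrightarrow> e) (finite_subsets_at_top UNIV)"
    using has_sum_ket[of e] by (simp add: has_sum_def)
  then have "((\<lambda>F. butterfly (?p F) (?p F)) \<longlongrightarrow> butterfly e e) (finite_subsets_at_top UNIV)"
    by (intro bounded_bilinear.tendsto[OF bounded_bilinear_butterfly])
  then have "\<forall>\<^sub>F F in finite_subsets_at_top UNIV. dist (butterfly (?p F) (?p F)) (butterfly e e) < \<delta>"
    using assms by (rule tendstoD)
  then obtain F where F: "finite F" "dist (butterfly (?p F) (?p F)) (butterfly e e) < \<delta>"
    unfolding eventually_finite_subsets_at_top by blast
  have "finite {x. ell2_fun (?p F) x \<noteq> 0}"
    by (rule finite_subset[OF _ F(1)]) (auto elim!: sum.not_neutral_contains_not_neutral split: if_splits)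
  then show ?thesis using that[of "?p F"] F(2) by (simp add: dist_norm norm_minus_commute)
qed

lemma sum_butterfly_finite_matrix:
  fixes f :: "'i \<Rightarrow> 'g::group_add ell2"
  assumes E: "finite E" and f: "\<And>e. e \<in> E \<Longrightarrow> finite {x. ell2_fun (f e) x \<noteq> 0}" and P: "P \<in> ell2_ops"
  defines "Q \<equiv> (\<Sum>e\<in>E. butterfly (f e) (f e))"
  shows "dominated (Q o\<^sub>L P o\<^sub>L Q)" "dominated Q"
proof -
  define D where "D = (\<Union>e\<in>E. {x. ell2_fun (f e) x \<noteq> 0})"
  have D: "finite D" using E f by (auto simp: D_def)
  have Q: "Q v = (\<Sum>e\<in>E. ell2_scale (ell2_cinner v (f e)) (f e))" for v
    by (simp add: Q_def blinfun.sum_left)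
  have Qops: "Q \<in> ell2_ops" by (auto simp: Q_def)
  have row: "ell2_fun (Q v) x = 0" if "x \<notin> D" for v x
    unfolding Q ell2_fun_sum using that by (intro sum.neutral) (auto simp: D_def)
  have col: "Q (ket y) = 0" if "y \<notin> D" for y
  proof -
    have "ell2_cinner (ket y) (f e) = 0" if "e \<in> E" for e
      using \<open>y \<notin> D\<close> that by (subst ell2_cinner_commute) (auto simp: D_def)
    then show ?thesis unfolding Q by simp
  qed
  have dom: "dominated K" if "K \<in> ell2_ops" "\<And>x y. entry K x y \<noteq> 0 \<Longrightarrow> x \<in> D \<and> y \<in> D" for K
  proof (rule dominated_if_finite_matrix[OF that(1)])
    show "finite ((\<lambda>(x, y). x - y) ` {(x, y). entry K x y \<noteq> 0})"
      by (rule finite_subset[of _ "(\<lambda>(x, y). x - y) ` (D \<times> D)"]) (use that D in auto)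
  qed
  show "dominated Q"
  proof (rule dom[OF Qops])
    show "x \<in> D \<and> y \<in> D" if "entry Q x y \<noteq> 0" for x y
    proof -
      have "entry Q x y = 0" if "x \<notin> D" using row[OF that, of "ket y"] by (simp add: entry_def)
      moreover have "entry Q x y = 0" if "y \<notin> D" using col[OF that] by (simp add: entry_def)
      ultimately show ?thesis using that by blast
    qed
  qed
  show "dominated (Q o\<^sub>L P o\<^sub>L Q)"
  proof (rule dom)
    show "Q o\<^sub>L P o\<^sub>L Q \<in> ell2_ops" using Qops P by blast
    show "x \<in> D \<and> y \<in> D" if "entry (Q o\<^sub>L P o\<^sub>L Q) x y \<noteq> 0" for x y
    proof -
      have "entry (Q o\<^sub>L P o\<^sub>L Q) x y = 0" if "x \<notin> D"
        using row[OF that, of "P (Q (ket y))"] by (simp add: entry_def)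
      moreover have "entry (Q o\<^sub>L P o\<^sub>L Q) x y = 0" if "y \<notin> D"
        using col[OF that] by (simp add: entry_def)
      ultimately show ?thesis using that by blast
    qed
  qed
qed

context twisted_kernels
begin

text \<open>For Fredholm \<open>T\<close> let \<open>P\<close> be the projection onto the kernel, \<open>X = 1 - s T\<^sup>* T\<close> with small \<open>s\<close>. The operators
  \<open>X\<^sup>n\<close> converge to \<open>P\<close> in norm, which puts the diagonals of \<open>P\<close> into \<open>A\<close>. For domination let \<open>Q\<close> be a finite
  matrix close to \<open>P\<close>: then \<open>M = s T\<^sup>* T + Q\<close> is invertible with convolution-dominated inverse \<open>Z\<close>, and
  \<open>M P = Q P\<close> gives \<open>P = Z Q P\<close>, hence \<open>P = P P\<^sup>* = Z (Q P Q) Z\<^sup>*\<close> with a finite matrix in the middle. So \<open>P\<close>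
  belongs to the algebra, and \<open>(s T\<^sup>* T + P)\<inverse> s T\<^sup>*\<close> is a Fredholm inverse.\<close>

theorem fredholm_inverse_closed_int_ops:
  assumes am: "amenable TYPE('g)" and rs: "rigidly_symmetric TYPE('g) TYPE('g operator)"
  shows "fredholm_inverse_closed (int_ops A lam)"
  unfolding fredholm_inverse_closed_def
proof (intro ballI impI)
  fix T :: "'g operator"
  assume "T \<in> int_ops A lam" and fr: "fredholm T"
  then have T: "T \<in> diag_in_A" "dominated T" by (auto simp: int_ops_iff)
  have Tops: "T \<in> ell2_ops" using T(1) by (rule diag_in_A_ops)
  obtain B where B: "finite B" "{v. T v = 0} \<subseteq> ell2.span B" using fr by (auto simp: fredholm_def)
  obtain B' where B': "finite B'" "\<And>v. \<exists>u. v - T u \<in> ell2.span B'" using fr by (auto simp: fredholm_def)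
  define V where "V = {v. T v = 0}"
  have V: "ell2.subspace V"
    by (rule ell2.subspaceI) (auto simp: V_def blinfun.add_right ell2_ops_scale[OF Tops])
  obtain P E where E: "finite E" "P = (\<Sum>e\<in>E. butterfly e e)" and P: "selfadj P"
    "range (blinfun_apply P) \<subseteq> V" "\<And>v. v \<in> V \<Longrightarrow> P v = v"
    by (rule projection_ex[OF V B(1)]) (use B(2) in \<open>simp add: V_def\<close>, (rule that; assumption))
  have Pops: "P \<in> ell2_ops" "op_adj P = P" using P(1) by (auto simp: selfadj_def)
  have PV: "P v \<in> V" for v using P(2) by blast
  have TP: "T o\<^sub>L P = 0" by (rule blinfun_eqI) (use PV in \<open>auto simp: V_def\<close>)
  have PP: "P o\<^sub>L P = P" by (rule blinfun_eqI) (simp add: P(3) PV)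
  have PT: "P o\<^sub>L op_adj T = 0" using op_adj_comp[OF Tops Pops(1)] by (simp add: TP Pops(2))
  define s where "s = 1 / ((norm T)\<^sup>2 + 1)"
  have s: "s > 0" "s \<le> 1" "s * (norm T)\<^sup>2 \<le> 1" by (simp_all add: s_def add_nonneg_pos divide_simps)
  define a where "a = s *\<^sub>R (op_adj T o\<^sub>L T)"
  have a: "a \<in> diag_in_A" "dominated a"
    unfolding a_def using T
    by (auto intro: diag_in_A_scaleR diag_in_A_comp diag_in_A_op_adj dominated_scaleR dominated_comp dominated_op_adj)
  have aops: "a \<in> ell2_ops" using a(1) by (rule diag_in_A_ops)
  have aP: "a o\<^sub>L P = 0" by (simp add: a_def blinfun_compose.scaleR_left blinfun_comp_assoc TP)
  have Pa: "P o\<^sub>L a = 0"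
    by (simp add: a_def blinfun_compose.scaleR_right blinfun_comp_assoc[symmetric] PT)
  define X where "X = id_blinfun - a"
  have X: "X \<in> diag_in_A" "dominated X"
    unfolding X_def using a
    by (auto intro: diag_in_A_diff diag_in_A_id dominated_diff dominated_id)
  have XP: "X o\<^sub>L P = P" by (simp add: X_def blinfun_compose.diff_left aP)
  have PX: "P o\<^sub>L X = P" by (simp add: X_def blinfun_compose.diff_right Pa)
  \<comment> \<open>\<open>X\<close> is a strict contraction on the orthogonal complement of the kernel.\<close>
  obtain C where C: "C > 0" "\<And>y. y \<in> range (blinfun_apply T) \<Longrightarrow> \<exists>u. T u = y \<and> norm u \<le> C * norm y"
    using bounded_preimages_if_closed_range[of T] fr by (auto simp: fredholm_def)
  have orth: "ell2_cinner (v - P v) (P v) = 0" for v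
  proof -
    have "ell2_cinner (v - P v) (P v) = ell2_cinner (P (v - P v)) v"
      using cinner_op_adj_right[OF Pops(1), of "v - P v" v] by (simp add: Pops(2))
    also have "P (v - P v) = 0" by (simp add: blinfun.diff_right P(3) PV)
    finally show ?thesis by simp
  qed
  have contr: "norm (v - P v) \<le> norm v" for v
    by (rule power2_le_imp_le) (use pythagoras[OF orth[of v]] in simp_all)
  define D where "D = C + 1"
  have D: "D \<ge> 1" using C(1) by (simp add: D_def)
  have lower: "norm (v - P v) \<le> D * norm (T v)" for v
  proof -
    obtain u where u: "T u = T v" "norm u \<le> C * norm (T v)" using C(2)[of "T v"] by auto
    have "v - u \<in> V" using u(1) by (simp add: V_def blinfun.diff_right)
    then have "P (v - u) = v - u" by (rule P(3))
    then have "v - P v = u - P u" by (simp add: blinfun.diff_right algebra_simps)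
    then have "norm (v - P v) \<le> norm u" using contr[of u] by simp
    also have "\<dots> \<le> D * norm (T v)"
      using u(2) norm_ge_zero[of "T v"] unfolding D_def distrib_right by linarith
    finally show ?thesis .
  qed
  define \<rho> where "\<rho> = sqrt (1 - s / D\<^sup>2)"
  have sD: "s / D\<^sup>2 \<le> 1" "s / D\<^sup>2 > 0"
    using s D by (auto simp: divide_simps intro: order_trans[OF s(2) one_le_power])
  have \<rho>: "0 \<le> \<rho>" "\<rho> < 1" using sD by (auto simp: \<rho>_def)
  have XPn: "norm (X - P) \<le> \<rho>"
  proof (rule norm_blinfun_bound[OF \<rho>(1)])
    fix v
    define w where "w = v - P v"
    have Tw: "T w = T v" using PV[of v] by (simp add: w_def blinfun.diff_right V_def)
    have "norm w \<le> D * norm (T w)" using lower[of v] by (simp add: w_def[symmetric] Tw)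
    then have "(norm w)\<^sup>2 \<le> D\<^sup>2 * (norm (T w))\<^sup>2" by (metis norm_ge_zero power_mono power_mult_distrib)
    then have "(s / D\<^sup>2) * (norm w)\<^sup>2 \<le> s * (norm (T w))\<^sup>2"
      using s(1) D by (simp add: divide_simps mult.commute mult.left_commute)
    have "(X - P) v = w - s *\<^sub>R op_adj T (T w)"
      by (simp add: X_def a_def blinfun.diff_left blinfun.scaleR_left w_def[symmetric] Tw)
    then have "(norm ((X - P) v))\<^sup>2 \<le> (norm w)\<^sup>2 - s * (norm (T w))\<^sup>2"
      using norm_id_minus_gram[OF Tops _ s(3), of w] s(1) by simp
    also have "\<dots> \<le> (1 - s / D\<^sup>2) * (norm w)\<^sup>2"
      using \<open>(s / D\<^sup>2) * (norm w)\<^sup>2 \<le> s * (norm (T w))\<^sup>2\<close> by (simp add: left_diff_distrib)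
    also have "\<dots> \<le> (1 - s / D\<^sup>2) * (norm v)\<^sup>2"
      using sD contr[of v] by (intro mult_left_mono power_mono) (auto simp: w_def)
    also have "\<dots> = (\<rho> * norm v)\<^sup>2" using sD by (simp add: \<rho>_def power_mult_distrib)
    finally show "norm ((X - P) v) \<le> \<rho> * norm v"
      by (rule power2_le_imp_le) (simp add: \<rho>)
  qed
  \<comment> \<open>\<open>1 - (a + Q) = X - Q\<close> differs from the strict contraction \<open>X - P\<close> by \<open>P - Q\<close>.\<close>
  have inv: "\<exists>Z\<in>ell2_ops. Z o\<^sub>L (a + Q) = id_blinfun \<and> (a + Q) o\<^sub>L Z = id_blinfun"
    if Q: "Q \<in> ell2_ops" "norm (P - Q) < 1 - \<rho>" for Q
  proof -
    have "norm (X - Q) \<le> norm (X - P) + norm (P - Q)"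
      using norm_triangle_ineq[of "X - P" "P - Q"] by simp
    then have n1: "norm (X - Q) < 1" using XPn Q(2) by linarith
    have XQ: "X - Q \<in> ell2_ops" using X(1) Q(1) diag_in_A_ops by blast
    obtain Z where "Z \<in> ell2_ops" "(id_blinfun - (X - Q)) o\<^sub>L Z = id_blinfun" "Z o\<^sub>L (id_blinfun - (X - Q)) = id_blinfun"
    proof (rule neumann_inverse[OF n1 closed_ell2_ops])
      show "ell2_ops \<noteq> {}" using zero_in_ell2_ops by blast
      show "id_blinfun + ((X - Q) o\<^sub>L Y) \<in> ell2_ops" if "Y \<in> ell2_ops" for Y
        by (intro add_in_ell2_ops comp_in_ell2_ops id_in_ell2_ops XQ that)
    qed
    moreover have "id_blinfun - (X - Q) = a + Q" by (simp add: X_def)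
    ultimately show ?thesis by auto
  qed
  have P_diag: "P \<in> diag_in_A"
  proof -
    define W where "W n = (((o\<^sub>L) X) ^^ n) X" for n
    have W: "W 0 = X" "W (Suc n) = X o\<^sub>L W n" for n by (simp_all add: W_def)
    have Wd: "W n \<in> diag_in_A" for n by (induction n) (auto simp: W X diag_in_A_comp)
    have PW: "P o\<^sub>L W n = P" for n
      by (induction n) (simp_all add: W PX blinfun_comp_assoc[symmetric])
    have "norm (W n - P) \<le> \<rho> ^ Suc n" for n
    proof (induction n)
      case (Suc n)
      have "W (Suc n) - P = (X - P) o\<^sub>L (W n - P)"
        by (simp add: W blinfun_compose.diff_left blinfun_compose.diff_right XP PW PP)
      then have "norm (W (Suc n) - P) \<le> norm (X - P) * norm (W n - P)" by (metis norm_blinfun_compose)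
      also have "\<dots> \<le> \<rho> * \<rho> ^ Suc n" by (intro mult_mono XPn Suc) (auto simp: \<rho>)
      finally show ?case by simp
    qed (simp add: W XPn)
    moreover have "(\<lambda>n. \<rho> ^ Suc n) \<longlonglongrightarrow> 0" using \<rho> by (intro LIMSEQ_Suc LIMSEQ_power_zero) auto
    ultimately have "(\<lambda>n. W n - P) \<longlonglongrightarrow> 0" by (intro Lim_null_comparison[of "\<lambda>n. W n - P"]) auto
    then have "W \<longlonglongrightarrow> P" by (simp add: LIM_zero_iff)
    then show ?thesis using closed_diag_in_A Wd unfolding closed_sequential_limits by blast
  qed
  have P_dom: "dominated P"
  proof -
    define \<eta> where "\<eta> = (1 - \<rho>) / (real (card E) + 1)"
    have \<eta>: "\<eta> > 0" "real (card E) * \<eta> < 1 - \<rho>" using \<rho> by (auto simp: \<eta>_def field_simps)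
    have "\<exists>f. finite {x. ell2_fun f x \<noteq> 0} \<and> norm (butterfly e e - butterfly f f) < \<eta>" for e :: "'g ell2"
      by (rule butterfly_finite_support_approx[OF \<eta>(1), of e]) blast
    then obtain f where f: "\<And>e :: 'g ell2. finite {x. ell2_fun (f e) x \<noteq> 0}"
      "\<And>e. norm (butterfly e e - butterfly (f e) (f e)) < \<eta>" by metis
    define Q where "Q = (\<Sum>e\<in>E. butterfly (f e) (f e))"
    have "norm (P - Q) \<le> (\<Sum>e\<in>E. norm (butterfly e e - butterfly (f e) (f e)))"
      unfolding E(2) Q_def sum_subtractf[symmetric] by (rule norm_sum)
    also have "\<dots> \<le> (\<Sum>e\<in>E. \<eta>)" using f(2) by (intro sum_mono less_imp_le)
    finally have nQ: "norm (P - Q) < 1 - \<rho>" using \<eta>(2) by simp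
    have Qops: "Q \<in> ell2_ops" by (auto simp: Q_def)
    have Qadj: "op_adj Q = Q"
    proof -
      have "op_adj (\<Sum>e\<in>G. butterfly (f e) (f e)) = (\<Sum>e\<in>G. butterfly (f e) (f e))" if "finite G" for G
        using that by (induction G rule: finite_induct) (auto simp: op_adj_add[OF _ sum_in_ell2_ops] op_adj_butterfly)
      then show ?thesis using E(1) by (simp add: Q_def)
    qed
    note dQ = sum_butterfly_finite_matrix[of E f P, OF E(1) f(1) Pops(1), folded Q_def]
    obtain Z where Z: "Z \<in> ell2_ops" "Z o\<^sub>L (a + Q) = id_blinfun" "(a + Q) o\<^sub>L Z = id_blinfun"
      using inv[OF Qops nQ] by blast
    have Zdom: "dominated Z"
      by (rule dominated_inverse[OF am rs dominated_add[OF a(2) dQ(2)] Z])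
    have 1: "P = Z o\<^sub>L (Q o\<^sub>L P)"
    proof -
      have "P = (Z o\<^sub>L (a + Q)) o\<^sub>L P" by (simp add: Z(2))
      also have "\<dots> = Z o\<^sub>L ((a o\<^sub>L P) + (Q o\<^sub>L P))"
        unfolding blinfun_comp_assoc blinfun_compose.add_left ..
      finally show ?thesis by (simp add: aP)
    qed
    have "op_adj P = (P o\<^sub>L Q) o\<^sub>L op_adj Z"
      by (subst 1) (use Z(1) Qops Pops in \<open>simp add: op_adj_comp comp_in_ell2_ops Qadj\<close>)
    then have 2: "P = (P o\<^sub>L Q) o\<^sub>L op_adj Z" by (simp add: Pops(2))
    have "P = P o\<^sub>L P" by (simp add: PP)
    also have "\<dots> = (Z o\<^sub>L (Q o\<^sub>L P)) o\<^sub>L ((P o\<^sub>L Q) o\<^sub>L op_adj Z)" using 1 2 by simp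
    also have "\<dots> = Z o\<^sub>L (Q o\<^sub>L (P o\<^sub>L P) o\<^sub>L Q) o\<^sub>L op_adj Z" by (simp only: blinfun_comp_assoc)
    also have "\<dots> = Z o\<^sub>L (Q o\<^sub>L P o\<^sub>L Q) o\<^sub>L op_adj Z" by (simp only: PP)
    finally have "P = Z o\<^sub>L (Q o\<^sub>L P o\<^sub>L Q) o\<^sub>L op_adj Z" .
    moreover have "dominated (Z o\<^sub>L (Q o\<^sub>L P o\<^sub>L Q) o\<^sub>L op_adj Z)"
      by (intro dominated_comp dominated_op_adj Zdom dQ(1))
    ultimately show ?thesis by simp
  qed
  obtain Z where Z: "Z \<in> ell2_ops" "Z o\<^sub>L (a + P) = id_blinfun" "(a + P) o\<^sub>L Z = id_blinfun"
    using inv[OF Pops(1)] \<rho> by auto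
  have "a + P \<in> int_ops A lam"
    using a P_diag P_dom by (auto simp: int_ops_iff intro: diag_in_A_add dominated_add)
  then have "Z \<in> int_ops A lam"
    using inverse_closed_int_ops[OF am rs] Z unfolding inverse_closed_def by blast
  then have Z': "Z \<in> diag_in_A" "dominated Z" by (auto simp: int_ops_iff)
  define S where "S = Z o\<^sub>L (s *\<^sub>R op_adj T)"
  have S: "S \<in> int_ops A lam"
    unfolding S_def int_ops_iff using Z' T
    by (auto intro: diag_in_A_comp diag_in_A_scaleR diag_in_A_op_adj dominated_comp dominated_scaleR dominated_op_adj)
  then have Sops: "S \<in> ell2_ops" by (auto simp: int_ops_iff diag_in_A_def)
  have ZP: "Z o\<^sub>L P = P"
  proof -
    have "P = (Z o\<^sub>L (a + P)) o\<^sub>L P" by (simp add: Z(2))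
    also have "\<dots> = Z o\<^sub>L ((a o\<^sub>L P) + (P o\<^sub>L P))"
      unfolding blinfun_comp_assoc blinfun_compose.add_left ..
    finally show ?thesis by (simp add: aP PP)
  qed
  have ST: "S o\<^sub>L T = id_blinfun + (- P)"
  proof -
    have "S o\<^sub>L T = Z o\<^sub>L a"
      by (simp add: S_def a_def blinfun_comp_assoc blinfun_compose.scaleR_left blinfun_compose.scaleR_right)
    also have "\<dots> = (Z o\<^sub>L (a + P)) - (Z o\<^sub>L P)" by (simp add: blinfun_compose.add_right)
    finally show ?thesis by (simp add: Z(2) ZP)
  qed
  define L where "L = (T o\<^sub>L S) - id_blinfun"
  have Lops: "L \<in> ell2_ops" using Tops Sops by (auto simp: L_def)
  have LT: "L (T u) = 0" for u
  proof -
    have "S (T u) = u - P u"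
      using arg_cong[OF ST, of "\<lambda>R. blinfun_apply R u"] by (simp add: blinfun.diff_left)
    then show ?thesis using PV[of u] by (simp add: L_def V_def blinfun.diff_left blinfun.diff_right)
  qed
  have "- P \<in> compact_ops"
  proof (rule finite_rank_compact[OF _ B(1)])
    have "- P v \<in> V" for v using ell2.subspace_neg[OF V PV[of v]] .
    then show "range (blinfun_apply (- P)) \<subseteq> ell2.span B"
      using B(2) by (auto simp: blinfun.minus_left V_def)
  qed (use Pops in auto)
  moreover have "L \<in> compact_ops"
  proof (rule finite_rank_compact[OF Lops, of "blinfun_apply L ` B'"])
    show "finite (blinfun_apply L ` B')" using B'(1) by simp
    have "ell2.subspace {v. L v \<in> ell2.span (blinfun_apply L ` B')}"
      by (rule ell2.subspaceI)
        (auto simp: blinfun.add_right ell2_ops_scale[OF Lops] ell2.span_add ell2.span_scale ell2.span_zero)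
    then have sub: "ell2.span B' \<subseteq> {v. L v \<in> ell2.span (blinfun_apply L ` B')}"
      by (intro ell2.span_minimal) (auto intro: ell2.span_base)
    show "range (blinfun_apply L) \<subseteq> ell2.span (blinfun_apply L ` B')"
    proof safe
      fix v
      obtain u where "v - T u \<in> ell2.span B'" using B'(2) by blast
      then have "L (v - T u) \<in> ell2.span (blinfun_apply L ` B')" using sub by blast
      then show "L v \<in> ell2.span (blinfun_apply L ` B')" by (simp add: blinfun.diff_right LT)
    qed
  qed
  moreover have "T o\<^sub>L S = id_blinfun + L" by (simp add: L_def)
  ultimately show "\<exists>S\<in>int_ops A lam. \<exists>K\<in>compact_ops. \<exists>L\<in>compact_ops.
      S o\<^sub>L T = id_blinfun + K \<and> T o\<^sub>L S = id_blinfun + L"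
    using S ST by blast
qed

end

theorem corollary3p14:
  fixes A :: "('g::group_add \<Rightarrow> complex) set"
    and \<omega> :: "'g \<Rightarrow> 'g \<Rightarrow> 'g \<Rightarrow> complex"
  assumes "amenable TYPE('g)"
    and "rigidly_symmetric TYPE('g) TYPE('g ell2 \<Rightarrow>\<^sub>L 'g ell2)"
    and "unital_cstar_subalgebra_linf A"
    and "translation_invariant A"
    and "two_cocycle A \<omega>"
  shows "star_subalgebra (int_ops A (cocycle_lambda \<omega>)) \<and>
         inverse_closed (int_ops A (cocycle_lambda \<omega>)) \<and>
         fredholm_inverse_closed (int_ops A (cocycle_lambda \<omega>))"
proof -
  interpret twisted_kernels A \<omega>
    using assms by unfold_locales
  show ?thesis
    using star_subalgebra_int_ops inverse_closed_int_ops fredholm_inverse_closed_int_ops assms by blast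
qed

end
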